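(* Up to isomorphism of Hopf algebras, there are exactly three isomorphism classes among the Hopf algebras $\mathcal{A}_{\alpha,\beta}$, $(\alpha,\beta)\in K^2$: 1. the class formed by the $\mathcal{A}_{1,\beta}$'s with $\beta\neq-1$; these are isomorphic to the Faà di Bruno Hopf algebra $\mathcal{H}_{FdB}$ on one variable; 2. the class of $\mathcal{A}_{1,-1}$, which is isomorphic to $Sym$, the Hopf algebra of symmetric functions; it is commutative and cocommutative; 3. the class of $\mathcal{A}_{0,1}=K[\bullet]$.
   Context: $K$ is a field of characteristic zero. A rooted tree is a finite connected graph without cycles with a distinguished root, up to isomorphism; its weight is its number of vertices; $\bullet$ is the tree of weight $1$. $\mathcal{H}_{CK}$ (Connes-Kreimer Hopf algebra) is, as an algebra, the free commutative unital $K$-algebra generated by rooted trees, graded by weight. $B^+$ is the linear operator sending a forest to the tree obtained by grafting its trees on a common new root ($B^+(1)=\bullet$). The coproduct is the unique algebra morphism with $\Delta(B^+(x))=B^+(x)\otimes1+(\mathrm{Id}\otimes B^+)\circ\Delta(x)$ for all $x$; $\mathcal{H}_{CK}$ is a graded connected Hopf algebra. $\overline{\mathcal{H}_{CK}}$ is the product of its homogeneous components. For $(\alpha,\beta)\in K^2$, $P_{\alpha,\beta}\in K[[h]]$ is the unique solution of $(1-\alpha\beta h)P'(h)=\alpha P(h)$, $P(0)=1$; $\sum_{n\ge1}a_n(\alpha,\beta)\in\overline{\mathcal{H}_{CK}}$ ($a_n$ homogeneous of degree $n$) is the unique solution of $X=B^+(P_{\alpha,\beta}(X))$, and $\mathcal{A}_{\alpha,\beta}$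 is the subalgebra of $\mathcal{H}_{CK}$ generated by the $a_n(\alpha,\beta)$, $n\ge1$; it is a Hopf subalgebra. For all $\alpha\neq0$, $\mathcal{A}_{\alpha,\beta}=\mathcal{A}_{1,\beta}$, and for all $\beta$, $\mathcal{A}_{0,\beta}=\mathcal{A}_{0,1}$. The Faà di Bruno Hopf algebra $\mathcal{H}_{FdB}$ is the Hopf algebra of functions on the opposite of the group $G=\{h+\sum_{n\ge1}a_nh^{n+1}\in K[[h]]\}$ (with composition): it is the polynomial ring $K[Y_1,Y_2,\ldots]$, where $Y_i$ is the function sending $h+\sum_{n\ge1}a_nh^{n+1}$ to $a_i$, with coproduct determined by $\Delta(f)(P\otimes Q)=f(Q\circ P)$ for $P,Q\in G$. *)

theory Defs
  imports
    "HOL-Library.Multiset"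
    "HOL-Library.Poly_Mapping"
    "HOL-Library.Product_Plus"
    "HOL-Library.Function_Algebras"
    "HOL-Computational_Algebra.Formal_Power_Series"
begin

section \<open>Hopf algebras with a concrete tensor square\<close>

text \<open>
  The data of a Hopf algebra over \<open>'k\<close> with carrier in \<open>'a\<close>. Addition is that of the type
  \<open>'a\<close>. The vector space \<open>'t\<close> contains the tensor square of the carrier: \<open>tens\<close> is bilinear,
  and the induced linear map from the tensor square of the carrier to \<open>'t\<close> is injective in each
  of the instances below. The antipode is not part of the data, since it is determined by the
  bialgebra structure and preserved by every morphism of bialgebras.
\<close>

record ('k, 'a, 't) hopf =
  carr :: "'a set"
  unit :: 'a
  mult :: "'a \<Rightarrow> 'a \<Rightarrow> 'a"
  scal :: "'k \<Rightarrow> 'a \<Rightarrow> 'a"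
  tens :: "'a \<Rightarrow> 'a \<Rightarrow> 't"
  counit :: "'a \<Rightarrow> 'k"
  comult :: "'a \<Rightarrow> 't"

inductive_set gen_subalg :: "('k, 'a::ab_group_add, 't) hopf \<Rightarrow> 'a set \<Rightarrow> 'a set"
  for H :: "('k, 'a, 't) hopf" and S :: "'a set" where
  gen: "x \<in> S \<Longrightarrow> x \<in> gen_subalg H S"
| unit: "unit H \<in> gen_subalg H S"
| add: "x \<in> gen_subalg H S \<Longrightarrow> y \<in> gen_subalg H S \<Longrightarrow> x + y \<in> gen_subalg H S"
| scal: "x \<in> gen_subalg H S \<Longrightarrow> scal H c x \<in> gen_subalg H S"
| mult: "x \<in> gen_subalg H S \<Longrightarrow> y \<in> gen_subalg H S \<Longrightarrow> mult H x y \<in> gen_subalg H S"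

definition alg_hom ::
    "('k, 'a::ab_group_add, 't) hopf \<Rightarrow> ('k, 'b::ab_group_add, 'u) hopf \<Rightarrow> ('a \<Rightarrow> 'b) \<Rightarrow> bool" where
  "alg_hom H H' \<phi> \<longleftrightarrow>
     (\<forall>x\<in>carr H. \<phi> x \<in> carr H') \<and>
     \<phi> (unit H) = unit H' \<and>
     (\<forall>x\<in>carr H. \<forall>y\<in>carr H. \<phi> (x + y) = \<phi> x + \<phi> y) \<and>
     (\<forall>c. \<forall>x\<in>carr H. \<phi> (scal H c x) = scal H' c (\<phi> x)) \<and>
     (\<forall>x\<in>carr H. \<forall>y\<in>carr H. \<phi> (mult H x y) = mult H' (\<phi> x) (\<phi> y))"

text \<open>
  The comultiplication clause says that \<open>comult H x\<close> lies in the tensor square of the carrier and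
  that \<open>\<phi> \<otimes> \<phi>\<close> maps it to \<open>comult H' (\<phi> x)\<close>. By injectivity of the tensor models the choice
  of the list \<open>ts\<close> does not matter.
\<close>

definition coalg_hom ::
    "('k, 'a, 't::comm_monoid_add) hopf \<Rightarrow> ('k, 'b, 'u::comm_monoid_add) hopf \<Rightarrow> ('a \<Rightarrow> 'b) \<Rightarrow> bool" where
  "coalg_hom H H' \<phi> \<longleftrightarrow>
     (\<forall>x\<in>carr H. counit H' (\<phi> x) = counit H x) \<and>
     (\<forall>x\<in>carr H. \<exists>ts. set ts \<subseteq> carr H \<times> carr H \<and>
        comult H x = (\<Sum>(a, b)\<leftarrow>ts. tens H a b) \<and>
        comult H' (\<phi> x) = (\<Sum>(a, b)\<leftarrow>ts. tens H' (\<phi> a) (\<phi> b)))"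

definition hopf_iso ::
    "('k, 'a::ab_group_add, 't::comm_monoid_add) hopf \<Rightarrow>
     ('k, 'b::ab_group_add, 'u::comm_monoid_add) hopf \<Rightarrow> bool"  (infix "\<cong>\<^sub>H" 50) where
  "H \<cong>\<^sub>H H' \<longleftrightarrow> (\<exists>\<phi>. bij_betw \<phi> (carr H) (carr H') \<and> alg_hom H H' \<phi> \<and> coalg_hom H H' \<phi>)"

definition commutative :: "('k, 'a, 't) hopf \<Rightarrow> bool" where
  "commutative H \<longleftrightarrow> (\<forall>x\<in>carr H. \<forall>y\<in>carr H. mult H x y = mult H y x)"

definition cocommutative :: "('k, 'a, 't::comm_monoid_add) hopf \<Rightarrow> bool" where
  "cocommutative H \<longleftrightarrow>
     (\<forall>x\<in>carr H. \<exists>ts. set ts \<subseteq> carr H \<times> carr H \<and>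
        comult H x = (\<Sum>(a, b)\<leftarrow>ts. tens H a b) \<and>
        comult H x = (\<Sum>(a, b)\<leftarrow>ts. tens H b a))"

definition iso_rel ::
    "('k, 'a::ab_group_add, 't::comm_monoid_add) hopf set \<Rightarrow>
     (('k, 'a, 't) hopf \<times> ('k, 'a, 't) hopf) set" where
  "iso_rel \<A> = {(H, H'). H \<in> \<A> \<and> H' \<in> \<A> \<and> H \<cong>\<^sub>H H'}"


section \<open>The Connes-Kreimer Hopf algebra\<close>

text \<open>
  A rooted tree up to isomorphism is determined by the multiset of its branches at the root.
  A forest is a multiset of trees, and multisets under addition are the free commutative
  monoid, so the free commutative algebra on trees is the monoid algebra of forests. Its tensor
  square is the monoid algebra of pairs of forests.
\<close>

datatype rtree = Node "rtree multiset"

type_synonym forest = "rtree multiset"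
type_synonym 'k ck = "forest \<Rightarrow>\<^sub>0 'k"
type_synonym 'k ck2 = "(forest \<times> forest) \<Rightarrow>\<^sub>0 'k"

primrec weight :: "rtree \<Rightarrow> nat" where
  "weight (Node F) = Suc (\<Sum>\<^sub># (image_mset weight F))"

definition fweight :: "forest \<Rightarrow> nat" where
  "fweight F = (\<Sum>t\<in>#F. weight t)"

definition homogeneous :: "nat \<Rightarrow> 'k::zero ck \<Rightarrow> bool" where
  "homogeneous n x \<longleftrightarrow> (\<forall>F\<in>Poly_Mapping.keys x. fweight F = n)"

definition lin_ext :: "('m \<Rightarrow> ('n \<Rightarrow>\<^sub>0 'k)) \<Rightarrow> ('m \<Rightarrow>\<^sub>0 'k::comm_ring_1) \<Rightarrow> ('n \<Rightarrow>\<^sub>0 'k)" where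
  "lin_ext f x = (\<Sum>m\<in>Poly_Mapping.keys x. Poly_Mapping.map ((*) (Poly_Mapping.lookup x m)) (f m))"

definition tree_elt :: "rtree \<Rightarrow> 'k::comm_ring_1 ck" where
  "tree_elt t = Poly_Mapping.single {#t#} 1"

definition Bplus :: "'k::comm_ring_1 ck \<Rightarrow> 'k ck" where
  "Bplus = lin_ext (\<lambda>F. tree_elt (Node F))"

definition id_Bplus :: "'k::comm_ring_1 ck2 \<Rightarrow> 'k ck2" where
  "id_Bplus = lin_ext (\<lambda>(F, G). Poly_Mapping.single (F, {#Node G#}) 1)"

definition ck_tens :: "'k::comm_ring_1 ck \<Rightarrow> 'k ck \<Rightarrow> 'k ck2" where
  "ck_tens x y = lin_ext (\<lambda>F. lin_ext (\<lambda>G. Poly_Mapping.single (F, G) 1) y) x"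

primrec tree_comult :: "rtree \<Rightarrow> 'k::comm_ring_1 ck2" where
  "tree_comult (Node F) =
     ck_tens (tree_elt (Node F)) 1 + id_Bplus (\<Prod>\<^sub># (image_mset tree_comult F))"

definition ck_comult :: "'k::comm_ring_1 ck \<Rightarrow> 'k ck2" where
  "ck_comult = lin_ext (\<lambda>F. \<Prod>t\<in>#F. tree_comult t)"

definition H_CK :: "('k::comm_ring_1, 'k ck, 'k ck2) hopf" where
  "H_CK = \<lparr>carr = UNIV, unit = 1, mult = (*), scal = (\<lambda>c. Poly_Mapping.map ((*) c)),
           tens = ck_tens, counit = (\<lambda>x. Poly_Mapping.lookup x {#}), comult = ck_comult\<rparr>"

lemma lookup_sum_pm: "finite S \<Longrightarrow> Poly_Mapping.lookup (\<Sum>m\<in>S. g m) n = (\<Sum>m\<in>S. Poly_Mapping.lookup (g m) n)"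
  by (induction S rule: finite_induct) (auto simp: lookup_add)

lemma lookup_scale: "Poly_Mapping.lookup (Poly_Mapping.map ((*) (c::'k::comm_ring_1)) p) n = c * Poly_Mapping.lookup p n"
  by (simp add: Poly_Mapping.map.rep_eq when_def)

lemma lookup_lin_ext:
  assumes "finite S" "Poly_Mapping.keys x \<subseteq> S"
  shows "Poly_Mapping.lookup (lin_ext f x) n = (\<Sum>m\<in>S. Poly_Mapping.lookup x m * Poly_Mapping.lookup (f m) n)"
  unfolding lin_ext_def using assms
  by (subst lookup_sum_pm, simp) (auto simp: lookup_scale in_keys_iff intro!: sum.mono_neutral_left)

lemma lin_ext_add: "lin_ext f (x + y) = lin_ext f x + lin_ext f y"
proof (rule poly_mapping_eqI)
  fix n
  let ?S = "Poly_Mapping.keys x \<union> Poly_Mapping.keys y"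
  have "finite ?S" "Poly_Mapping.keys (x + y) \<subseteq> ?S" using keys_add[of x y] by auto
  then show "Poly_Mapping.lookup (lin_ext f (x + y)) n = Poly_Mapping.lookup (lin_ext f x + lin_ext f y) n"
    by (simp add: lookup_lin_ext[of ?S] lookup_add distrib_right sum.distrib)
qed

lemma lin_ext_single: "lin_ext f (Poly_Mapping.single m c) = Poly_Mapping.map ((*) c) (f m)"
  by (rule poly_mapping_eqI) (simp add: lookup_lin_ext[of "{m}"] lookup_scale)

lemma poly_mapping_single_induct:
  assumes "P 0" "\<And>m c. P (Poly_Mapping.single m c)" "\<And>x y. P x \<Longrightarrow> P y \<Longrightarrow> P (x + y)"
  shows "P (x :: 'm \<Rightarrow>\<^sub>0 'k::comm_ring_1)"
proof -
  have eq: "x = (\<Sum>m\<in>Poly_Mapping.keys x. Poly_Mapping.single m (Poly_Mapping.lookup x m))"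
    by (rule poly_mapping_eqI) (simp add: lookup_sum_pm lookup_single when_def in_keys_iff)
  have "finite S \<Longrightarrow> P (\<Sum>m\<in>S. Poly_Mapping.single m (Poly_Mapping.lookup x m))" for S
    by (induction S rule: finite_induct) (auto intro: assms)
  then show ?thesis using eq by (metis finite_keys)
qed

lemma lin_ext_mult:
  fixes f :: "'m::comm_monoid_add \<Rightarrow> ('n::comm_monoid_add \<Rightarrow>\<^sub>0 'k::comm_ring_1)"
  assumes "\<And>m n. f (m + n) = f m * f n"
  shows "lin_ext f (x * y) = lin_ext f x * lin_ext f y"
proof (induction x rule: poly_mapping_single_induct)
  case (2 m c)
  show ?case
  proof (induction y rule: poly_mapping_single_induct)
    case (2 n d)
    show ?case
      by (simp add: mult_single lin_ext_single assms mult_map_scale_conv_mult)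
        (metis (no_types, lifting) add_0 mult.assoc mult.commute mult_single)
  qed (simp_all add: lin_ext_add distrib_left, simp add: lin_ext_def)
qed (simp_all add: lin_ext_add distrib_right, simp add: lin_ext_def)

lemma ck_comult_mult: "ck_comult (x * y) = ck_comult x * ck_comult y"
  unfolding ck_comult_def by (rule lin_ext_mult) simp

lemma ck_comult_1: "ck_comult 1 = 1"
  unfolding ck_comult_def single_one[symmetric]
  by (simp del: single_one add: lin_ext_single mult_map_scale_conv_mult)

lemma ck_tens_single: "ck_tens (Poly_Mapping.single F a) (Poly_Mapping.single G b) = Poly_Mapping.single (F,G) (a*b)"
  by (simp add: ck_tens_def lin_ext_single)

lemma ck_comult_Bplus: "ck_comult (Bplus x) = ck_tens (Bplus x) 1 + id_Bplus (ck_comult x)"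
proof (induction x rule: poly_mapping_single_induct)
  case 1 show ?case by (simp add: ck_comult_def Bplus_def ck_tens_def id_Bplus_def lin_ext_def)
next
  case (2 m c)
  have s: "id_Bplus (Poly_Mapping.map ((*) c) z) = Poly_Mapping.map ((*) c) (id_Bplus z)" for z :: "'a ck2"
    apply (induction z rule: poly_mapping_single_induct)
      apply (simp add: id_Bplus_def lin_ext_def mult_map_scale_conv_mult)
     apply (simp add: id_Bplus_def lin_ext_single mult_single mult_map_scale_conv_mult split: prod.splits)
    apply (simp add: id_Bplus_def mult_map_scale_conv_mult distrib_left lin_ext_add)
    done
  have one: "1 = Poly_Mapping.single {#} (1::'a)" by simp
  show ?case
    apply (simp add: ck_comult_def Bplus_def lin_ext_single tree_elt_def s)
    apply (simp only: one ck_tens_single)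
    apply (simp add: mult_map_scale_conv_mult distrib_left mult_single)
    done
next
  case (3 x y)
  have t: "ck_tens (x + y) z = ck_tens x z + ck_tens y z" for x y z :: "'a ck"
    by (simp add: ck_tens_def lin_ext_add)
  have b: "Bplus (x + y) = Bplus x + Bplus y" for x y :: "'a ck" by (simp add: Bplus_def lin_ext_add)
  have c: "ck_comult (x + y) = ck_comult x + ck_comult y" for x y :: "'a ck" by (simp add: ck_comult_def lin_ext_add)
  have i: "id_Bplus (x + y) = id_Bplus x + id_Bplus y" for x y :: "'a ck2" by (simp add: id_Bplus_def lin_ext_add)
  show ?case using 3 by (simp add: t b c i)
qed


section \<open>Dyson-Schwinger equations\<close>

definition P_series :: "'k::field_char_0 \<Rightarrow> 'k \<Rightarrow> 'k fps" where
  "P_series \<alpha> \<beta> =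
     (THE P. (1 - fps_const (\<alpha> * \<beta>) * fps_X) * fps_deriv P = fps_const \<alpha> * P \<and> fps_nth P 0 = 1)"

text \<open>
  An element \<open>\<Sum>\<^sub>n x\<^sub>n\<close> of the completion, with \<open>x\<^sub>n\<close> homogeneous of degree \<open>n\<close>, is encoded as the
  power series \<open>\<Sum>\<^sub>n x\<^sub>n t\<^sup>n\<close> over \<open>'k ck\<close>, which makes the completion a subalgebra of \<open>'k ck fps\<close>.
  As \<open>Bplus\<close> raises degrees by one, it is accompanied by a multiplication by \<open>t\<close>.
\<close>

definition completed_Bplus :: "'k::comm_ring_1 ck fps \<Rightarrow> 'k ck fps" where
  "completed_Bplus X = fps_X * Abs_fps (\<lambda>n. Bplus (fps_nth X n))"

definition scalar_fps :: "'k::comm_ring_1 fps \<Rightarrow> 'k ck fps" where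
  "scalar_fps P = Abs_fps (\<lambda>n. Poly_Mapping.single {#} (fps_nth P n))"

definition DS_solution :: "'k::field_char_0 \<Rightarrow> 'k \<Rightarrow> 'k ck fps" where
  "DS_solution \<alpha> \<beta> =
     (THE X. fps_nth X 0 = 0 \<and> (\<forall>n. homogeneous n (fps_nth X n)) \<and>
             X = completed_Bplus (fps_compose (scalar_fps (P_series \<alpha> \<beta>)) X))"

definition a_elt :: "'k::field_char_0 \<Rightarrow> 'k \<Rightarrow> nat \<Rightarrow> 'k ck" where
  "a_elt \<alpha> \<beta> n = fps_nth (DS_solution \<alpha> \<beta>) n"

definition A_hopf :: "'k::field_char_0 \<Rightarrow> 'k \<Rightarrow> ('k, 'k ck, 'k ck2) hopf" where
  "A_hopf \<alpha> \<beta> = H_CK\<lparr>carr := gen_subalg H_CK {a_elt \<alpha> \<beta> n | n. n \<ge> 1}\<rparr>"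

definition A_family :: "('k::field_char_0, 'k ck, 'k ck2) hopf set" where
  "A_family = {A_hopf \<alpha> \<beta> | \<alpha> \<beta>. True}"

definition K_bullet :: "('k::field_char_0, 'k ck, 'k ck2) hopf" where
  "K_bullet = H_CK\<lparr>carr := gen_subalg H_CK {tree_elt (Node {#})}\<rparr>"

lemma P_series_iff: "((1 - fps_const (\<alpha> * \<beta>) * fps_X) * fps_deriv P = fps_const \<alpha> * P) \<longleftrightarrow>
  (\<forall>n. of_nat (Suc n) * fps_nth P (Suc n) = \<alpha> * fps_nth P n + \<alpha> * \<beta> * (of_nat n * fps_nth P n))"
  for \<alpha> :: "'k::field_char_0"
proof -
  have "fps_nth ((1 - fps_const (\<alpha> * \<beta>) * fps_X) * fps_deriv P) n = of_nat (Suc n) * fps_nth P (Suc n) - \<alpha> * \<beta> * (of_nat n * fps_nth P n)" for n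
    by (cases n) (simp_all add: left_diff_distrib mult.assoc)
  then show ?thesis by (simp add: fps_eq_iff algebra_simps)
qed

lemma P_series_ex1: "\<exists>!P. (1 - fps_const (\<alpha> * \<beta>) * fps_X) * fps_deriv P = fps_const \<alpha> * P \<and> fps_nth P 0 = 1"
  for \<alpha> :: "'k::field_char_0"
proof -
  define p where "p = rec_nat 1 (\<lambda>n x. (\<alpha> * x + \<alpha> * \<beta> * (of_nat n * x)) / of_nat (Suc n) :: 'k)"
  have p: "p 0 = 1" "\<And>n. p (Suc n) = (\<alpha> * p n + \<alpha> * \<beta> * (of_nat n * p n)) / of_nat (Suc n)" by (simp_all add: p_def)
  show ?thesis unfolding P_series_iff
  proof (rule ex1I[of _ "Abs_fps p"])
    show "(\<forall>n. of_nat (Suc n) * fps_nth (Abs_fps p) (Suc n) = \<alpha> * fps_nth (Abs_fps p) n + \<alpha> * \<beta> * (of_nat n * fps_nth (Abs_fps p) n)) \<and> fps_nth (Abs_fps p) 0 = 1"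
      by (simp add: p del: of_nat_Suc)
  next
    fix P assume a: "(\<forall>n. of_nat (Suc n) * fps_nth P (Suc n) = \<alpha> * fps_nth P n + \<alpha> * \<beta> * (of_nat n * fps_nth P n)) \<and> fps_nth P 0 = 1"
    have "fps_nth P n = p n" for n
    proof (induction n)
      case (Suc n)
      have "of_nat (Suc n) * fps_nth P (Suc n) = of_nat (Suc n) * p (Suc n)" using a Suc p(2)[of n] by (simp del: of_nat_Suc)
      then show ?case by (metis mult_cancel_left of_nat_neq_0)
    qed (simp add: a p)
    then show "P = Abs_fps p" by (simp add: fps_eq_iff)
  qed
qed

lemma fps_power_nth_cong: "(\<And>j. j \<le> n \<Longrightarrow> fps_nth X j = fps_nth Y j) \<Longrightarrow> fps_nth (X ^ i) n = fps_nth (Y ^ i) n"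
  for X :: "'a::comm_ring_1 fps"
proof (induction i arbitrary: n)
  case (Suc i)
  show ?case
    unfolding power_Suc fps_mult_nth
  proof (rule sum.cong[OF refl])
    fix j assume "j \<in> {0..n}"
    then show "fps_nth X j * fps_nth (X ^ i) (n - j) = fps_nth Y j * fps_nth (Y ^ i) (n - j)"
      using Suc.IH[of "n - j"] Suc.prems by simp
  qed
qed simp

lemma fps_compose_nth_cong: "(\<And>j. j \<le> n \<Longrightarrow> fps_nth X j = fps_nth Y j) \<Longrightarrow> fps_nth (fps_compose C X) n = fps_nth (fps_compose C Y) n"
  for X :: "'a::comm_ring_1 fps"
  unfolding fps_compose_nth using fps_power_nth_cong[of n X Y] by simp

definition graded :: "'k::zero ck fps \<Rightarrow> bool" where "graded X \<longleftrightarrow> (\<forall>n. homogeneous n (fps_nth X n))"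

lemma homogeneous_add: "homogeneous n x \<Longrightarrow> homogeneous n y \<Longrightarrow> homogeneous n (x + y)"
  unfolding homogeneous_def using keys_add[of x y] by auto

lemma homogeneous_sum: "(\<And>i. i \<in> S \<Longrightarrow> homogeneous n (f i)) \<Longrightarrow> homogeneous n (sum f S)"
proof (induction S rule: infinite_finite_induct)
  case (insert i S)
  then show ?case by (simp add: homogeneous_add)
qed (simp_all add: homogeneous_def)

lemma homogeneous_mult: "homogeneous n x \<Longrightarrow> homogeneous m y \<Longrightarrow> homogeneous (n + m) (x * y)"
  unfolding homogeneous_def
proof
  fix F assume h: "\<forall>F\<in>Poly_Mapping.keys x. fweight F = n" "\<forall>F\<in>Poly_Mapping.keys y. fweight F = m"
    and F: "F \<in> Poly_Mapping.keys (x * y)"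
  from F keys_mult[of x y] obtain a b
    where "F = a + b" "a \<in> Poly_Mapping.keys x" "b \<in> Poly_Mapping.keys y" by blast
  then show "fweight F = n + m" using h by (simp add: fweight_def)
qed

lemma graded_mult: "graded X \<Longrightarrow> graded Y \<Longrightarrow> graded (X * Y)" for X :: "'k::comm_ring_1 ck fps"
  unfolding graded_def fps_mult_nth
  apply (intro allI homogeneous_sum)
  subgoal for n i using homogeneous_mult[of i "fps_nth X i" "n - i"  "fps_nth Y (n - i)"] by auto
  done

lemma homogeneous_scalar: "homogeneous 0 (Poly_Mapping.single {#} c)"
  by (auto simp: homogeneous_def fweight_def)

lemma graded_power: "graded X \<Longrightarrow> graded (X ^ i)" for X :: "'k::comm_ring_1 ck fps"
proof (induction i)
  case 0
  have "homogeneous 0 (1 :: 'k ck)"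
    using homogeneous_scalar[of "1 :: 'k"] by simp
  then show ?case by (simp add: graded_def homogeneous_def)
qed (simp add: graded_mult)

lemma homogeneous_Bplus: "homogeneous n x \<Longrightarrow> homogeneous (Suc n) (Bplus x)"
proof -
  assume a: "homogeneous n x"
  show ?thesis unfolding Bplus_def lin_ext_def
    by (rule homogeneous_sum) (use a in \<open>auto simp: homogeneous_def tree_elt_def fweight_def split: if_splits\<close>)
qed

lemma graded_DS: "graded X \<Longrightarrow> graded (completed_Bplus (fps_compose (scalar_fps P) X))"
  unfolding graded_def
proof (intro allI)
  fix n assume a: "\<forall>n. homogeneous n (fps_nth X n)"
  have "homogeneous n (fps_nth (fps_compose (scalar_fps P) X) n)" for n
    unfolding fps_compose_nth
  proof (rule homogeneous_sum)
    fix i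
    show "homogeneous n (fps_nth (scalar_fps P) i * fps_nth (X ^ i) n)"
      using homogeneous_mult[OF homogeneous_scalar, of n "fps_nth (X ^ i) n"] graded_power[of X i] a unfolding graded_def scalar_fps_def by auto
  qed
  then show "homogeneous n (fps_nth (completed_Bplus (fps_compose (scalar_fps P) X)) n)"
    by (cases n) (auto simp: completed_Bplus_def homogeneous_Bplus, simp add: homogeneous_def)
qed

lemma DS_nth_cong: "(\<And>j. j < n \<Longrightarrow> fps_nth X j = fps_nth Y j) \<Longrightarrow>
  fps_nth (completed_Bplus (fps_compose C X)) n = fps_nth (completed_Bplus (fps_compose C Y)) n"
  by (cases n) (auto simp: completed_Bplus_def intro!: arg_cong[where f = Bplus] fps_compose_nth_cong)

lemma DS_solution_ex1: "\<exists>!X. fps_nth X 0 = 0 \<and> (\<forall>n. homogeneous n (fps_nth X n)) \<and>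
             X = completed_Bplus (fps_compose (scalar_fps P) X)"
proof -
  define F where "F = (\<lambda>X. completed_Bplus (fps_compose (scalar_fps P) X))"
  define Xs where "Xs k = (F ^^ k) 0" for k
  have S: "Xs (Suc k) = F (Xs k)" for k by (simp add: Xs_def)
  have st: "n < k \<Longrightarrow> fps_nth (Xs (Suc k)) n = fps_nth (Xs k) n" for n k
  proof (induction k arbitrary: n)
    case (Suc k)
    have "fps_nth (F (Xs (Suc k))) n = fps_nth (F (Xs k)) n"
      unfolding F_def by (rule DS_nth_cong) (use Suc in simp)
    then show ?case by (simp only: S)
  qed simp
  have st2: "fps_nth (Xs (k + Suc n)) n = fps_nth (Xs (Suc n)) n" for n k
    by (induction k) (auto simp: st)
  define X where "X = Abs_fps (\<lambda>n. fps_nth (Xs (Suc n)) n)"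
  have g: "graded (Xs k)" for k
  proof (induction k)
    case (Suc k)
    then show ?case by (simp only: S F_def graded_DS)
  qed (simp add: Xs_def graded_def homogeneous_def)
  have eq: "X = F X"
  proof (rule fps_ext)
    fix n
    have "fps_nth X n = fps_nth (F (Xs n)) n" by (simp add: X_def S)
    also have "\<dots> = fps_nth (F X) n" unfolding F_def
    proof (rule DS_nth_cong)
      fix j assume "j < n"
      then show "fps_nth (Xs n) j = fps_nth X j"
        using st2[of "n - Suc j" j] by (simp add: X_def)
    qed
    finally show "fps_nth X n = fps_nth (F X) n" .
  qed
  have X0: "fps_nth X 0 = 0" by (subst eq) (simp add: F_def completed_Bplus_def)
  have u: "Y = X" if "Y = F Y" for Y
  proof (rule fps_ext)
    fix n show "fps_nth Y n = fps_nth X n"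
    proof (induction n rule: less_induct)
      case (less n)
      then have "fps_nth (F Y) n = fps_nth (F X) n"
        unfolding F_def by (rule DS_nth_cong)
      then show ?case using that eq by metis
    qed
  qed
  show ?thesis
  proof (rule ex1I[of _ X])
    have "homogeneous n (fps_nth X n)" for n
      using g[of "Suc n"] by (simp add: graded_def X_def)
    then show "fps_nth X 0 = 0 \<and> (\<forall>n. homogeneous n (fps_nth X n)) \<and>
        X = completed_Bplus (fps_compose (scalar_fps P) X)"
      using X0 eq unfolding F_def by blast
  qed (rule u, simp add: F_def)
qed


section \<open>The Faa di Bruno Hopf algebra\<close>

typedef (overloaded) ('k::field_char_0) diffeo = "{P :: 'k fps. fps_nth P 0 = 0 \<and> fps_nth P 1 = 1}"
  morphisms series Diffeo
  by (rule exI[of _ fps_X]) simp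

definition diffeo_comp :: "'k::field_char_0 diffeo \<Rightarrow> 'k diffeo \<Rightarrow> 'k diffeo" where
  "diffeo_comp Q P = Diffeo (fps_compose (series Q) (series P))"

lemma series_diffeo_comp: "series (diffeo_comp Q P) = fps_compose (series Q) (series P)"
proof -
  have "fps_nth (series Q) 0 = 0" "fps_nth (series Q) 1 = 1" "fps_nth (series P) 1 = 1"
    using series[of P] series[of Q] by simp_all
  then have "fps_compose (series Q) (series P) \<in> {P. fps_nth P 0 = 0 \<and> fps_nth P 1 = 1}"
    by (simp add: fps_compose_nth)
  then show ?thesis
    unfolding diffeo_comp_def by (rule Diffeo_inverse)
qed

definition coord :: "nat \<Rightarrow> 'k::field_char_0 diffeo \<Rightarrow> 'k" where
  "coord i P = fps_nth (series P) (Suc i)"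

text \<open>
  Since \<open>'k\<close> is infinite, the coordinate functions are algebraically independent, so the
  polynomial functions on the group form a polynomial ring in the coordinates. A tensor \<open>f \<otimes> g\<close> of
  functions is the function \<open>(P, Q) \<mapsto> f P * g Q\<close> of two variables. The ring operations on
  functions are the pointwise ones.
\<close>

definition fun_FdB ::
    "('k::field_char_0, 'k diffeo \<Rightarrow> 'k, 'k diffeo \<times> 'k diffeo \<Rightarrow> 'k) hopf" where
  "fun_FdB = \<lparr>carr = UNIV, unit = 1, mult = (*), scal = (\<lambda>c f P. c * f P),
              tens = (\<lambda>f g (P, Q). f P * g Q), counit = (\<lambda>f. f (Diffeo fps_X)),
              comult = (\<lambda>f (P, Q). f (diffeo_comp Q P))\<rparr>"

definition H_FdB ::
    "('k::field_char_0, 'k diffeo \<Rightarrow> 'k, 'k diffeo \<times> 'k diffeo \<Rightarrow> 'k) hopf" where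
  "H_FdB = fun_FdB\<lparr>carr := gen_subalg fun_FdB {coord i | i. i \<ge> 1}\<rparr>"


section \<open>The Hopf algebra of symmetric functions\<close>

text \<open>
  A formal power series in variables \<open>x\<^sub>0, x\<^sub>1, \<dots>\<close> is its family of coefficients, where a monomial
  is the multiset of its variables. A series in two alphabets has coefficients indexed by pairs of
  monomials.
\<close>

definition symmetric_function :: "(nat multiset \<Rightarrow> 'k::zero) \<Rightarrow> bool" where
  "symmetric_function f \<longleftrightarrow>
     (\<exists>d. \<forall>m. f m \<noteq> 0 \<longrightarrow> size m \<le> d) \<and>
     (\<forall>\<sigma> m. bij \<sigma> \<longrightarrow> f (image_mset \<sigma> m) = f m)"

definition series_mult ::
    "(nat multiset \<Rightarrow> 'k::comm_ring_1) \<Rightarrow> (nat multiset \<Rightarrow> 'k) \<Rightarrow> nat multiset \<Rightarrow> 'k" where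
  "series_mult f g m = (\<Sum>p | p \<subseteq># m. f p * g (m - p))"

text \<open>
  The coproduct is \<open>f \<mapsto> f(x\<^sub>0, y\<^sub>0, x\<^sub>1, y\<^sub>1, \<dots>)\<close>: the alphabet is split into the variables of even
  index and those of odd index. By symmetry the choice of the splitting is irrelevant.
\<close>

definition alphabet_doubling ::
    "(nat multiset \<Rightarrow> 'k) \<Rightarrow> nat multiset \<times> nat multiset \<Rightarrow> 'k" where
  "alphabet_doubling f = (\<lambda>(p, q). f (image_mset (\<lambda>i. 2 * i) p + image_mset (\<lambda>i. 2 * i + 1) q))"

definition Sym ::
    "('k::comm_ring_1, nat multiset \<Rightarrow> 'k, nat multiset \<times> nat multiset \<Rightarrow> 'k) hopf" where
  "Sym = \<lparr>carr = {f. symmetric_function f}, unit = (\<lambda>m. if m = {#} then 1 else 0),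
          mult = series_mult, scal = (\<lambda>c f m. c * f m),
          tens = (\<lambda>f g (p, q). f p * g q), counit = (\<lambda>f. f {#}),
          comult = alphabet_doubling\<rparr>"

end

theory Submission
  imports Defs "HOL-Library.Multiset_Order"
begin

text \<open>
  For \<open>\<alpha> \<noteq> 0\<close>, passing from \<open>\<alpha>\<close> to \<open>1\<close> rescales the homogeneous generators \<open>a\<^sub>n\<close>, and for \<open>\<alpha> = 0\<close> only
  \<open>a\<^sub>1 = \<bullet>\<close> survives. So the Hopf algebras to compare are \<open>A_hopf 1 \<beta>\<close> and \<open>K_bullet\<close>.

  Let \<open>P = P_series 1 \<beta>\<close> and let \<open>X = \<Sum>\<^sub>n a\<^sub>n t\<^sup>n\<close> be the solution of the Dyson-Schwinger equation, with \<open>t\<close>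
  keeping track of the degree. The series \<open>P\<close> is \<open>(1 - \<beta> h)\<close> to the power \<open>-1 / \<beta>\<close> and satisfies the
  addition formula \<open>P (x + (1 - \<beta> x) z) = P x * P z\<close> (\<open>binomial_addition_formula\<close>). Inserted into the
  recursion that the cocycle property of \<open>Bplus\<close> gives for the coproduct, it yields
  \<open>\<Delta> X = X \<otimes> 1 + (1 - \<beta> X \<otimes> 1) ((1 \<otimes> X) \<circ> (t P' X \<otimes> 1))\<close> (\<open>comult_DS_solution\<close>).

  A character of \<open>A_hopf 1 \<beta>\<close> is given by the series \<open>f\<close> of its values on the generators, and by this
  formula characters multiply by the law \<open>f + (1 - \<beta> f) (g \<circ> (h P' f))\<close>. As \<open>P'\<close> obeys an addition formula of
  the same kind, \<open>f \<mapsto> h P' f\<close> turns this law into the composition of diffeomorphisms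
  (\<open>chart_at_comp\<close>). Since \<open>P' = 1 + (1 + \<beta>) h + \<dots>\<close>, the map is invertible for \<open>\<beta> \<noteq> -1\<close>, and the algebra is
  isomorphic to the Faa di Bruno Hopf algebra (\<open>A_iso_FdB\<close>). For \<open>\<beta> = -1\<close> one has \<open>P' = 1\<close>, and the
  formula says that \<open>1 + X\<close> is group-like. The same holds for the series of elementary symmetric
  functions, which freely generate the symmetric functions (\<open>elementary_generate_Sym\<close>,
  \<open>to_Sym_inj\<close>); this gives the isomorphism with \<open>Sym\<close> (\<open>A_minus_1_iso_Sym\<close>).

  That these maps are injective rests on the algebraic independence of the generators: each \<open>a\<^sub>n\<close>
  with \<open>n \<ge> 1\<close> contains the ladder with \<open>n\<close> vertices with coefficient \<open>1\<close> and no other ladder, so an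
  element of the subalgebra is determined by its coefficients at forests of ladders (\<open>A_retraction\<close>).

  The three classes differ. The Faa di Bruno Hopf algebra is not cocommutative because
  diffeomorphisms do not commute, whereas \<open>A_hopf 1 (-1)\<close> is cocommutative. On \<open>K_bullet\<close> all
  derivations relative to the counit are proportional, unlike on \<open>A_hopf 1 \<beta>\<close> (\<open>K_bullet_not_iso\<close>).

  Morphisms of coalgebras are described through expansions of coproducts into pure tensors. That
  isomorphy is transitive and preserves cocommutativity therefore needs that \<open>\<phi> \<otimes> \<phi>\<close> does not depend
  on the expansion; this is \<open>tensor_image_cong\<close>, a form of the universal property of the tensor
  product.
\<close>


section \<open>Power series over commutative rings\<close>

text \<open>
  An additive operator each of whose output coefficients depends on finitely many input coefficients
  is determined by its values on monomials. This reduces the rules for composition below to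
  monomials. The bound \<open>Suc n\<close>, rather than \<open>n\<close>, makes the principle applicable to the derivative.
\<close>

lemma fps_additive_ext:
  fixes S T :: "'a::comm_ring_1 fps \<Rightarrow> 'a fps"
  assumes S_add: "\<And>a b. S (a + b) = S a + S b" and T_add: "\<And>a b. T (a + b) = T a + T b"
    and monom: "\<And>c i. S (fps_const c * fps_X ^ i) = T (fps_const c * fps_X ^ i)"
    and S_local: "\<And>n a. (\<And>i. i \<le> Suc n \<Longrightarrow> fps_nth a i = 0) \<Longrightarrow> fps_nth (S a) n = 0"
    and T_local: "\<And>n a. (\<And>i. i \<le> Suc n \<Longrightarrow> fps_nth a i = 0) \<Longrightarrow> fps_nth (T a) n = 0"
  shows "S a = T a"
proof (rule fps_ext)
  fix n
  define p where "p m = (\<Sum>i<m. fps_const (fps_nth a i) * fps_X ^ i)" for m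
  have S0: "S 0 = 0" and T0: "T 0 = 0" using S_add[of 0 0] T_add[of 0 0] by simp_all
  have ST: "S (p m) = T (p m)" for m
    by (induction m) (simp_all add: p_def S0 T0 S_add T_add monom)
  have p_nth: "fps_nth (p m) i = (if i < m then fps_nth a i else 0)" for m i
    by (induction m) (auto simp: p_def fps_X_power_iff less_Suc_eq)
  have split: "a = p (Suc (Suc n)) + (a - p (Suc (Suc n)))" by simp
  have "fps_nth (a - p (Suc (Suc n))) i = 0" if "i \<le> Suc n" for i
    using that by (simp add: p_nth)
  then have "fps_nth (S (a - p (Suc (Suc n)))) n = 0" "fps_nth (T (a - p (Suc (Suc n)))) n = 0"
    using S_local T_local by blast+
  moreover have "fps_nth (S a) n = fps_nth (S (p (Suc (Suc n)))) n + fps_nth (S (a - p (Suc (Suc n)))) n"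
    by (subst split) (simp only: S_add fps_add_nth)
  moreover have "fps_nth (T a) n = fps_nth (T (p (Suc (Suc n)))) n + fps_nth (T (a - p (Suc (Suc n)))) n"
    by (subst split) (simp only: T_add fps_add_nth)
  ultimately show "fps_nth (S a) n = fps_nth (T a) n" by (simp add: ST)
qed

lemma fps_power_nth_eq_0:
  fixes c :: "'a::comm_ring_1 fps"
  assumes "fps_nth c 0 = 0" "n < i"
  shows "fps_nth (c ^ i) n = 0"
  using assms(2)
proof (induction i arbitrary: n)
  case (Suc i)
  have "fps_nth c j * fps_nth (c ^ i) (n - j) = 0" if "j \<le> n" for j
    using Suc that assms(1) by (cases j) auto
  then show ?case by (simp add: fps_mult_nth)
qed simp

lemma fps_compose_monom:
  fixes c :: "'a::comm_ring_1 fps"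
  assumes "fps_nth c 0 = 0"
  shows "fps_compose (fps_const k * fps_X ^ i) c = fps_const k * c ^ i"
proof (rule fps_ext)
  fix n
  have "fps_nth (fps_compose (fps_const k * fps_X ^ i) c) n
      = (\<Sum>j=0..n. if j = i then k * fps_nth (c ^ i) n else 0)"
    unfolding fps_compose_nth by (rule sum.cong) auto
  also have "\<dots> = k * fps_nth (c ^ i) n"
    using fps_power_nth_eq_0[OF assms] by (auto simp: not_le)
  finally show "fps_nth (fps_compose (fps_const k * fps_X ^ i) c) n = fps_nth (fps_const k * c ^ i) n"
    by simp
qed

lemma fps_mult_nth_eq_0:
  fixes a :: "'a::comm_ring_1 fps"
  assumes "\<And>i. i \<le> n \<Longrightarrow> fps_nth a i = 0"
  shows "fps_nth (a * b) n = 0"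
  using assms by (simp add: fps_mult_nth)

lemma fps_compose_nth_eq_0:
  fixes a :: "'a::comm_ring_1 fps"
  assumes "\<And>i. i \<le> n \<Longrightarrow> fps_nth a i = 0"
  shows "fps_nth (a oo c) n = 0"
  using assms by (simp add: fps_compose_nth)

text \<open>
  Both sides are additive and local in \<open>a\<close> and in \<open>b\<close>, and on monomials the claim is
  \<open>c\<^sup>i * c\<^sup>j = c\<^sup>i\<^sup>+\<^sup>j\<close>. No cancellation is involved, so the coefficients may have zero divisors.
\<close>

lemma fps_compose_mult:
  fixes a b c :: "'a::comm_ring_1 fps"
  assumes c: "fps_nth c 0 = 0"
  shows "((a * b) oo c) = (a oo c) * (b oo c)"
proof (rule fps_additive_ext[where S = "\<lambda>a. ((a * b) oo c)"])
  fix k :: 'a and i :: nat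
  show "((fps_const k * fps_X ^ i * b) oo c)
      = ((fps_const k * fps_X ^ i) oo c) * (b oo c)"
  proof (rule fps_additive_ext[where S = "\<lambda>b. ((fps_const k * fps_X ^ i * b) oo c)"])
    fix l :: 'a and j :: nat
    have "fps_const k * fps_X ^ i * (fps_const l * fps_X ^ j)
        = fps_const (k * l) * (fps_X ^ (i + j) :: 'a fps)"
      by (simp add: power_add ac_simps flip: fps_const_mult)
    then show "((fps_const k * fps_X ^ i * (fps_const l * fps_X ^ j)) oo c)
        = ((fps_const k * fps_X ^ i) oo c) * ((fps_const l * fps_X ^ j) oo c)"
      by (simp only: fps_compose_monom[OF c]) (simp only: power_add fps_const_mult[symmetric] ac_simps)
  next
    fix n and b :: "'a fps" assume b: "\<And>i. i \<le> Suc n \<Longrightarrow> fps_nth b i = 0"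
    show "fps_nth ((fps_const k * fps_X ^ i * b) oo c) n = 0"
      by (rule fps_compose_nth_eq_0, subst mult.commute, rule fps_mult_nth_eq_0) (simp add: b)
    show "fps_nth (((fps_const k * fps_X ^ i) oo c) * (b oo c)) n = 0"
      by (subst mult.commute, rule fps_mult_nth_eq_0, rule fps_compose_nth_eq_0) (simp add: b)
  qed (simp_all add: fps_compose_add_distrib distrib_left)
next
  fix n and a :: "'a fps" assume a: "\<And>i. i \<le> Suc n \<Longrightarrow> fps_nth a i = 0"
  show "fps_nth ((a * b) oo c) n = 0"
    by (rule fps_compose_nth_eq_0, rule fps_mult_nth_eq_0) (simp add: a)
  show "fps_nth ((a oo c) * (b oo c)) n = 0"
    by (rule fps_mult_nth_eq_0, rule fps_compose_nth_eq_0) (simp add: a)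
qed (simp_all add: fps_compose_add_distrib distrib_right)

lemma fps_compose_pow:
  fixes a c :: "'a::comm_ring_1 fps"
  assumes "fps_nth c 0 = 0"
  shows "((a ^ i) oo c) = (a oo c) ^ i"
  by (induction i) (simp_all add: fps_compose_mult[OF assms])

lemma fps_compose_assoc_comm_ring:
  fixes a b c :: "'a::comm_ring_1 fps"
  assumes b: "fps_nth b 0 = 0" and c: "fps_nth c 0 = 0"
  shows "(a oo (b oo c)) = ((a oo b) oo c)"
proof (rule fps_additive_ext[where S = "\<lambda>a. (a oo (b oo c))"])
  fix k :: 'a and i :: nat
  have "fps_nth (b oo c) 0 = 0" by (simp add: b)
  from fps_compose_monom[OF this] show "((fps_const k * fps_X ^ i) oo (b oo c))
      = (((fps_const k * fps_X ^ i) oo b) oo c)"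
    by (simp add: fps_compose_monom[OF b] fps_compose_mult[OF c] fps_compose_pow[OF c])
next
  fix n and a :: "'a fps" assume a: "\<And>i. i \<le> Suc n \<Longrightarrow> fps_nth a i = 0"
  show "fps_nth (a oo (b oo c)) n = 0"
    by (rule fps_compose_nth_eq_0) (simp add: a)
  show "fps_nth ((a oo b) oo c) n = 0"
    by (rule fps_compose_nth_eq_0, rule fps_compose_nth_eq_0) (simp add: a)
qed (simp_all add: fps_compose_add_distrib)

lemma fps_deriv_power_comm_ring: "fps_deriv (c ^ i) = of_nat i * c ^ (i - 1) * fps_deriv c"
  for c :: "'a::comm_ring_1 fps"
proof (induction i)
  case (Suc i)
  then show ?case by (cases i) (simp_all add: algebra_simps)
qed simp

lemma fps_compose_chain_rule:
  fixes a c :: "'a::comm_ring_1 fps"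
  assumes c: "fps_nth c 0 = 0"
  shows "fps_deriv (a oo c) = ((fps_deriv a) oo c) * fps_deriv c"
proof (rule fps_additive_ext[where S = "\<lambda>a. fps_deriv (a oo c)"])
  fix k :: 'a and i :: nat
  have d: "fps_deriv (fps_const k * fps_X ^ i) = fps_const (k * of_nat i) * (fps_X ^ (i - 1) :: 'a fps)"
    by (simp add: fps_deriv_power_comm_ring fps_of_nat mult.assoc flip: fps_const_mult)
  show "fps_deriv ((fps_const k * fps_X ^ i) oo c)
      = ((fps_deriv (fps_const k * fps_X ^ i)) oo c) * fps_deriv c"
    unfolding d fps_compose_monom[OF c]
    by (simp add: fps_deriv_power_comm_ring fps_of_nat mult.assoc flip: fps_const_mult)
next
  fix n and a :: "'a fps" assume a: "\<And>i. i \<le> Suc n \<Longrightarrow> fps_nth a i = 0"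
  have "fps_nth (a oo c) (Suc n) = 0" by (rule fps_compose_nth_eq_0) (simp add: a)
  then show "fps_nth (fps_deriv (a oo c)) n = 0" by simp
  show "fps_nth (((fps_deriv a) oo c) * fps_deriv c) n = 0"
    by (rule fps_mult_nth_eq_0, rule fps_compose_nth_eq_0) (simp add: a)
qed (simp_all add: fps_compose_add_distrib distrib_right)

text \<open>
  Expanding \<open>b\<close> in powers of \<open>c\<close> turns a coefficient of \<open>a * (b \<circ> c)\<close> into a finite sum of products of
  a coefficient of \<open>b\<close> with a coefficient built from \<open>a\<close> and \<open>c\<close>. Both the coproduct of a generator
  and the coordinates of a composite of diffeomorphisms are read off in this form.
\<close>

lemma fps_mult_compose_nth_eq_sum:
  fixes a b c :: "'a::comm_ring_1 fps"
  assumes c: "fps_nth c 0 = 0"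
  shows "fps_nth (a * (b oo c)) n = (\<Sum>j\<le>n. fps_nth b j * fps_nth (a * c ^ j) n)"
proof -
  have "fps_nth (b oo c) i = (\<Sum>j\<le>n. fps_nth b j * fps_nth (c ^ j) i)" if "i \<le> n" for i
    unfolding fps_compose_nth
    by (rule sum.mono_neutral_left) (use that fps_power_nth_eq_0[OF c] in auto)
  then have "fps_nth (a * (b oo c)) n
      = (\<Sum>i=0..n. fps_nth a i * (\<Sum>j\<le>n. fps_nth b j * fps_nth (c ^ j) (n - i)))"
    by (simp add: fps_mult_nth)
  also have "\<dots> = (\<Sum>j\<le>n. fps_nth b j * (\<Sum>i=0..n. fps_nth a i * fps_nth (c ^ j) (n - i)))"
    by (simp add: sum_distrib_left mult.left_commute) (rule sum.swap)
  finally show ?thesis by (simp add: fps_mult_nth)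
qed

locale ring_morphism =
  fixes h :: "'r::comm_ring_1 \<Rightarrow> 's::comm_ring_1"
  assumes h_one: "h 1 = 1"
    and h_add: "h (x + y) = h x + h y"
    and h_mult: "h (x * y) = h x * h y"
begin

lemma h_zero: "h 0 = 0"
  using h_add[of 0 0] by simp

lemma h_diff: "h (x - y) = h x - h y"
  using h_add[of "x - y" y] by simp

lemma h_minus: "h (- y) = - h y"
  using h_diff[of 0 y] by (simp add: h_zero)

lemma h_sum: "h (sum f A) = (\<Sum>i\<in>A. h (f i))"
  by (induction A rule: infinite_finite_induct) (simp_all add: h_zero h_add)

lemma h_of_nat: "h (of_nat n) = of_nat n"
  by (induction n) (simp_all add: h_zero h_one h_add)

lemma h_prod_mset: "h (\<Prod>\<^sub># M) = (\<Prod>x\<in>#M. h x)"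
  by (induction M) (simp_all add: h_one h_mult)

end

definition fps_map :: "('r \<Rightarrow> 's) \<Rightarrow> 'r fps \<Rightarrow> 's fps" where
  "fps_map h X = Abs_fps (\<lambda>n. h (fps_nth X n))"

lemma fps_map_nth [simp]: "fps_nth (fps_map h X) n = h (fps_nth X n)"
  by (simp add: fps_map_def)

lemma fps_map_map: "fps_map g (fps_map h X) = fps_map (\<lambda>x. g (h x)) X"
  by (rule fps_ext) simp

context ring_morphism
begin

lemma fps_map_morphism: "ring_morphism (fps_map h :: 'r fps \<Rightarrow> 's fps)"
  by unfold_locales (simp_all add: fps_eq_iff h_one h_add h_mult h_zero fps_mult_nth h_sum)

lemmas fps_map_one = ring_morphism.h_one[OF fps_map_morphism]
  and fps_map_diff = ring_morphism.h_diff[OF fps_map_morphism]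
  and fps_map_mult = ring_morphism.h_mult[OF fps_map_morphism]

lemma fps_map_power: "fps_map h (X ^ i) = fps_map h X ^ i"
  by (induction i) (simp_all add: fps_map_one fps_map_mult)

lemma fps_map_X: "fps_map h fps_X = fps_X"
  by (rule fps_ext) (simp add: fps_X_def h_zero h_one)

lemma fps_map_const: "fps_map h (fps_const c) = fps_const (h c)"
  by (rule fps_ext) (simp add: h_zero)

lemma fps_map_compose: "fps_map h (P oo X) = ((fps_map h P) oo (fps_map h X))"
  by (rule fps_ext) (simp add: fps_compose_nth h_sum h_mult flip: fps_map_power)

lemma fps_map_deriv: "fps_map h (fps_deriv P) = fps_deriv (fps_map h P)"
  by (rule fps_ext) (simp add: h_mult h_add h_one h_of_nat)

end

text \<open>
  A commutative algebra over the field \<open>'k\<close>, given by its structure morphism.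
\<close>

locale scalars = ring_morphism \<iota> for \<iota> :: "'k::field_char_0 \<Rightarrow> 'r::comm_ring_1"
begin

lemma of_nat_Suc_torsion_free: "of_nat (Suc n) * x = (0::'r) \<Longrightarrow> x = 0"
proof -
  assume a: "of_nat (Suc n) * x = 0"
  have "x = \<iota> (inverse (of_nat (Suc n)) * of_nat (Suc n)) * x"
    by (simp add: h_one del: of_nat_Suc)
  also have "\<dots> = \<iota> (inverse (of_nat (Suc n))) * (of_nat (Suc n) * x)"
    by (simp only: h_mult h_of_nat mult.assoc)
  finally show ?thesis unfolding a by simp
qed

text \<open>
  As \<open>v\<close> has no constant term, the equation expresses \<open>(n + 1) Y\<^sub>n\<^sub>+\<^sub>1\<close> through earlier coefficients of \<open>Y\<close>,
  and one can divide by \<open>n + 1\<close> in an algebra over a field of characteristic zero.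
\<close>

lemma linear_ode_unique:
  fixes Y Z v w :: "'r fps"
  assumes Y: "(1 - v) * fps_deriv Y = w * Y" and Z: "(1 - v) * fps_deriv Z = w * Z"
    and v: "fps_nth v 0 = 0" and init: "fps_nth Y 0 = fps_nth Z 0"
  shows "Y = Z"
proof -
  define D where "D = Y - Z"
  have eq: "fps_deriv D = v * fps_deriv D + w * D"
    using Y Z by (simp add: D_def algebra_simps)
  have "fps_nth D n = 0" for n
  proof (induction n rule: less_induct)
    case (less n)
    show ?case
    proof (cases n)
      case 0
      then show ?thesis by (simp add: D_def init)
    next
      case (Suc m)
      have "fps_nth v i * fps_nth (fps_deriv D) (m - i) = 0" if "i \<le> m" for i
      proof (cases i)
        case 0
        then show ?thesis by (simp add: v)
      next
        case (Suc j)
        then have "Suc (m - i) < n" using that \<open>n = Suc m\<close> by simp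
        then show ?thesis by (simp add: less.IH)
      qed
      then have "fps_nth (v * fps_deriv D) m = 0" by (simp add: fps_mult_nth)
      moreover have "fps_nth (w * D) m = 0"
        using less.IH by (simp add: fps_mult_nth Suc)
      ultimately have "fps_nth (fps_deriv D) m = 0" by (subst eq) simp
      then show ?thesis
        using of_nat_Suc_torsion_free[of m] Suc by (simp add: fps_deriv_nth)
    qed
  qed
  then show ?thesis by (simp add: D_def fps_eq_iff)
qed

text \<open>
  The series \<open>R\<close> is \<open>(1 - \<beta> h)\<close> to the power \<open>- c / \<beta>\<close> (and \<open>exp (c h)\<close> for \<open>\<beta> = 0\<close>), and for
  \<open>u = x + (1 - \<beta> x) z\<close> one has \<open>1 - \<beta> u = (1 - \<beta> x) (1 - \<beta> z)\<close>, so \<open>R u = R x * R z\<close>. The proof avoids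
  the case distinction on \<open>\<beta>\<close>: both sides solve the same linear differential equation
  \<open>(1 - \<beta> u) Y' = c u' Y\<close>.
\<close>

lemma binomial_addition_formula:
  fixes R :: "'k fps" and x z :: "'r fps"
  assumes R: "(1 - fps_const \<beta> * fps_X) * fps_deriv R = fps_const c * R" and R0: "fps_nth R 0 = 1"
    and x: "fps_nth x 0 = 0" and z: "fps_nth z 0 = 0"
  shows "((fps_map \<iota> R) oo (x + (1 - fps_const (\<iota> \<beta>) * x) * z))
    = ((fps_map \<iota> R) oo x) * ((fps_map \<iota> R) oo z)"
proof -
  let ?b = "fps_const (\<iota> \<beta>)" and ?c = "fps_const (\<iota> c)" and ?R = "fps_map \<iota> R"
  let ?u = "x + (1 - ?b * x) * z"
  have u: "fps_nth ?u 0 = 0" by (simp add: x z)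
  have ode: "(1 - ?b * y) * ((fps_deriv ?R) oo y) = ?c * (?R oo y)"
    if y: "fps_nth y 0 = 0" for y
  proof -
    have "(1 - ?b * fps_X) * fps_deriv ?R = ?c * ?R"
      using arg_cong[OF R, of "fps_map \<iota>"]
      by (simp only: fps_map_mult fps_map_diff fps_map_one fps_map_const fps_map_X fps_map_deriv)
    from arg_cong[OF this, of "\<lambda>F. (F oo y)"] show ?thesis
      by (simp add: fps_compose_mult[OF y] fps_compose_sub_distrib y)
  qed
  have chain: "fps_deriv (?R oo y) = ((fps_deriv ?R) oo y) * fps_deriv y"
    if "fps_nth y 0 = 0" for y
    using fps_compose_chain_rule[OF that] .
  have factor: "1 - ?b * ?u = (1 - ?b * x) * (1 - ?b * z)" by (simp add: algebra_simps)
  have du: "fps_deriv ?u = (1 - ?b * z) * fps_deriv x + (1 - ?b * x) * fps_deriv z"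
    by (simp add: algebra_simps)
  show ?thesis
  proof (rule linear_ode_unique[where v = "?b * ?u" and w = "?c * fps_deriv ?u"])
    have "(1 - ?b * ?u) * fps_deriv (?R oo ?u)
        = ((1 - ?b * ?u) * ((fps_deriv ?R) oo ?u)) * fps_deriv ?u"
      by (simp only: chain[OF u] mult.assoc)
    also have "\<dots> = ?c * fps_deriv ?u * (?R oo ?u)"
      unfolding ode[OF u] by (simp only: ac_simps)
    finally show "(1 - ?b * ?u) * fps_deriv (?R oo ?u) = ?c * fps_deriv ?u * (?R oo ?u)" .
    let ?S = "fps_compose (fps_deriv ?R)"
    have "(1 - ?b * ?u) * fps_deriv ((?R oo x) * (?R oo z))
      = (1 - ?b * z) * ((1 - ?b * x) * ?S x) * fps_deriv x * (?R oo z)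
        + (1 - ?b * x) * ((1 - ?b * z) * ?S z) * fps_deriv z * (?R oo x)"
      unfolding factor by (simp only: fps_deriv_mult chain[OF x] chain[OF z] distrib_left ac_simps)
    also have "\<dots> = ?c * fps_deriv ?u * ((?R oo x) * (?R oo z))"
      unfolding ode[OF x] ode[OF z] du by (simp only: distrib_left distrib_right ac_simps)
    finally show "(1 - ?b * ?u) * fps_deriv ((?R oo x) * (?R oo z))
      = ?c * fps_deriv ?u * ((?R oo x) * (?R oo z))" .
  qed (simp_all add: x z h_one R0)
qed

end


section \<open>Morphisms of Hopf algebras with a concrete tensor square\<close>

text \<open>
  The parts of a bialgebra that isomorphisms see. Elements of the algebra and of the tensor square
  are determined by their coordinates \<open>ev x i\<close> and \<open>ev2 t (i, j)\<close>, and a pure tensor has the products of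
  the coordinates of its factors as coordinates. The coordinates are coefficients in the
  Connes-Kreimer algebra and in the symmetric functions, and values in an algebra of functions.
  The product \<open>tmult\<close> of the tensor square makes the comultiplication multiplicative.
\<close>

locale hopf_model =
  fixes H :: "('k::field, 'a::ab_group_add, 't::ab_group_add) hopf"
    and ev :: "'a \<Rightarrow> 'i \<Rightarrow> 'k"
    and ev2 :: "'t \<Rightarrow> 'i \<times> 'i \<Rightarrow> 'k"
    and tmult :: "'t \<Rightarrow> 't \<Rightarrow> 't"
  assumes unit_carr: "unit H \<in> carr H"
    and add_carr: "x \<in> carr H \<Longrightarrow> y \<in> carr H \<Longrightarrow> x + y \<in> carr H"
    and scal_carr: "x \<in> carr H \<Longrightarrow> scal H c x \<in> carr H"
    and mult_carr: "x \<in> carr H \<Longrightarrow> y \<in> carr H \<Longrightarrow> mult H x y \<in> carr H"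
    and ev_add: "ev (x + y) i = ev x i + ev y i"
    and ev_scal: "ev (scal H c x) i = c * ev x i"
    and ev_inj: "(\<And>i. ev x i = ev y i) \<Longrightarrow> x = y"
    and ev2_add: "ev2 (s + t) p = ev2 s p + ev2 t p"
    and ev2_inj: "(\<And>i j. ev2 s (i, j) = ev2 t (i, j)) \<Longrightarrow> s = t"
    and ev2_tens: "ev2 (tens H x y) (i, j) = ev x i * ev y j"
    and tmult_add_left: "tmult (s + t) u = tmult s u + tmult t u"
    and tmult_add_right: "tmult u (s + t) = tmult u s + tmult u t"
    and tmult_tens: "tmult (tens H x y) (tens H x' y') = tens H (mult H x x') (mult H y y')"
    and comult_unit: "comult H (unit H) = tens H (unit H) (unit H)"
    and comult_add: "comult H (x + y) = comult H x + comult H y"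
    and comult_scal: "ev2 (comult H (scal H c x)) p = c * ev2 (comult H x) p"
    and comult_mult: "comult H (mult H x y) = tmult (comult H x) (comult H y)"
    and counit_unit: "counit H (unit H) = 1"
    and counit_add: "counit H (x + y) = counit H x + counit H y"
    and counit_scal: "counit H (scal H c x) = c * counit H x"
    and counit_mult: "counit H (mult H x y) = counit H x * counit H y"
begin

lemma ev_zero: "ev 0 i = 0"
  using ev_add[of 0 0 i] by (metis add.right_neutral add_left_cancel)

lemma ev2_zero: "ev2 0 p = 0"
  using ev2_add[of 0 0 p] by (metis add.right_neutral add_left_cancel)

lemma zero_carr: "0 \<in> carr H"
proof -
  have "0 = scal H 0 (unit H)" by (rule ev_inj) (simp add: ev_zero ev_scal)
  then show ?thesis using scal_carr[OF unit_carr] by metis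
qed

lemma tens_add_left: "tens H (x + y) z = tens H x z + tens H y z"
  by (rule ev2_inj) (simp add: ev2_tens ev2_add ev_add distrib_right)

lemma tens_add_right: "tens H z (x + y) = tens H z x + tens H z y"
  by (rule ev2_inj) (simp add: ev2_tens ev2_add ev_add distrib_left)

lemma tens_balanced: "tens H (scal H c x) y = tens H x (scal H c y)"
  by (rule ev2_inj) (simp add: ev2_tens ev_scal)

lemma tmult_zero: "tmult 0 u = 0" "tmult u 0 = 0"
  using tmult_add_left[of 0 0 u] tmult_add_right[of u 0 0] by simp_all

lemma ev2_tensor_sum:
  "ev2 (\<Sum>(a, b)\<leftarrow>ts. tens H (f a) (g b)) (i, j) = (\<Sum>(a, b)\<leftarrow>ts. ev (f a) i * ev (g b) j)"
  by (induction ts) (auto simp: ev2_zero ev2_add ev2_tens)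

lemma tensor_sum_mult:
  "tmult (\<Sum>(a, b)\<leftarrow>ts. tens H (f a) (g b)) (\<Sum>(c, d)\<leftarrow>us. tens H (f' c) (g' d))
    = (\<Sum>((a, b), (c, d))\<leftarrow>List.product ts us. tens H (mult H (f a) (f' c)) (mult H (g b) (g' d)))"
proof (induction ts)
  case (Cons p ts)
  obtain a b where p: "p = (a, b)" by (cases p)
  have "tmult (tens H (f a) (g b)) (\<Sum>(c, d)\<leftarrow>us. tens H (f' c) (g' d))
      = (\<Sum>(c, d)\<leftarrow>us. tens H (mult H (f a) (f' c)) (mult H (g b) (g' d)))"
    by (induction us) (auto simp: tmult_zero tmult_add_right tmult_tens)
  with Cons show ?case by (simp add: p tmult_add_left comp_def split_def)
qed (simp add: tmult_zero)

text \<open>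
  The universal property of the tensor product, restricted to the span of pure tensors: a balanced
  biadditive map on the carrier factors through \<open>tens\<close>. The proof shortens a vanishing sum of
  tensors. If \<open>b0\<close> is the second factor of the first term and its coordinate \<open>j\<close> is nonzero, reading
  coordinate \<open>j\<close> of all second factors writes \<open>a0\<close> as a combination of the remaining first factors, and
  the first term can be distributed over the others.
\<close>

lemma balanced_map_vanishes:
  fixes B :: "'a \<Rightarrow> 'a \<Rightarrow> 'u::ab_group_add"
  assumes add_left: "\<And>x y z. x \<in> carr H \<Longrightarrow> y \<in> carr H \<Longrightarrow> z \<in> carr H \<Longrightarrow> B (x + y) z = B x z + B y z"
    and add_right: "\<And>x y z. x \<in> carr H \<Longrightarrow> y \<in> carr H \<Longrightarrow> z \<in> carr H \<Longrightarrow> B z (x + y) = B z x + B z y"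
    and balanced: "\<And>c x y. x \<in> carr H \<Longrightarrow> y \<in> carr H \<Longrightarrow> B (scal H c x) y = B x (scal H c y)"
    and ts: "set ts \<subseteq> carr H \<times> carr H"
    and zero: "(\<Sum>(a, b)\<leftarrow>ts. tens H a b) = 0"
  shows "(\<Sum>(a, b)\<leftarrow>ts. B a b) = 0"
  using ts zero
proof (induction "length ts" arbitrary: ts)
  case (Suc n)
  then obtain a0 b0 us where ts: "ts = (a0, b0) # us" by (cases ts) auto
  have carr: "a0 \<in> carr H" "b0 \<in> carr H" "set us \<subseteq> carr H \<times> carr H" and len: "n = length us"
    using Suc.prems(1) Suc.hyps(2) ts by auto
  have ev2_ts: "ev a0 i * ev b0 j + (\<Sum>(a, b)\<leftarrow>us. ev a i * ev b j) = 0" for i j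
    using arg_cong[OF Suc.prems(2), of "\<lambda>t. ev2 t (i, j)"]
    by (simp add: ts ev2_add ev2_tens ev2_zero ev2_tensor_sum[where f = "\<lambda>x. x" and g = "\<lambda>x. x"])
  show ?case
  proof (cases "b0 = 0")
    case True
    have "tens H a0 0 = 0" by (rule ev2_inj) (simp add: ev2_tens ev_zero ev2_zero)
    then have "(\<Sum>(a, b)\<leftarrow>us. tens H a b) = 0" using Suc.prems(2) ts True by simp
    then have "(\<Sum>(a, b)\<leftarrow>us. B a b) = 0" using Suc.hyps(1) len carr by blast
    moreover have "B a0 0 = 0" using add_right[OF zero_carr zero_carr carr(1)] by simp
    ultimately show ?thesis by (simp add: ts True)
  next
    case False
    then obtain j where j: "ev b0 j \<noteq> 0" using ev_inj[of b0 0] ev_zero by metis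
    \<comment> \<open>The coefficients of \<open>a0\<close> in terms of the other first factors.\<close>
    define r where "r b = - ev b j / ev b0 j" for b
    have a0: "(\<Sum>(a, b)\<leftarrow>us. scal H (r b) a) = a0"
    proof (rule ev_inj)
      fix i
      have "ev (\<Sum>(a, b)\<leftarrow>us. scal H (r b) a) i = (\<Sum>(a, b)\<leftarrow>us. r b * ev a i)"
        by (induction us) (auto simp: ev_zero ev_add ev_scal)
      also have "\<dots> = - (\<Sum>(a, b)\<leftarrow>us. ev a i * ev b j) / ev b0 j"
        by (induction us) (auto simp: r_def diff_divide_distrib)
      also have "(\<Sum>(a, b)\<leftarrow>us. ev a i * ev b j) = - (ev a0 i * ev b0 j)"
        using ev2_ts[of i j] by (simp add: eq_neg_iff_add_eq_0 add.commute)
      also have "- (- (ev a0 i * ev b0 j)) / ev b0 j = ev a0 i" using j by simp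
      finally show "ev (\<Sum>(a, b)\<leftarrow>us. scal H (r b) a) i = ev a0 i" .
    qed
    define vs where "vs = map (\<lambda>(a, b). (a, b + scal H (r b) b0)) us"
    have tens_vs: "(\<Sum>(a, b)\<leftarrow>vs. tens H a b)
        = (\<Sum>(a, b)\<leftarrow>us. tens H a b) + tens H (\<Sum>(a, b)\<leftarrow>us. scal H (r b) a) b0"
    proof -
      have z: "tens H 0 b0 = 0" by (rule ev2_inj) (simp add: ev2_tens ev_zero ev2_zero)
      show ?thesis unfolding vs_def
        by (induction us) (auto simp: z tens_add_left tens_add_right tens_balanced)
    qed
    have B_vs: "(\<Sum>(a, b)\<leftarrow>vs. B a b)
        = (\<Sum>(a, b)\<leftarrow>us. B a b) + B (\<Sum>(a, b)\<leftarrow>us. scal H (r b) a) b0"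
    proof -
      have z: "B 0 b0 = 0" using add_left[OF zero_carr zero_carr carr(2)] by simp
      have c: "(\<Sum>(a, b)\<leftarrow>ws. scal H (r b) a) \<in> carr H" if "set ws \<subseteq> carr H \<times> carr H" for ws
        using that by (induction ws) (auto simp: zero_carr add_carr scal_carr)
      show ?thesis unfolding vs_def using carr(3)
        by (induction us) (auto simp: z c add_left add_right balanced scal_carr add_carr carr)
    qed
    have "(\<Sum>(a, b)\<leftarrow>vs. tens H a b) = 0"
      using Suc.prems(2) unfolding tens_vs a0 by (simp add: ts add.commute)
    moreover have "set vs \<subseteq> carr H \<times> carr H" "n = length vs"
      using carr len by (auto simp: vs_def add_carr scal_carr)
    ultimately have "(\<Sum>(a, b)\<leftarrow>vs. B a b) = 0" using Suc.hyps(1) by blast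
    then show ?thesis unfolding B_vs a0 by (simp add: ts add.commute)
  qed
qed simp

lemma balanced_map_cong:
  fixes B :: "'a \<Rightarrow> 'a \<Rightarrow> 'u::ab_group_add"
  assumes add_left: "\<And>x y z. x \<in> carr H \<Longrightarrow> y \<in> carr H \<Longrightarrow> z \<in> carr H \<Longrightarrow> B (x + y) z = B x z + B y z"
    and add_right: "\<And>x y z. x \<in> carr H \<Longrightarrow> y \<in> carr H \<Longrightarrow> z \<in> carr H \<Longrightarrow> B z (x + y) = B z x + B z y"
    and balanced: "\<And>c x y. x \<in> carr H \<Longrightarrow> y \<in> carr H \<Longrightarrow> B (scal H c x) y = B x (scal H c y)"
    and ts: "set ts \<subseteq> carr H \<times> carr H" and us: "set us \<subseteq> carr H \<times> carr H"
    and eq: "(\<Sum>(a, b)\<leftarrow>ts. tens H a b) = (\<Sum>(a, b)\<leftarrow>us. tens H a b)"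
  shows "(\<Sum>(a, b)\<leftarrow>ts. B a b) = (\<Sum>(a, b)\<leftarrow>us. B a b)"
proof -
  define neg where "neg = map (\<lambda>(a, b). (scal H (- 1) a, b :: 'a))"
  have neg_add: "scal H (- 1) a + a = 0" for a by (rule ev_inj) (simp add: ev_add ev_scal ev_zero)
  have tneg: "tens H (scal H (- 1) a) b = - tens H a b" for a b
  proof -
    have "tens H 0 b = 0" by (rule ev2_inj) (simp add: ev2_tens ev_zero ev2_zero)
    then have "tens H (scal H (- 1) a) b + tens H a b = 0" by (simp add: neg_add flip: tens_add_left)
    then show ?thesis by (simp add: eq_neg_iff_add_eq_0)
  qed
  have Bneg: "B (scal H (- 1) a) b = - B a b" if "a \<in> carr H" "b \<in> carr H" for a b
  proof -
    have "B 0 b = 0" using add_left[OF zero_carr zero_carr that(2)] by simp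
    then have "B (scal H (- 1) a) b + B a b = 0"
      using add_left[of "scal H (- 1) a" a b] that by (simp add: neg_add scal_carr)
    then show ?thesis by (simp add: eq_neg_iff_add_eq_0)
  qed
  have "(\<Sum>(a, b)\<leftarrow>neg us. tens H a b) = - (\<Sum>(a, b)\<leftarrow>us. tens H a b)"
    by (induction us) (auto simp: neg_def tneg)
  moreover have "set (neg us) \<subseteq> carr H \<times> carr H" using us by (auto simp: neg_def scal_carr)
  ultimately have ts_us: "set (ts @ neg us) \<subseteq> carr H \<times> carr H"
      "(\<Sum>(a, b)\<leftarrow>ts @ neg us. tens H a b) = 0"
    using ts eq by auto
  have "(\<Sum>(a, b)\<leftarrow>ts @ neg us. B a b) = 0"
  proof (rule balanced_map_vanishes[where B = B, OF _ _ _ ts_us])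
    show "B (x + y) z = B x z + B y z" "B z (x + y) = B z x + B z y"
      if "x \<in> carr H" "y \<in> carr H" "z \<in> carr H" for x y z
      using that by (rule add_left, rule add_right)
    show "B (scal H c x) y = B x (scal H c y)" if "x \<in> carr H" "y \<in> carr H" for c x y
      using that by (rule balanced)
  qed
  moreover have "(\<Sum>(a, b)\<leftarrow>neg us. B a b) = - (\<Sum>(a, b)\<leftarrow>us. B a b)"
    using us by (induction us) (auto simp: neg_def Bneg)
  ultimately show ?thesis by simp
qed

text \<open>
  For a morphism of algebras \<open>\<phi>\<close> the map \<open>\<phi> \<otimes> \<phi>\<close> is well defined on tensors, because
  \<open>(a, b) \<mapsto> \<phi> a \<otimes> \<phi> b\<close> is balanced.
\<close>

lemma tensor_image_cong:
  assumes H': "hopf_model H' ev' ev2' tmult'" and \<phi>: "alg_hom H H' \<phi>"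
    and ts: "set ts \<subseteq> carr H \<times> carr H" and us: "set us \<subseteq> carr H \<times> carr H"
    and eq: "(\<Sum>(a, b)\<leftarrow>ts. tens H a b) = (\<Sum>(a, b)\<leftarrow>us. tens H a b)"
  shows "(\<Sum>(a, b)\<leftarrow>ts. tens H' (\<phi> a) (\<phi> b)) = (\<Sum>(a, b)\<leftarrow>us. tens H' (\<phi> a) (\<phi> b))"
proof (rule balanced_map_cong[OF _ _ _ ts us eq])
  interpret H': hopf_model H' ev' ev2' tmult' by (rule H')
  show "tens H' (\<phi> (x + y)) (\<phi> z) = tens H' (\<phi> x) (\<phi> z) + tens H' (\<phi> y) (\<phi> z)"
    "tens H' (\<phi> z) (\<phi> (x + y)) = tens H' (\<phi> z) (\<phi> x) + tens H' (\<phi> z) (\<phi> y)"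
    if "x \<in> carr H" "y \<in> carr H" "z \<in> carr H" for x y z
    using \<phi> that by (simp_all add: alg_hom_def H'.tens_add_left H'.tens_add_right)
  show "tens H' (\<phi> (scal H c x)) (\<phi> y) = tens H' (\<phi> x) (\<phi> (scal H c y))"
    if "x \<in> carr H" "y \<in> carr H" for c x y
    using \<phi> that by (simp add: alg_hom_def H'.tens_balanced)
qed

end

lemma hopf_iso_sym:
  assumes H: "hopf_model H ev ev2 tmult" and iso: "H \<cong>\<^sub>H H'"
  shows "H' \<cong>\<^sub>H H"
proof -
  interpret hopf_model H ev ev2 tmult by (rule H)
  from iso obtain \<phi> where bij: "bij_betw \<phi> (carr H) (carr H')" and alg: "alg_hom H H' \<phi>"
    and coalg: "coalg_hom H H' \<phi>" by (auto simp: hopf_iso_def)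
  define \<psi> where "\<psi> = the_inv_into (carr H) \<phi>"
  have inj: "inj_on \<phi> (carr H)" and surj: "\<phi> ` carr H = carr H'" using bij by (auto simp: bij_betw_def)
  have \<psi>: "\<psi> (\<phi> x) = x" if "x \<in> carr H" for x
    unfolding \<psi>_def using inj that by (rule the_inv_into_f_f)
  have bij': "bij_betw \<psi> (carr H') (carr H)"
    unfolding \<psi>_def using bij by (rule bij_betw_the_inv_into)
  have "alg_hom H' H \<psi>" unfolding alg_hom_def
  proof (intro conjI ballI allI)
    show "\<psi> (unit H') = unit H" using \<psi>[OF unit_carr] alg by (simp add: alg_hom_def)
    fix x assume "x \<in> carr H'"
    then obtain x' where x: "x' \<in> carr H" "x = \<phi> x'" using surj by blast
    then show "\<psi> x \<in> carr H" using \<psi> by simp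
    show "\<psi> (scal H' c x) = scal H c (\<psi> x)" for c
      using \<psi>[OF scal_carr[OF x(1), of c]] alg x \<psi> by (simp add: alg_hom_def)
    fix y assume "y \<in> carr H'"
    then obtain y' where y: "y' \<in> carr H" "y = \<phi> y'" using surj by blast
    show "\<psi> (x + y) = \<psi> x + \<psi> y"
      using \<psi>[OF add_carr[OF x(1) y(1)]] alg x y \<psi> by (simp add: alg_hom_def)
    show "\<psi> (mult H' x y) = mult H (\<psi> x) (\<psi> y)"
      using \<psi>[OF mult_carr[OF x(1) y(1)]] alg x y \<psi> by (simp add: alg_hom_def)
  qed
  moreover have "coalg_hom H' H \<psi>" unfolding coalg_hom_def
  proof (intro conjI ballI)
    fix x assume "x \<in> carr H'"
    then obtain x' where x: "x' \<in> carr H" "x = \<phi> x'" using surj by blast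
    show "counit H (\<psi> x) = counit H' x" using coalg x \<psi> by (simp add: coalg_hom_def)
    obtain ts where ts: "set ts \<subseteq> carr H \<times> carr H" "comult H x' = (\<Sum>(a, b)\<leftarrow>ts. tens H a b)"
      "comult H' (\<phi> x') = (\<Sum>(a, b)\<leftarrow>ts. tens H' (\<phi> a) (\<phi> b))"
      using coalg x by (auto simp: coalg_hom_def)
    let ?us = "map (\<lambda>(a, b). (\<phi> a, \<phi> b)) ts"
    have "(\<Sum>(a, b)\<leftarrow>?us. tens H (\<psi> a) (\<psi> b)) = (\<Sum>(a, b)\<leftarrow>ts. tens H a b)"
      using ts(1) by (induction ts) (auto simp: \<psi>)
    moreover have "(\<Sum>(a, b)\<leftarrow>?us. tens H' a b) = (\<Sum>(a, b)\<leftarrow>ts. tens H' (\<phi> a) (\<phi> b))"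
      by (simp add: comp_def split_def)
    moreover have "set ?us \<subseteq> carr H' \<times> carr H'" using ts(1) surj by auto
    ultimately show "\<exists>us. set us \<subseteq> carr H' \<times> carr H' \<and> comult H' x = (\<Sum>(a, b)\<leftarrow>us. tens H' a b) \<and>
        comult H (\<psi> x) = (\<Sum>(a, b)\<leftarrow>us. tens H (\<psi> a) (\<psi> b))"
      using ts x \<psi> by (intro exI[of _ ?us]) simp
  qed
  ultimately show ?thesis using bij' by (auto simp: hopf_iso_def)
qed

text \<open>
  The two morphisms come with different expansions of the coproduct of \<open>\<phi> x\<close> into pure tensors of
  \<open>H'\<close>, which \<open>tensor_image_cong\<close> makes interchangeable.
\<close>

lemma hopf_iso_trans:
  assumes H': "hopf_model H' ev' ev2' tmult'" and H'': "hopf_model H'' ev'' ev2'' tmult''"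
    and iso: "H \<cong>\<^sub>H H'" "H' \<cong>\<^sub>H H''"
  shows "H \<cong>\<^sub>H H''"
proof -
  interpret H': hopf_model H' ev' ev2' tmult' by (rule H')
  from iso obtain \<phi> \<psi> where bij: "bij_betw \<phi> (carr H) (carr H')" "bij_betw \<psi> (carr H') (carr H'')"
    and alg: "alg_hom H H' \<phi>" "alg_hom H' H'' \<psi>"
    and coalg: "coalg_hom H H' \<phi>" "coalg_hom H' H'' \<psi>" by (auto simp: hopf_iso_def)
  have "coalg_hom H H'' (\<psi> \<circ> \<phi>)" unfolding coalg_hom_def
  proof (intro conjI ballI)
    fix x assume x: "x \<in> carr H"
    then have \<phi>x: "\<phi> x \<in> carr H'" using alg by (simp add: alg_hom_def)
    then show "counit H'' ((\<psi> \<circ> \<phi>) x) = counit H x" using x coalg by (simp add: coalg_hom_def)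
    obtain ts where ts: "set ts \<subseteq> carr H \<times> carr H" "comult H x = (\<Sum>(a, b)\<leftarrow>ts. tens H a b)"
      "comult H' (\<phi> x) = (\<Sum>(a, b)\<leftarrow>ts. tens H' (\<phi> a) (\<phi> b))"
      using coalg x by (auto simp: coalg_hom_def)
    obtain us where us: "set us \<subseteq> carr H' \<times> carr H'" "comult H' (\<phi> x) = (\<Sum>(a, b)\<leftarrow>us. tens H' a b)"
      "comult H'' (\<psi> (\<phi> x)) = (\<Sum>(a, b)\<leftarrow>us. tens H'' (\<psi> a) (\<psi> b))"
      using coalg \<phi>x by (auto simp: coalg_hom_def)
    let ?ts = "map (\<lambda>(a, b). (\<phi> a, \<phi> b)) ts"
    have "set ?ts \<subseteq> carr H' \<times> carr H'" using ts(1) alg(1) by (auto simp: alg_hom_def)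
    moreover have "(\<Sum>(a, b)\<leftarrow>?ts. tens H' a b) = (\<Sum>(a, b)\<leftarrow>us. tens H' a b)"
      using ts(3) us(2) by (simp add: comp_def split_def)
    ultimately have "(\<Sum>(a, b)\<leftarrow>?ts. tens H'' (\<psi> a) (\<psi> b)) = (\<Sum>(a, b)\<leftarrow>us. tens H'' (\<psi> a) (\<psi> b))"
      using H'.tensor_image_cong[OF H'' alg(2) _ us(1)] by blast
    then show "\<exists>ts. set ts \<subseteq> carr H \<times> carr H \<and> comult H x = (\<Sum>(a, b)\<leftarrow>ts. tens H a b) \<and>
        comult H'' ((\<psi> \<circ> \<phi>) x) = (\<Sum>(a, b)\<leftarrow>ts. tens H'' ((\<psi> \<circ> \<phi>) a) ((\<psi> \<circ> \<phi>) b))"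
      using ts us(3) by (intro exI[of _ ts]) (simp add: comp_def split_def)
  qed
  moreover have "alg_hom H H'' (\<psi> \<circ> \<phi>)" using alg by (simp add: alg_hom_def)
  moreover have "bij_betw (\<psi> \<circ> \<phi>) (carr H) (carr H'')" using bij by (rule bij_betw_trans)
  ultimately show ?thesis by (auto simp: hopf_iso_def)
qed

lemma cocommutative_hopf_iso:
  assumes H: "hopf_model H ev ev2 tmult" and H': "hopf_model H' ev' ev2' tmult'"
    and iso: "H \<cong>\<^sub>H H'" and cocomm: "cocommutative H"
  shows "cocommutative H'"
  unfolding cocommutative_def
proof
  interpret hopf_model H ev ev2 tmult by (rule H)
  from iso obtain \<phi> where bij: "bij_betw \<phi> (carr H) (carr H')" and alg: "alg_hom H H' \<phi>"
    and coalg: "coalg_hom H H' \<phi>" by (auto simp: hopf_iso_def)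
  fix y assume "y \<in> carr H'"
  then obtain x where x: "x \<in> carr H" "y = \<phi> x" using bij by (auto simp: bij_betw_def)
  obtain ts where ts: "set ts \<subseteq> carr H \<times> carr H" "comult H x = (\<Sum>(a, b)\<leftarrow>ts. tens H a b)"
    "comult H' y = (\<Sum>(a, b)\<leftarrow>ts. tens H' (\<phi> a) (\<phi> b))"
    using coalg x by (auto simp: coalg_hom_def)
  obtain us where us: "set us \<subseteq> carr H \<times> carr H" "comult H x = (\<Sum>(a, b)\<leftarrow>us. tens H a b)"
    "comult H x = (\<Sum>(a, b)\<leftarrow>us. tens H b a)"
    using cocomm x by (auto simp: cocommutative_def)
  have swap: "(\<Sum>(a, b)\<leftarrow>map prod.swap us. f a b) = (\<Sum>(a, b)\<leftarrow>us. f b a)"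
    for f :: "_ \<Rightarrow> _ \<Rightarrow> 'z::monoid_add"
    by (simp add: comp_def split_def)
  have "set (map prod.swap us) \<subseteq> carr H \<times> carr H" using us(1) by auto
  moreover have "(\<Sum>(a, b)\<leftarrow>map prod.swap us. tens H a b) = (\<Sum>(a, b)\<leftarrow>ts. tens H a b)"
    using us(3) ts(2) swap[of "tens H"] by simp
  ultimately have "(\<Sum>(a, b)\<leftarrow>map prod.swap us. tens H' (\<phi> a) (\<phi> b)) = (\<Sum>(a, b)\<leftarrow>ts. tens H' (\<phi> a) (\<phi> b))"
    using tensor_image_cong[OF H' alg _ ts(1)] by blast
  then have 1: "(\<Sum>(a, b)\<leftarrow>us. tens H' (\<phi> b) (\<phi> a)) = comult H' y"
    using swap[of "\<lambda>a b. tens H' (\<phi> a) (\<phi> b)"] ts(3) by simp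
  have "(\<Sum>(a, b)\<leftarrow>us. tens H' (\<phi> a) (\<phi> b)) = (\<Sum>(a, b)\<leftarrow>ts. tens H' (\<phi> a) (\<phi> b))"
    using tensor_image_cong[OF H' alg us(1) ts(1)] us(2) ts(2) by simp
  then have 2: "(\<Sum>(a, b)\<leftarrow>us. tens H' (\<phi> a) (\<phi> b)) = comult H' y" using ts(3) by simp
  let ?us = "map (\<lambda>(a, b). (\<phi> a, \<phi> b)) us"
  have "set ?us \<subseteq> carr H' \<times> carr H'" using us(1) alg by (auto simp: alg_hom_def)
  then show "\<exists>ts. set ts \<subseteq> carr H' \<times> carr H' \<and> comult H' y = (\<Sum>(a, b)\<leftarrow>ts. tens H' a b) \<and>
      comult H' y = (\<Sum>(a, b)\<leftarrow>ts. tens H' b a)"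
    using 1 2 by (intro exI[of _ ?us]) (simp add: comp_def split_def)
qed

text \<open>
  Expansions of the coproducts of \<open>x\<close> and \<open>y\<close> into pure tensors yield expansions for \<open>x + y\<close>, for scalar
  multiples and for the product, since the comultiplication is a morphism of algebras. The image
  under \<open>\<phi>\<close> follows the same pattern, so compatibility spreads from the generators.
\<close>

lemma coalg_hom_from_generators:
  assumes H: "hopf_model H ev ev2 tmult" and H': "hopf_model H' ev' ev2' tmult'"
    and alg: "alg_hom H H' \<phi>" and gen: "carr H = gen_subalg H S"
    and counit: "\<And>x. x \<in> S \<Longrightarrow> counit H' (\<phi> x) = counit H x"
    and comult: "\<And>x. x \<in> S \<Longrightarrow> \<exists>ts. set ts \<subseteq> carr H \<times> carr H \<and> comult H x = (\<Sum>(a, b)\<leftarrow>ts. tens H a b) \<and>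
        comult H' (\<phi> x) = (\<Sum>(a, b)\<leftarrow>ts. tens H' (\<phi> a) (\<phi> b))"
  shows "coalg_hom H H' \<phi>"
proof -
  interpret H: hopf_model H ev ev2 tmult by (rule H)
  interpret H': hopf_model H' ev' ev2' tmult' by (rule H')
  have \<phi>: "\<phi> (unit H) = unit H'"
    "\<And>x y. x \<in> carr H \<Longrightarrow> y \<in> carr H \<Longrightarrow> \<phi> (x + y) = \<phi> x + \<phi> y"
    "\<And>c x. x \<in> carr H \<Longrightarrow> \<phi> (scal H c x) = scal H' c (\<phi> x)"
    "\<And>x y. x \<in> carr H \<Longrightarrow> y \<in> carr H \<Longrightarrow> \<phi> (mult H x y) = mult H' (\<phi> x) (\<phi> y)"
    using alg by (auto simp: alg_hom_def)
  have "counit H' (\<phi> x) = counit H x \<and>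
     (\<exists>ts. set ts \<subseteq> carr H \<times> carr H \<and> comult H x = (\<Sum>(a, b)\<leftarrow>ts. tens H a b) \<and>
        comult H' (\<phi> x) = (\<Sum>(a, b)\<leftarrow>ts. tens H' (\<phi> a) (\<phi> b)))" (is "?c x \<and> ?P x")
    if "x \<in> gen_subalg H S" for x
    using that
  proof (induction rule: gen_subalg.induct)
    case (gen x)
    then show ?case using counit comult by blast
  next
    case unit
    have "?P (unit H)"
      by (rule exI[of _ "[(unit H, unit H)]"]) (simp add: H.unit_carr H.comult_unit H'.comult_unit \<phi>)
    then show ?case by (simp add: \<phi> H.counit_unit H'.counit_unit)
  next
    case (add x y)
    then have xy: "x \<in> carr H" "y \<in> carr H" by (simp_all add: gen)
    obtain ts us where "set ts \<subseteq> carr H \<times> carr H" "comult H x = (\<Sum>(a, b)\<leftarrow>ts. tens H a b)"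
        "comult H' (\<phi> x) = (\<Sum>(a, b)\<leftarrow>ts. tens H' (\<phi> a) (\<phi> b))"
        "set us \<subseteq> carr H \<times> carr H" "comult H y = (\<Sum>(a, b)\<leftarrow>us. tens H a b)"
        "comult H' (\<phi> y) = (\<Sum>(a, b)\<leftarrow>us. tens H' (\<phi> a) (\<phi> b))"
      using add.IH by blast
    then have "?P (x + y)" using xy
      by (intro exI[of _ "ts @ us"]) (simp add: \<phi> H.comult_add H'.comult_add)
    then show ?case using add xy by (simp add: \<phi> H.counit_add H'.counit_add)
  next
    case (scal x c)
    then have x: "x \<in> carr H" by (simp add: gen)
    obtain ts where ts: "set ts \<subseteq> carr H \<times> carr H" "comult H x = (\<Sum>(a, b)\<leftarrow>ts. tens H a b)"
        "comult H' (\<phi> x) = (\<Sum>(a, b)\<leftarrow>ts. tens H' (\<phi> a) (\<phi> b))"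
      using scal.IH by blast
    let ?us = "map (\<lambda>(a, b). (scal H c a, b)) ts"
    have "comult H (scal H c x) = (\<Sum>(a, b)\<leftarrow>?us. tens H a b)"
    proof (rule H.ev2_inj)
      fix i j
      have "c * (\<Sum>(a, b)\<leftarrow>ts. ev a i * ev b j) = (\<Sum>(a, b)\<leftarrow>ts. ev (scal H c a) i * ev b j)"
        by (induction ts) (auto simp: H.ev_scal distrib_left mult.assoc)
      then show "ev2 (comult H (scal H c x)) (i, j) = ev2 (\<Sum>(a, b)\<leftarrow>?us. tens H a b) (i, j)"
        using H.ev2_tensor_sum[of "\<lambda>x. x" "\<lambda>x. x"] H.ev2_tensor_sum[of "scal H c" "\<lambda>x. x"]
        by (simp add: H.comult_scal ts(2) comp_def split_def)
    qed
    moreover have "comult H' (\<phi> (scal H c x)) = (\<Sum>(a, b)\<leftarrow>?us. tens H' (\<phi> a) (\<phi> b))"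
    proof (rule H'.ev2_inj)
      fix i j
      have "c * (\<Sum>(a, b)\<leftarrow>ts. ev' (\<phi> a) i * ev' (\<phi> b) j) = (\<Sum>(a, b)\<leftarrow>ts. ev' (\<phi> (scal H c a)) i * ev' (\<phi> b) j)"
        using ts(1) by (induction ts) (auto simp: H'.ev_scal \<phi> distrib_left mult.assoc)
      then show "ev2' (comult H' (\<phi> (scal H c x))) (i, j) = ev2' (\<Sum>(a, b)\<leftarrow>?us. tens H' (\<phi> a) (\<phi> b)) (i, j)"
        using H'.ev2_tensor_sum[of \<phi> \<phi>] H'.ev2_tensor_sum[of "\<lambda>x. \<phi> (scal H c x)" \<phi>]
        by (simp add: H'.comult_scal \<phi> x ts(3) comp_def split_def)
    qed
    moreover have "set ?us \<subseteq> carr H \<times> carr H" using ts(1) by (auto simp: H.scal_carr)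
    ultimately have "?P (scal H c x)" by blast
    then show ?case using scal x by (simp add: \<phi> H.counit_scal H'.counit_scal)
  next
    case (mult x y)
    then have xy: "x \<in> carr H" "y \<in> carr H" by (simp_all add: gen)
    obtain ts us where ts: "set ts \<subseteq> carr H \<times> carr H" "comult H x = (\<Sum>(a, b)\<leftarrow>ts. tens H a b)"
        "comult H' (\<phi> x) = (\<Sum>(a, b)\<leftarrow>ts. tens H' (\<phi> a) (\<phi> b))"
        and us: "set us \<subseteq> carr H \<times> carr H" "comult H y = (\<Sum>(a, b)\<leftarrow>us. tens H a b)"
        "comult H' (\<phi> y) = (\<Sum>(a, b)\<leftarrow>us. tens H' (\<phi> a) (\<phi> b))"
      using mult.IH by blast
    let ?vs = "map (\<lambda>((a, b), (c, d)). (mult H a c, mult H b d)) (List.product ts us)"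
    have "comult H (mult H x y) = (\<Sum>(a, b)\<leftarrow>?vs. tens H a b)"
      using H.tensor_sum_mult[where f = "\<lambda>x. x" and g = "\<lambda>x. x" and f' = "\<lambda>x. x" and g' = "\<lambda>x. x"]
      by (simp add: H.comult_mult ts us comp_def split_def)
    moreover have "comult H' (\<phi> (mult H x y)) = (\<Sum>(a, b)\<leftarrow>?vs. tens H' (\<phi> a) (\<phi> b))"
    proof -
      have "comult H' (\<phi> (mult H x y)) = (\<Sum>((a, b), (c, d))\<leftarrow>List.product ts us.
          tens H' (mult H' (\<phi> a) (\<phi> c)) (mult H' (\<phi> b) (\<phi> d)))"
        by (simp add: \<phi> xy H'.comult_mult ts us H'.tensor_sum_mult)
      also have "\<dots> = (\<Sum>(a, b)\<leftarrow>?vs. tens H' (\<phi> a) (\<phi> b))"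
        unfolding map_map
        by (rule arg_cong[where f = sum_list], rule map_cong[OF refl])
          (auto simp: \<phi> dest!: subsetD[OF ts(1)] subsetD[OF us(1)])
      finally show ?thesis .
    qed
    moreover have "set ?vs \<subseteq> carr H \<times> carr H" using ts(1) us(1) H.mult_carr by fastforce
    ultimately have "?P (mult H x y)" by blast
    then show ?case using mult xy by (simp add: \<phi> H.counit_mult H'.counit_mult)
  qed
  then show ?thesis by (simp add: coalg_hom_def gen)
qed

text \<open>
  Cocommutativity says that the identity is a morphism to the co-opposite coalgebra.
\<close>

lemma cocommutative_from_generators:
  assumes H: "hopf_model H ev ev2 tmult" and gen: "carr H = gen_subalg H S"
    and comult: "\<And>x. x \<in> S \<Longrightarrow> \<exists>ts. set ts \<subseteq> carr H \<times> carr H \<and>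
        comult H x = (\<Sum>(a, b)\<leftarrow>ts. tens H a b) \<and> comult H x = (\<Sum>(a, b)\<leftarrow>ts. tens H b a)"
  shows "cocommutative H"
proof -
  interpret H: hopf_model H ev ev2 tmult by (rule H)
  \<comment> \<open>The co-opposite coalgebra: reversing \<open>tens\<close> amounts to reversing the coproduct.\<close>
  let ?H' = "H\<lparr>tens := \<lambda>a b. tens H b a\<rparr>"
  have H': "hopf_model ?H' ev (\<lambda>t (i, j). ev2 t (j, i)) tmult"
  proof unfold_locales
    show "x = y" if "\<And>i. ev x i = ev y i" for x y using that by (rule H.ev_inj)
    show "s = t" if "\<And>i j. (case (i, j) of (i, j) \<Rightarrow> ev2 s (j, i)) = (case (i, j) of (i, j) \<Rightarrow> ev2 t (j, i))" for s t
      using that by (intro H.ev2_inj) simp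
  qed (auto simp: H.unit_carr H.add_carr H.scal_carr H.mult_carr H.ev_add H.ev_scal
      H.ev2_add H.ev2_tens H.tmult_add_left H.tmult_add_right H.tmult_tens H.comult_unit H.comult_add
      H.comult_scal H.comult_mult H.counit_unit H.counit_add H.counit_scal H.counit_mult)
  have "coalg_hom H ?H' (\<lambda>x. x)"
    by (rule coalg_hom_from_generators[OF H H' _ gen])
      (use comult in \<open>auto simp: alg_hom_def\<close>)
  then show ?thesis by (simp add: coalg_hom_def cocommutative_def)
qed

lemma gen_subalg_mono:
  assumes "\<And>x. x \<in> S \<Longrightarrow> x \<in> gen_subalg H T"
  shows "gen_subalg H S \<subseteq> gen_subalg H T"
proof
  fix x assume "x \<in> gen_subalg H S"
  then show "x \<in> gen_subalg H T"
    by induction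
      ((rule assms gen_subalg.unit gen_subalg.add gen_subalg.scal gen_subalg.mult; assumption)+)
qed

lemma gen_subalg_eqI:
  assumes "\<And>x. x \<in> S \<Longrightarrow> x \<in> gen_subalg H T" "\<And>x. x \<in> T \<Longrightarrow> x \<in> gen_subalg H S"
  shows "gen_subalg H S = gen_subalg H T"
  using gen_subalg_mono[of S H T] gen_subalg_mono[of T H S] assms by blast

lemma gen_subalg_carr_update [simp]: "gen_subalg (H\<lparr>carr := C\<rparr>) S = gen_subalg H S"
proof -
  have sub: "gen_subalg H S \<subseteq> gen_subalg H' S"
    if "unit H = unit H'" "scal H = scal H'" "mult H = mult H'" for H H' :: "('k, 'a, 't) hopf"
  proof
    fix x assume "x \<in> gen_subalg H S"
    then show "x \<in> gen_subalg H' S"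
    proof induction
      case unit
      show ?case unfolding that by (rule gen_subalg.unit)
    next
      case (scal x c)
      then show ?case unfolding that by (intro gen_subalg.scal)
    next
      case (mult x y)
      then show ?case unfolding that by (intro gen_subalg.mult)
    qed (rule gen_subalg.gen gen_subalg.add; assumption)+
  qed
  show ?thesis by (intro equalityI sub) simp_all
qed

lemma gen_subalg_image:
  assumes unit: "\<phi> (unit H) = unit H'" and add: "\<And>x y. \<phi> (x + y) = \<phi> x + \<phi> y"
    and scal: "\<And>c x. \<phi> (scal H c x) = scal H' c (\<phi> x)"
    and mult: "\<And>x y. \<phi> (mult H x y) = mult H' (\<phi> x) (\<phi> y)"
  shows "\<phi> ` gen_subalg H S = gen_subalg H' (\<phi> ` S)"
proof (intro equalityI subsetI)
  fix y assume "y \<in> \<phi> ` gen_subalg H S"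
  then obtain x where "x \<in> gen_subalg H S" "y = \<phi> x" by blast
  then show "y \<in> gen_subalg H' (\<phi> ` S)"
  proof (induction arbitrary: y)
    case (gen x)
    then show ?case by (simp add: gen_subalg.gen)
  qed (simp_all add: assms gen_subalg.unit gen_subalg.add gen_subalg.scal gen_subalg.mult)
next
  fix y assume "y \<in> gen_subalg H' (\<phi> ` S)"
  then show "y \<in> \<phi> ` gen_subalg H S"
  proof induction
    case (gen x)
    then show ?case using gen_subalg.gen by blast
  next
    case unit
    show ?case unfolding assms(1)[symmetric] by (intro imageI gen_subalg.unit)
  next
    case (add x y)
    then obtain x' y' where "x = \<phi> x'" "y = \<phi> y'" "x' \<in> gen_subalg H S" "y' \<in> gen_subalg H S" by blast
    then show ?case by (simp add: gen_subalg.add flip: assms(2))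
  next
    case (scal x c)
    then obtain x' where "x = \<phi> x'" "x' \<in> gen_subalg H S" by blast
    then show ?case by (simp add: gen_subalg.scal flip: assms(3))
  next
    case (mult x y)
    then obtain x' y' where "x = \<phi> x'" "y = \<phi> y'" "x' \<in> gen_subalg H S" "y' \<in> gen_subalg H S" by blast
    then show ?case by (simp add: gen_subalg.mult flip: assms(4))
  qed
qed


section \<open>Power series with coefficients in a subalgebra\<close>

text \<open>
  Products and compositions of series with coefficients in a subalgebra have coefficients in it. This
  puts the cofactors of the coproduct into \<open>A_hopf 1 \<beta>\<close>, and it compares algebras of functions by
  their generators.
\<close>

locale subalgebra = scalars \<iota> for \<iota> :: "'k::field_char_0 \<Rightarrow> 'r::comm_ring_1" +
  fixes C :: "'r set"
  assumes scalar_in: "\<iota> c \<in> C"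
    and add_in: "x \<in> C \<Longrightarrow> y \<in> C \<Longrightarrow> x + y \<in> C"
    and mult_in: "x \<in> C \<Longrightarrow> y \<in> C \<Longrightarrow> x * y \<in> C"
begin

lemma zero_in: "0 \<in> C" and one_in: "1 \<in> C"
  using scalar_in[of 0] scalar_in[of 1] by (simp_all add: h_zero h_one)

lemma diff_in: "x \<in> C \<Longrightarrow> y \<in> C \<Longrightarrow> x - y \<in> C"
  using add_in[OF _ mult_in[OF scalar_in[of "- 1"]]] by (simp add: h_minus h_one)

lemma sum_in: "(\<And>i. i \<in> A \<Longrightarrow> f i \<in> C) \<Longrightarrow> sum f A \<in> C"
  by (induction A rule: infinite_finite_induct) (simp_all add: zero_in add_in)

lemma fps_const_in: "x \<in> C \<Longrightarrow> fps_nth (fps_const x) n \<in> C"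
  and fps_one_in: "fps_nth 1 n \<in> C" and fps_X_in: "fps_nth fps_X n \<in> C"
  by (simp_all add: fps_X_def zero_in one_in)

lemma fps_diff_in: "(\<And>n. fps_nth X n \<in> C) \<Longrightarrow> (\<And>n. fps_nth Y n \<in> C) \<Longrightarrow> fps_nth (X - Y) n \<in> C"
  by (simp add: diff_in)

lemma fps_mult_in: "(\<And>n. fps_nth X n \<in> C) \<Longrightarrow> (\<And>n. fps_nth Y n \<in> C) \<Longrightarrow> fps_nth (X * Y) n \<in> C"
  by (simp add: fps_mult_nth sum_in mult_in)

lemma fps_power_in: "(\<And>n. fps_nth X n \<in> C) \<Longrightarrow> fps_nth (X ^ i) n \<in> C"
  by (induction i arbitrary: n) (simp_all add: zero_in one_in fps_mult_in)

lemma fps_compose_in: "(\<And>n. fps_nth X n \<in> C) \<Longrightarrow> fps_nth ((fps_map \<iota> P) oo X) n \<in> C"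
  unfolding fps_compose_nth by (simp add: sum_in mult_in scalar_in fps_power_in)

end

lemma (in scalars) subalgebra_gen_subalg:
  assumes "unit H = 1" "mult H = (*)" "\<And>c x. scal H c x = \<iota> c * x"
  shows "subalgebra \<iota> (gen_subalg H S)"
proof unfold_locales
  show "\<iota> c \<in> gen_subalg H S" for c
    using gen_subalg.scal[OF gen_subalg.unit, of H c S] by (simp add: assms)
  show "x * y \<in> gen_subalg H S" if "x \<in> gen_subalg H S" "y \<in> gen_subalg H S" for x y
    using gen_subalg.mult[OF that] by (simp add: assms)
qed (rule gen_subalg.add)


section \<open>The tensor square of the Connes-Kreimer algebra\<close>

abbreviation lookup :: "('a \<Rightarrow>\<^sub>0 'b::zero) \<Rightarrow> 'a \<Rightarrow> 'b" where
  "lookup \<equiv> Poly_Mapping.lookup"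

abbreviation single :: "'a \<Rightarrow> 'b \<Rightarrow> 'a \<Rightarrow>\<^sub>0 'b::zero" where
  "single \<equiv> Poly_Mapping.single"

abbreviation keys :: "('a \<Rightarrow>\<^sub>0 'b::zero) \<Rightarrow> 'a set" where
  "keys \<equiv> Poly_Mapping.keys"

abbreviation ck_scalar :: "'k::comm_ring_1 \<Rightarrow> 'k ck" where
  "ck_scalar \<equiv> single {#}"

abbreviation ck2_scalar :: "'k::comm_ring_1 \<Rightarrow> 'k ck2" where
  "ck2_scalar \<equiv> single ({#}, {#})"

text \<open>
  The two embeddings \<open>x \<mapsto> x \<otimes> 1\<close> and \<open>y \<mapsto> 1 \<otimes> y\<close> are ring morphisms, and \<open>x \<otimes> y\<close> is the product of
  the images. Applied coefficientwise they move power series into the tensor square.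
\<close>

abbreviation ck_left :: "'k::comm_ring_1 ck \<Rightarrow> 'k ck2" where
  "ck_left x \<equiv> ck_tens x 1"

abbreviation ck_right :: "'k::comm_ring_1 ck \<Rightarrow> 'k ck2" where
  "ck_right y \<equiv> ck_tens 1 y"

lemma zero_pair_mset: "(0 :: 'a multiset \<times> 'b multiset) = ({#}, {#})"
  by (simp add: zero_prod_def)

interpretation ck_scalar: scalars "ck_scalar :: 'k::field_char_0 \<Rightarrow> 'k ck"
  by unfold_locales (simp_all add: single_add mult_single)

interpretation ck2_scalar: scalars "ck2_scalar :: 'k::field_char_0 \<Rightarrow> 'k ck2"
  by unfold_locales (simp_all add: single_add mult_single flip: zero_pair_mset)

lemma lookup_ck_tens:
  "lookup (ck_tens x y) (F, G) = lookup x F * lookup y G"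
proof -
  have "lookup (lin_ext (\<lambda>G. single (F', G) 1) y) (F, G)
      = (if F' = F then lookup y G else 0)" for F'
    by (auto simp: lookup_lin_ext[OF finite_keys order_refl] lookup_single when_def in_keys_iff
        sum.delta' mult.commute[of _ "if _ then _ else _"] if_distrib[where f = "\<lambda>x. x * _"] cong: if_cong)
  then show ?thesis
    by (auto simp: ck_tens_def lookup_lin_ext[OF finite_keys order_refl] in_keys_iff
        sum.delta' if_distrib[where f = "\<lambda>x. _ * x"] cong: if_cong)
qed

lemma ck2_eqI:
  fixes s t :: "'k::zero ck2"
  assumes "\<And>F G. lookup s (F, G) = lookup t (F, G)"
  shows "s = t"
  by (rule poly_mapping_eqI) (use assms in auto)

lemma ck_tens_add_left: "ck_tens (x + y) z = ck_tens x z + ck_tens y z"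
  by (rule ck2_eqI) (simp add: lookup_ck_tens lookup_add distrib_right)

lemma ck_tens_add_right: "ck_tens z (x + y) = ck_tens z x + ck_tens z y"
  by (rule ck2_eqI) (simp add: lookup_ck_tens lookup_add distrib_left)

lemma ck_tens_zero: "ck_tens 0 z = 0" "ck_tens z 0 = 0"
  by (rule ck2_eqI, simp add: lookup_ck_tens)+

lemma ck_tens_mult: "ck_tens a b * ck_tens c d = ck_tens (a * c) (b * d)"
proof (induction a rule: poly_mapping_single_induct)
  case (2 F k)
  show ?case
  proof (induction b rule: poly_mapping_single_induct)
    case (2 G l)
    show ?case
    proof (induction c rule: poly_mapping_single_induct)
      case (2 F' k')
      show ?case
      proof (induction d rule: poly_mapping_single_induct)
        case (2 G' l')
        show ?case by (simp add: ck_tens_single mult_single ac_simps)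
      qed (simp_all add: ck_tens_zero ck_tens_add_right distrib_left)
    qed (simp_all add: ck_tens_zero ck_tens_add_left distrib_left)
  qed (simp_all add: ck_tens_zero ck_tens_add_right distrib_left distrib_right)
qed (simp_all add: ck_tens_zero ck_tens_add_left distrib_left distrib_right)

lemma ck_tens_one: "ck_tens 1 1 = 1"
  by (metis ck_tens_single mult_1 single_one zero_pair_mset)

interpretation ck_left: ring_morphism "ck_left :: 'k::field_char_0 ck \<Rightarrow> _"
  by unfold_locales (simp_all add: ck_tens_one ck_tens_add_left ck_tens_mult)

interpretation ck_right: ring_morphism "ck_right :: 'k::field_char_0 ck \<Rightarrow> _"
  by unfold_locales (simp_all add: ck_tens_one ck_tens_add_right ck_tens_mult)

lemma ck_comult_add: "ck_comult (x + y) = ck_comult x + ck_comult y"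
  by (simp add: ck_comult_def lin_ext_add)

interpretation ck_comult: ring_morphism "ck_comult :: 'k::field_char_0 ck \<Rightarrow> _"
  by unfold_locales (simp_all add: ck_comult_1 ck_comult_add ck_comult_mult)

lemma ck_left_scalar: "ck_left (ck_scalar c) = ck2_scalar c"
  and ck_right_scalar: "ck_right (ck_scalar c) = ck2_scalar c"
  by (metis ck_tens_single mult_1_right single_one, metis ck_tens_single mult_1 single_one)

lemma ck_comult_scalar: "ck_comult (ck_scalar c) = ck2_scalar c"
  unfolding ck_comult_def
  by (simp add: lin_ext_single mult_map_scale_conv_mult zero_pair_mset)

lemma scal_eq_scalar_mult: "Poly_Mapping.map ((*) c) x = ck_scalar c * x"
  for x :: "'k::field_char_0 ck"
  by (simp add: mult_map_scale_conv_mult)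

lemma Bplus_add: "Bplus (x + y) = Bplus x + Bplus y"
  by (simp add: Bplus_def lin_ext_add)

lemma id_Bplus_add: "id_Bplus (x + y) = id_Bplus x + id_Bplus y"
  by (simp add: id_Bplus_def lin_ext_add)

lemma Bplus_zero: "Bplus 0 = 0" and id_Bplus_zero: "id_Bplus 0 = 0"
  by (simp_all add: Bplus_def id_Bplus_def lin_ext_def)

lemma id_Bplus_sum: "id_Bplus (sum f A) = (\<Sum>i\<in>A. id_Bplus (f i))"
  by (induction A rule: infinite_finite_induct) (simp_all add: id_Bplus_zero id_Bplus_add)

lemma Bplus_single: "Bplus (single F c) = single {#Node F#} c"
  for c :: "'k::field_char_0"
  by (simp add: Bplus_def lin_ext_single tree_elt_def mult_map_scale_conv_mult mult_single)

lemma id_Bplus_single: "id_Bplus (single (F, G) c) = single (F, {#Node G#}) c"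
  for c :: "'k::field_char_0"
  by (simp add: id_Bplus_def lin_ext_single mult_map_scale_conv_mult mult_single)

lemma id_Bplus_tens: "id_Bplus (ck_tens x y) = ck_tens x (Bplus y)"
  for x y :: "'k::field_char_0 ck"
proof (induction x rule: poly_mapping_single_induct)
  case (2 F k)
  show ?case
  proof (induction y rule: poly_mapping_single_induct)
    case (2 G l)
    show ?case by (simp add: ck_tens_single Bplus_single id_Bplus_single)
  qed (simp_all add: ck_tens_zero ck_tens_add_right id_Bplus_zero Bplus_zero id_Bplus_add Bplus_add)
qed (simp_all add: ck_tens_zero ck_tens_add_left id_Bplus_zero id_Bplus_add)

lemma H_CK_subalgebra: "subalgebra ck_scalar (gen_subalg H_CK S)" for S :: "'k::field_char_0 ck set"
  by (rule ck_scalar.subalgebra_gen_subalg) (simp_all add: H_CK_def fun_eq_iff scal_eq_scalar_mult)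

lemma H_CK_model: "hopf_model (H_CK\<lparr>carr := gen_subalg H_CK S\<rparr>)
    lookup lookup (*)" for S :: "'k::field_char_0 ck set"
proof -
  have counit: "lookup (x * y) {#} = lookup x {#} * lookup y {#}"
    for x y :: "'k ck"
  proof (induction x rule: poly_mapping_single_induct)
    case (2 F k)
    show ?case
    proof (induction y rule: poly_mapping_single_induct)
      case (2 G l)
      show ?case by (simp add: mult_single lookup_single when_def)
    qed (simp_all add: distrib_left lookup_add)
  qed (simp_all add: distrib_right lookup_add)
  have comult: "ck_comult (Poly_Mapping.map ((*) c) x) = Poly_Mapping.map ((*) c) (ck_comult x)"
    for c and x :: "'k ck"
    by (simp add: scal_eq_scalar_mult ck_comult_mult ck_comult_scalar mult_map_scale_conv_mult zero_pair_mset)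
  interpret C: subalgebra ck_scalar "gen_subalg H_CK S" by (rule H_CK_subalgebra)
  have scal: "Poly_Mapping.map ((*) c) x \<in> gen_subalg H_CK S" if "x \<in> gen_subalg H_CK S" for c x
    using C.mult_in[OF C.scalar_in[of c] that] by (simp add: scal_eq_scalar_mult)
  show ?thesis
  proof unfold_locales
    show "x = y" if "\<And>i. lookup x i = lookup y i" for x y :: "'k ck"
      using that by (rule poly_mapping_eqI)
    show "s = t" if "\<And>i j. lookup s (i, j) = lookup t (i, j)" for s t :: "'k ck2"
      using that by (rule ck2_eqI)
  qed (use C.one_in C.add_in C.mult_in scal in \<open>simp_all add: H_CK_def lookup_add lookup_scale lookup_ck_tens
      distrib_left distrib_right ck_tens_mult ck_comult_1 ck_tens_one ck_comult_add comult ck_comult_mult counit\<close>)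
qed


section \<open>The coproduct of a Dyson-Schwinger solution\<close>

lemma P_series_ode: "(1 - fps_const (\<alpha> * \<beta>) * fps_X) * fps_deriv (P_series \<alpha> \<beta>) = fps_const \<alpha> * P_series \<alpha> \<beta>"
  and P_series_0: "fps_nth (P_series \<alpha> \<beta>) 0 = 1" for \<alpha> \<beta> :: "'k::field_char_0"
  using theI'[OF P_series_ex1[of \<alpha> \<beta>]] by (simp_all add: P_series_def)

lemma P_series_rec:
  "of_nat (Suc n) * fps_nth (P_series \<alpha> \<beta>) (Suc n)
    = \<alpha> * (1 + \<beta> * of_nat n) * fps_nth (P_series \<alpha> \<beta>) n" for \<alpha> \<beta> :: "'k::field_char_0"
  using P_series_ode[of \<alpha> \<beta>] unfolding P_series_iff by (simp add: algebra_simps del: of_nat_Suc)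

lemma P_series_scale: "fps_nth (P_series \<alpha> \<beta>) n = \<alpha> ^ n * fps_nth (P_series 1 \<beta>) n"
  for \<alpha> \<beta> :: "'k::field_char_0"
proof (induction n)
  case (Suc n)
  have "of_nat (Suc n) * fps_nth (P_series \<alpha> \<beta>) (Suc n)
      = \<alpha> ^ Suc n * (of_nat (Suc n) * fps_nth (P_series 1 \<beta>) (Suc n))"
    unfolding P_series_rec Suc by simp
  then have "of_nat (Suc n) * fps_nth (P_series \<alpha> \<beta>) (Suc n)
      = of_nat (Suc n) * (\<alpha> ^ Suc n * fps_nth (P_series 1 \<beta>) (Suc n))" by (simp only: ac_simps)
  then show ?case by (metis mult_cancel_left of_nat_neq_0)
qed (simp add: P_series_0)

lemma scalar_fps_eq: "scalar_fps P = fps_map ck_scalar P"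
  by (rule fps_ext) (simp add: scalar_fps_def)

lemma completed_Bplus_eq: "completed_Bplus X = fps_X * fps_map Bplus X"
  by (simp add: completed_Bplus_def fps_map_def)

lemma DS_solution_properties:
  "fps_nth (DS_solution \<alpha> \<beta>) 0 = 0 \<and> (\<forall>n. homogeneous n (fps_nth (DS_solution \<alpha> \<beta>) n)) \<and>
    DS_solution \<alpha> \<beta> = completed_Bplus ((scalar_fps (P_series \<alpha> \<beta>)) oo (DS_solution \<alpha> \<beta>))"
  for \<alpha> \<beta> :: "'k::field_char_0"
  unfolding DS_solution_def by (rule theI'[OF DS_solution_ex1])

lemmas DS_solution_0 = DS_solution_properties[THEN conjunct1]
  and DS_solution_homogeneous = DS_solution_properties[THEN conjunct2, THEN conjunct1, rule_format]
  and DS_solution_fixpoint = DS_solution_properties[THEN conjunct2, THEN conjunct2]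

lemma DS_solution_unique:
  assumes "fps_nth X 0 = 0" "\<And>n. homogeneous n (fps_nth X n)"
    "X = completed_Bplus ((scalar_fps (P_series \<alpha> \<beta>)) oo X)"
  shows "X = DS_solution \<alpha> \<beta>"
  unfolding DS_solution_def
  by (rule the1_equality[OF DS_solution_ex1, symmetric]) (use assms in blast)

text \<open>
  Since \<open>P_series \<alpha> \<beta>\<close> is \<open>P_series 1 \<beta>\<close> evaluated at \<open>\<alpha> h\<close>, the series \<open>\<alpha> X\<close> solves the equation with
  \<open>Bplus\<close> multiplied by \<open>\<alpha>\<close>. By homogeneity, multiplying \<open>Bplus\<close> by \<open>\<alpha>\<close> multiplies the component of
  degree \<open>n\<close> of the solution by \<open>\<alpha>\<^sup>n\<close>.
\<close>

lemma DS_solution_scale: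
  fixes \<alpha> \<beta> :: "'k::field_char_0"
  shows "fps_nth (DS_solution \<alpha> \<beta>) (Suc n) = ck_scalar (\<alpha> ^ n) * fps_nth (DS_solution 1 \<beta>) (Suc n)"
proof -
  define X where "X = DS_solution 1 \<beta>"
  define Y where "Y = Abs_fps (\<lambda>n. ck_scalar (\<alpha> ^ (n - 1)) * fps_nth X n)"
  let ?a = "fps_const (ck_scalar \<alpha>)" and ?P = "\<lambda>\<alpha>. fps_map ck_scalar (P_series \<alpha> \<beta>)"
  have pow: "ck_scalar \<alpha> ^ m = ck_scalar (\<alpha> ^ m)" for m
    by (induction m) (simp_all add: mult_single)
  have X0: "fps_nth X 0 = 0" by (simp add: X_def DS_solution_0)
  \<comment> \<open>Multiplying by \<open>\<alpha>\<close> compensates the shifted exponent \<open>n - 1\<close>.\<close>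
  have aY: "?a * Y = (X oo (?a * fps_X))"
  proof (rule fps_ext)
    fix n show "fps_nth (?a * Y) n = fps_nth (X oo (?a * fps_X)) n"
      by (cases n) (simp_all add: Y_def X0 pow mult_single mult.assoc[symmetric])
  qed
  have PY: "fps_nth ((?P \<alpha>) oo Y) n = ck_scalar (\<alpha> ^ n) * fps_nth ((?P 1) oo X) n" for n
  proof -
    have "ck_scalar (fps_nth (P_series \<alpha> \<beta>) i) * fps_nth (Y ^ i) n
        = ck_scalar (\<alpha> ^ n) * (ck_scalar (fps_nth (P_series 1 \<beta>) i) * fps_nth (X ^ i) n)" for i
    proof -
      have "ck_scalar (fps_nth (P_series \<alpha> \<beta>) i) * fps_nth (Y ^ i) n
          = ck_scalar (fps_nth (P_series 1 \<beta>) i) * fps_nth ((?a * Y) ^ i) n"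
        by (subst P_series_scale)
          (simp add: power_mult_distrib pow fps_const_power mult_single ac_simps flip: ck_scalar.h_mult)
      also have "(?a * Y) ^ i = ((X ^ i) oo (?a * fps_X))"
        unfolding aY by (rule fps_compose_pow[symmetric]) simp
      also have "fps_nth ((X ^ i) oo (?a * fps_X)) n = ck_scalar (\<alpha> ^ n) * fps_nth (X ^ i) n"
        by (simp add: pow)
      finally show ?thesis by (simp only: ac_simps)
    qed
    then show ?thesis by (simp add: fps_compose_nth sum_distrib_left)
  qed
  have "Y = DS_solution \<alpha> \<beta>"
  proof (rule DS_solution_unique)
    show "fps_nth Y 0 = 0" by (simp add: Y_def X0)
    show "homogeneous n (fps_nth Y n)" for n
      using homogeneous_mult[OF homogeneous_scalar DS_solution_homogeneous[of n 1 \<beta>]]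
      by (simp add: Y_def X_def)
    have Bplus_scalar: "Bplus (ck_scalar c * x) = ck_scalar c * Bplus x" for c :: 'k and x
      by (induction x rule: poly_mapping_single_induct)
        (simp_all add: Bplus_zero Bplus_single mult_single distrib_left Bplus_add)
    show "Y = completed_Bplus ((scalar_fps (P_series \<alpha> \<beta>)) oo Y)"
    proof (rule fps_ext)
      fix n
      show "fps_nth Y n = fps_nth (completed_Bplus ((scalar_fps (P_series \<alpha> \<beta>)) oo Y)) n"
      proof (cases n)
        case (Suc m)
        have "fps_nth X (Suc m) = Bplus (fps_nth ((?P 1) oo X) m)"
          by (subst X_def, subst DS_solution_fixpoint) (simp add: scalar_fps_eq completed_Bplus_eq X_def)
        moreover have "fps_nth Y (Suc m) = ck_scalar (\<alpha> ^ m) * fps_nth X (Suc m)" by (simp add: Y_def)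
        ultimately show ?thesis
          by (simp add: Suc scalar_fps_eq completed_Bplus_eq PY Bplus_scalar)
      qed (simp add: Y_def X0 completed_Bplus_eq)
    qed
  qed
  moreover have "fps_nth Y (Suc n) = ck_scalar (\<alpha> ^ n) * fps_nth X (Suc n)" by (simp add: Y_def)
  ultimately show ?thesis by (simp only: X_def)
qed

text \<open>
  \<open>id \<otimes> Bplus\<close> is linear over the left tensor factor. As the coefficients of \<open>a\<close> and \<open>g\<close> lie in that
  factor, it acts only on the coefficients of \<open>y\<close>.
\<close>

lemma id_Bplus_compose:
  fixes a g y :: "'k::field_char_0 ck fps"
  assumes "fps_nth g 0 = 0"
  shows "fps_map id_Bplus (fps_map ck_left a * ((fps_map ck_right y) oo (fps_map ck_left g)))
    = fps_map ck_left a * ((fps_map ck_right (fps_map Bplus y)) oo (fps_map ck_left g))"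
proof -
  have g: "fps_nth (fps_map ck_left g) 0 = 0" by (simp add: assms ck_tens_zero)
  show ?thesis
    by (rule fps_ext)
      (simp add: fps_mult_compose_nth_eq_sum[OF g] id_Bplus_sum ck_tens_mult id_Bplus_tens
        flip: ck_left.fps_map_power ck_left.fps_map_mult)
qed

text \<open>
  In the notation \<open>x = X \<otimes> 1\<close>, \<open>y = 1 \<otimes> X\<close>, \<open>G = t P' x\<close>, the claim is \<open>\<Delta> X = x + (1 - \<beta> x) (y \<circ> G)\<close>. The cocycle
  property of \<open>Bplus\<close> shows that \<open>\<Delta> X\<close> solves \<open>V = x + t (id \<otimes> Bplus) (P V)\<close>, which has a single solution as
  its right-hand side raises degrees. The proposed series solves it too: by the addition formula
  \<open>P (x + (1 - \<beta> x) (y \<circ> G)) = P x * (P y \<circ> G)\<close>, where \<open>P x\<close> passes through \<open>id \<otimes> Bplus\<close>, and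
  \<open>P = (1 - \<beta> h) P'\<close> turns \<open>t P x\<close> into \<open>(1 - \<beta> x) G\<close>.
\<close>

theorem comult_DS_solution:
  fixes \<beta> :: "'k::field_char_0"
  defines "X \<equiv> DS_solution 1 \<beta>" and "P \<equiv> P_series 1 \<beta>"
  shows "fps_map ck_comult X = fps_map ck_left X + (1 - fps_const (ck2_scalar \<beta>) * fps_map ck_left X) *
    fps_compose (fps_map ck_right X)
      (fps_X * ((fps_map ck2_scalar (fps_deriv P)) oo (fps_map ck_left X)))"
proof -
  define x where "x = fps_map ck_left X"
  define y where "y = fps_map ck_right X"
  define P2 where "P2 = fps_map ck2_scalar P"
  define R2 where "R2 = fps_map ck2_scalar (fps_deriv P)"
  define b where "b = fps_const (ck2_scalar \<beta>)"
  define G where "G = fps_X * (R2 oo x)"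
  define g where "g = fps_X * ((fps_map ck_scalar (fps_deriv P)) oo X)"
  define S where "S = ((fps_map ck_scalar P) oo X)"
  let ?F = "\<lambda>V. x + fps_X * fps_map id_Bplus (P2 oo V)"
  have X0: "fps_nth X 0 = 0" by (simp add: X_def DS_solution_0)
  then have x0: "fps_nth x 0 = 0" and y0: "fps_nth y 0 = 0" by (simp_all add: x_def y_def ck_tens_zero)
  have G0: "fps_nth G 0 = 0" and g0: "fps_nth g 0 = 0" by (simp_all add: G_def g_def)
  have X_eq: "X = fps_X * fps_map Bplus S"
    unfolding S_def X_def P_def
    by (subst DS_solution_fixpoint) (simp only: completed_Bplus_eq scalar_fps_eq)
  have ode: "(1 - fps_const \<beta> * fps_X) * fps_deriv P = fps_const 1 * P"
    using P_series_ode[of 1 \<beta>] by (simp add: P_def)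
  have push: "fps_map ck_left (fps_map ck_scalar Q) = fps_map ck2_scalar Q"
    "fps_map ck_right (fps_map ck_scalar Q) = fps_map ck2_scalar Q"
    "fps_map ck_comult (fps_map ck_scalar Q) = fps_map ck2_scalar Q" for Q :: "'k fps"
    by (simp_all add: fps_map_map ck_left_scalar ck_right_scalar ck_comult_scalar)
  have unique: "V = W" if "V = ?F V" "W = ?F W" for V W
  proof (rule fps_ext)
    fix n show "fps_nth V n = fps_nth W n"
    proof (induction n rule: less_induct)
      case (less n)
      have "fps_nth (?F V) n = fps_nth (?F W) n"
      proof (cases n)
        case (Suc m)
        have "fps_nth (P2 oo V) m = fps_nth (P2 oo W) m"
          by (rule fps_compose_nth_cong) (simp add: less.IH Suc)
        then show ?thesis by (simp add: Suc)
      qed simp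
      then show ?case by (subst that(1), subst that(2))
    qed
  qed
  have "fps_map ck_comult X = ?F (fps_map ck_comult X)"
  proof -
    have "fps_map ck_comult X = fps_X * fps_map (\<lambda>z. ck_comult (Bplus z)) S"
      by (subst X_eq) (simp add: ck_comult.fps_map_mult ck_comult.fps_map_X fps_map_map)
    also have "fps_map (\<lambda>z. ck_comult (Bplus z)) S
        = fps_map ck_left (fps_map Bplus S) + fps_map id_Bplus (fps_map ck_comult S)"
      by (rule fps_ext) (simp add: ck_comult_Bplus)
    also have "fps_X * \<dots> = fps_map ck_left (fps_X * fps_map Bplus S) + fps_X * fps_map id_Bplus (fps_map ck_comult S)"
      by (simp add: ck_left.fps_map_mult ck_left.fps_map_X distrib_left)
    also have "fps_map ck_comult S = (P2 oo (fps_map ck_comult X))"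
      by (simp add: S_def ck_comult.fps_map_compose push P2_def)
    also have "fps_map ck_left (fps_X * fps_map Bplus S) = x" by (simp add: x_def flip: X_eq)
    finally show ?thesis .
  qed
  moreover have "x + (1 - b * x) * (y oo G) = ?F (x + (1 - b * x) * (y oo G))"
  proof -
    have yG0: "fps_nth (y oo G) 0 = 0" by (simp add: y0)
    have PS: "(P2 oo x) = fps_map ck_left S"
      by (simp add: S_def ck_left.fps_map_compose push P2_def x_def)
    have Gg: "G = fps_map ck_left g"
      by (simp add: G_def g_def ck_left.fps_map_mult ck_left.fps_map_X ck_left.fps_map_compose push R2_def x_def)
    have "(P2 oo (x + (1 - b * x) * (y oo G))) = (P2 oo x) * (P2 oo (y oo G))"
      unfolding P2_def b_def
      by (rule ck2_scalar.binomial_addition_formula[OF ode _ x0 yG0]) (simp add: P_def P_series_0)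
    also have "(P2 oo (y oo G)) = ((fps_map ck_right S) oo G)"
      unfolding fps_compose_assoc_comm_ring[OF y0 G0]
      by (simp add: S_def ck_right.fps_map_compose push P2_def y_def)
    finally have 1: "fps_map id_Bplus (P2 oo (x + (1 - b * x) * (y oo G)))
        = (P2 oo x) * ((fps_map ck_right (fps_map Bplus S)) oo G)"
      by (simp only: id_Bplus_compose[OF g0] PS Gg)
    have P2x: "(P2 oo x) = (1 - b * x) * (R2 oo x)"
    proof -
      have "(1 - b * fps_X) * R2 = P2"
        using arg_cong[OF ode, of "fps_map ck2_scalar"]
        by (simp add: ck2_scalar.fps_map_mult ck2_scalar.fps_map_diff ck2_scalar.fps_map_one
            ck2_scalar.fps_map_const ck2_scalar.fps_map_X P2_def R2_def b_def ck2_scalar.h_one)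
      from arg_cong[OF this, of "\<lambda>F. (F oo x)"] show ?thesis
        by (simp add: fps_compose_mult[OF x0] fps_compose_sub_distrib x0 b_def)
    qed
    have "(y oo G) = G * ((fps_map ck_right (fps_map Bplus S)) oo G)"
      unfolding y_def
      by (subst X_eq) (simp add: ck_right.fps_map_mult ck_right.fps_map_X fps_compose_mult[OF G0] G0)
    then show ?thesis unfolding 1 P2x by (simp add: G_def ac_simps)
  qed
  ultimately have "fps_map ck_comult X = x + (1 - b * x) * (y oo G)" by (rule unique)
  then show ?thesis by (simp add: x_def y_def b_def G_def R2_def)
qed

text \<open>
  The left tensor factor that accompanies \<open>a_elt 1 \<beta> j\<close> in the coproduct of \<open>a_elt 1 \<beta> n\<close>.
\<close>

definition DS_cofactor :: "'k::field_char_0 \<Rightarrow> nat \<Rightarrow> nat \<Rightarrow> 'k ck" where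
  "DS_cofactor \<beta> n j = fps_nth ((1 - fps_const (ck_scalar \<beta>) * DS_solution 1 \<beta>) *
     (fps_X * ((fps_map ck_scalar (fps_deriv (P_series 1 \<beta>))) oo (DS_solution 1 \<beta>))) ^ j) n"

corollary comult_a_elt:
  "ck_comult (a_elt 1 \<beta> n) = ck_tens (a_elt 1 \<beta> n) 1 + (\<Sum>j\<le>n. ck_tens (DS_cofactor \<beta> n j) (a_elt 1 \<beta> j))"
proof -
  let ?X = "DS_solution 1 \<beta>"
  let ?g = "fps_X * ((fps_map ck_scalar (fps_deriv (P_series 1 \<beta>))) oo ?X)"
  let ?a = "1 - fps_const (ck_scalar \<beta>) * ?X"
  have g: "fps_map ck_left ?g
      = fps_X * ((fps_map ck2_scalar (fps_deriv (P_series 1 \<beta>))) oo (fps_map ck_left ?X))"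
    by (simp add: ck_left.fps_map_mult ck_left.fps_map_X ck_left.fps_map_compose fps_map_map ck_left_scalar)
  have a: "fps_map ck_left ?a = 1 - fps_const (ck2_scalar \<beta>) * fps_map ck_left ?X"
    by (simp add: ck_left.fps_map_mult ck_left.fps_map_diff ck_left.fps_map_one ck_left.fps_map_const ck_left_scalar)
  have g0: "fps_nth (fps_map ck_left ?g) 0 = 0" by (simp add: ck_tens_zero)
  have "ck_comult (a_elt 1 \<beta> n) = ck_tens (a_elt 1 \<beta> n) 1 +
      fps_nth (fps_map ck_left ?a * ((fps_map ck_right ?X) oo (fps_map ck_left ?g))) n"
    using arg_cong[OF comult_DS_solution[of \<beta>], of "\<lambda>F. fps_nth F n"] unfolding g a by (simp add: a_elt_def)
  then show ?thesis
    unfolding fps_mult_compose_nth_eq_sum[OF g0]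
    by (simp add: DS_cofactor_def a_elt_def ck_tens_mult flip: ck_left.fps_map_power ck_left.fps_map_mult)
qed


section \<open>Ladders and the algebraic independence of the generators\<close>

primrec ladder :: "nat \<Rightarrow> rtree" where
  "ladder 0 = Node {#}"
| "ladder (Suc n) = Node {#ladder n#}"

lemma ladder_eq_iff [simp]: "ladder m = ladder n \<longleftrightarrow> m = n"
proof (induction m arbitrary: n)
  case 0
  show ?case by (cases n) simp_all
next
  case (Suc m)
  then show ?case by (cases n) simp_all
qed

lemma inj_ladder: "inj ladder"
  by (rule injI) simp

text \<open>
  Killing all trees other than ladders loses no information on \<open>A_hopf 1 \<beta>\<close>, because its generator of degree \<open>n + 1\<close> contains a single
  ladder, with coefficient \<open>1\<close>.
\<close>

definition ladder_value :: "(nat \<Rightarrow> 'r::zero) \<Rightarrow> rtree \<Rightarrow> 'r" where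
  "ladder_value c t = (if t \<in> range ladder then c (inv ladder t) else 0)"

lemma ladder_value_ladder [simp]: "ladder_value c (ladder n) = c n"
  by (simp add: ladder_value_def inv_f_f[OF inj_ladder])

lemma prod_mset_eq_0: "x \<in># M \<Longrightarrow> f x = 0 \<Longrightarrow> (\<Prod>x\<in>#M. f x) = (0::'r::comm_ring_1)"
  by (metis image_mset_add_mset mult_zero_left multi_member_split prod_mset.add_mset)

lemma forest_cases:
  obtains (ladders) M where "F = image_mset ladder M" | (other) t where "t \<in># F" "t \<notin> range ladder"
proof (cases "set_mset F \<subseteq> range ladder")
  case True
  have "image_mset ladder (image_mset (inv ladder) F) = image_mset (\<lambda>t. t) F"
    unfolding multiset.map_comp
    by (rule image_mset_cong) (use True in \<open>auto simp: f_inv_into_f\<close>)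
  then show ?thesis using that(1)[of "image_mset (inv ladder) F"] by simp
qed (use that in blast)

text \<open>
  The morphism out of the free commutative algebra on trees with prescribed values \<open>\<tau>\<close> on trees.
\<close>

definition ck_eval :: "('k::zero \<Rightarrow> 'r::comm_ring_1) \<Rightarrow> (rtree \<Rightarrow> 'r) \<Rightarrow> 'k ck \<Rightarrow> 'r" where
  "ck_eval \<iota> \<tau> x = (\<Sum>F\<in>keys x. \<iota> (lookup x F) * (\<Prod>t\<in>#F. \<tau> t))"

context scalars
begin

lemma ck_eval_superset:
  assumes "finite S" "keys x \<subseteq> S"
  shows "ck_eval \<iota> \<tau> x = (\<Sum>F\<in>S. \<iota> (lookup x F) * (\<Prod>t\<in>#F. \<tau> t))"
  unfolding ck_eval_def
  by (rule sum.mono_neutral_left) (use assms in \<open>auto simp: in_keys_iff h_zero\<close>)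

lemma ck_eval_single: "ck_eval \<iota> \<tau> (single F c) = \<iota> c * (\<Prod>t\<in>#F. \<tau> t)"
  by (subst ck_eval_superset[of "{F}"]) auto

lemma ck_eval_zero: "ck_eval \<iota> \<tau> 0 = 0"
  by (simp add: ck_eval_def)

lemma ck_eval_add: "ck_eval \<iota> \<tau> (x + y) = ck_eval \<iota> \<tau> x + ck_eval \<iota> \<tau> y"
proof -
  let ?S = "keys x \<union> keys y"
  have "finite ?S" "keys (x + y) \<subseteq> ?S" using keys_add[of x y] by auto
  then show ?thesis
    by (simp add: ck_eval_superset[of ?S] lookup_add h_add distrib_right sum.distrib)
qed

lemma ck_eval_mult: "ck_eval \<iota> \<tau> (x * y) = ck_eval \<iota> \<tau> x * ck_eval \<iota> \<tau> y"
proof (induction x rule: poly_mapping_single_induct)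
  case (2 F c)
  show ?case
  proof (induction y rule: poly_mapping_single_induct)
    case (2 G d)
    show ?case by (simp add: mult_single ck_eval_single h_mult)
  qed (simp_all add: ck_eval_zero ck_eval_add distrib_left)
qed (simp_all add: ck_eval_zero ck_eval_add distrib_right)

lemma ck_eval_scalar: "ck_eval \<iota> \<tau> (ck_scalar c) = \<iota> c"
  by (simp add: ck_eval_single)

lemma ck_eval_morphism: "ring_morphism (ck_eval \<iota> \<tau>)"
  using ck_eval_scalar[of \<tau> 1] by unfold_locales (simp_all add: ck_eval_add ck_eval_mult h_one)

lemma ring_morphism_ck_eval:
  assumes "ring_morphism g"
  shows "g (ck_eval \<iota> \<tau> x) = ck_eval (\<lambda>c. g (\<iota> c)) (\<lambda>t. g (\<tau> t)) x"
proof -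
  interpret g: ring_morphism g by (rule assms)
  show ?thesis by (simp add: ck_eval_def g.h_sum g.h_mult g.h_prod_mset image_mset.compositionality comp_def)
qed

end

lemma lookup_mult_empty:
  "lookup (x * y) {#} = lookup x {#} * lookup y {#}"
  for x y :: "'k::field_char_0 ck"
  using hopf_model.counit_mult[OF H_CK_model[of UNIV]] by (simp add: H_CK_def)

interpretation ck_counit: ring_morphism "\<lambda>x :: 'k::field_char_0 ck. lookup x {#}"
  by unfold_locales (simp_all add: lookup_add lookup_mult_empty)

text \<open>
  Taking the coefficient of a single tree is a derivation relative to the counit.
\<close>

lemma lookup_mult_tree:
  "lookup (x * y) {#t#} = lookup x {#} * lookup y {#t#}
    + lookup x {#t#} * lookup y {#}"
  for x y :: "'k::field_char_0 ck"
proof (induction x rule: poly_mapping_single_induct)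
  case (2 F c)
  show ?case
  proof (induction y rule: poly_mapping_single_induct)
    case (2 G d)
    show ?case by (auto simp: mult_single lookup_single when_def union_is_single)
  qed (simp_all add: lookup_add algebra_simps)
qed (simp_all add: lookup_add algebra_simps)

lemma lookup_Bplus_Node: "lookup (Bplus x) {#Node F#} = lookup x F"
  for x :: "'k::field_char_0 ck"
  by (induction x rule: poly_mapping_single_induct)
    (simp_all add: Bplus_zero Bplus_single Bplus_add lookup_add lookup_single when_def)

lemma lookup_Bplus_not_tree: "size F \<noteq> 1 \<Longrightarrow> lookup (Bplus x) F = 0"
  for x :: "'k::field_char_0 ck"
  by (induction x rule: poly_mapping_single_induct)
    (auto simp: Bplus_zero Bplus_single Bplus_add lookup_add lookup_single when_def)

lemma a_elt_0: "a_elt \<alpha> \<beta> 0 = 0"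
  by (simp add: a_elt_def DS_solution_0)

lemma a_elt_Suc: "a_elt \<alpha> \<beta> (Suc n)
    = Bplus (fps_nth ((fps_map ck_scalar (P_series \<alpha> \<beta>)) oo (DS_solution \<alpha> \<beta>)) n)"
  unfolding a_elt_def
  by (subst DS_solution_fixpoint) (simp add: completed_Bplus_eq scalar_fps_eq)

lemma lookup_a_elt_not_tree: "size F \<noteq> 1 \<Longrightarrow> lookup (a_elt \<alpha> \<beta> n) F = 0"
  for \<alpha> :: "'k::field_char_0"
  by (cases n) (simp_all add: a_elt_0 a_elt_Suc lookup_Bplus_not_tree)

lemma P_series_1: "fps_nth (P_series \<alpha> \<beta>) (Suc 0) = \<alpha>" for \<alpha> :: "'k::field_char_0"
  using P_series_rec[of 0 \<alpha> \<beta>] by (simp add: P_series_0)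

text \<open>
  The coefficient of \<open>Bplus S\<close> at a ladder is the coefficient of \<open>S\<close> at the next shorter ladder, where
  \<open>S = P X\<close>. There only the linear term \<open>P\<^sub>1 X = X\<close> contributes, since the coefficient at a tree is a derivation
  and \<open>X\<close> has counit zero. So the coefficients propagate from degree to degree.
\<close>

lemma lookup_a_elt_ladder:
  "lookup (a_elt 1 \<beta> (Suc n)) {#ladder m#} = (if m = n then 1 else (0 :: 'k::field_char_0))"
proof (induction n arbitrary: m)
  define X where "X = DS_solution 1 \<beta>"
  define S where "S = ((fps_map ck_scalar (P_series 1 \<beta>)) oo X)"
  have a: "a_elt 1 \<beta> (Suc n) = Bplus (fps_nth S n)" for n
    unfolding S_def X_def by (rule a_elt_Suc)
  have X0: "lookup (fps_nth X n) {#} = 0" for n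
    using lookup_a_elt_not_tree[of "{#}" 1 \<beta> n] by (simp add: a_elt_def X_def)
  have pow0: "lookup (fps_nth (X ^ i) n) {#} = (if i = 0 \<and> n = 0 then 1 else 0)" for i n
  proof -
    have "fps_map (\<lambda>x. lookup x {#}) X = 0" by (rule fps_ext) (simp add: X0)
    then have "fps_map (\<lambda>x. lookup x {#}) (X ^ i) = 0 ^ i"
      by (simp add: ck_counit.fps_map_power)
    from arg_cong[OF this, of "\<lambda>F. fps_nth F n"] show ?thesis by (cases i) auto
  qed
  have S0: "lookup (fps_nth S n) {#} = (if n = 0 then 1 else 0)" for n
  proof -
    have "lookup (fps_nth S n) {#}
        = (\<Sum>i=0..n. if i = 0 then (if n = 0 then 1 else 0) else 0)"
      unfolding S_def fps_compose_nth ck_counit.h_sum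
      by (rule sum.cong) (auto simp: ck_counit.h_mult pow0 P_series_0)
    then show ?thesis by simp
  qed
  have pow1: "lookup (fps_nth (X ^ i) n) {#t#}
      = (if i = 1 then lookup (fps_nth X n) {#t#} else 0)" for i n t
  proof (cases i)
    case 0
    then show ?thesis by (simp add: lookup_one)
  next
    case (Suc j)
    have "lookup (fps_nth (X ^ i) n) {#t#}
        = (\<Sum>l=0..n. if l = n then (if j = 0 then lookup (fps_nth X n) {#t#} else 0) else 0)"
      unfolding Suc power_Suc fps_mult_nth lookup_sum_pm[OF finite_atLeastAtMost]
      by (rule sum.cong) (auto simp: lookup_mult_tree X0 pow0)
    then show ?thesis by (simp add: Suc)
  qed
  have S1: "lookup (fps_nth S n) {#t#} = lookup (fps_nth X n) {#t#}" for n t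
  proof -
    have "lookup (fps_nth S n) {#t#}
        = (\<Sum>i=0..n. if i = 1 then lookup (fps_nth X n) {#t#} else 0)"
      unfolding S_def fps_compose_nth lookup_sum_pm[OF finite_atLeastAtMost]
      by (rule sum.cong) (auto simp: lookup_mult_tree pow1 pow0 P_series_1 lookup_single when_def)
    then show ?thesis by (cases n) (auto simp: X_def DS_solution_0)
  qed
  {
    case 0
    show ?case by (cases m) (simp_all add: a lookup_Bplus_Node S0 S1 X_def DS_solution_0)
  next
    case (Suc n)
    have "lookup (fps_nth X (Suc n)) {#ladder k#} = (if k = n then 1 else 0)" for k
      using Suc.IH[of k] by (simp add: a_elt_def X_def)
    then show ?case by (cases m) (simp_all add: a lookup_Bplus_Node S0 S1)
  }
qed

lemma (in scalars) ck_eval_a_elt: "ck_eval \<iota> (ladder_value c) (a_elt 1 \<beta> (Suc n)) = c n"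
proof -
  let ?x = "a_elt 1 \<beta> (Suc n)"
  let ?S = "insert {#ladder n#} (keys ?x)"
  have "ck_eval \<iota> (ladder_value c) ?x = (\<Sum>F\<in>?S. if F = {#ladder n#} then c n else 0)"
  proof (subst ck_eval_superset[of ?S], simp, blast, rule sum.cong[OF refl])
    fix F assume "F \<in> ?S"
    show "\<iota> (lookup ?x F) * (\<Prod>t\<in>#F. ladder_value c t) = (if F = {#ladder n#} then c n else 0)"
    proof (cases "size F = 1")
      case True
      then obtain t where F: "F = {#t#}" by (metis One_nat_def size_1_singleton_mset)
      show ?thesis
      proof (cases "t \<in> range ladder")
        case True
        then obtain m where "t = ladder m" by blast
        then show ?thesis by (simp add: F lookup_a_elt_ladder h_one h_zero)
      next
        case False
        then show ?thesis by (auto simp: F ladder_value_def)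
      qed
    next
      case False
      then show ?thesis by (auto simp: lookup_a_elt_not_tree h_zero)
    qed
  qed
  then show ?thesis by simp
qed

abbreviation A_carrier :: "'k::field_char_0 \<Rightarrow> 'k ck set" where
  "A_carrier \<beta> \<equiv> gen_subalg H_CK {a_elt 1 \<beta> n | n. n \<ge> 1}"

lemma carr_A_hopf: "carr (A_hopf 1 \<beta>) = A_carrier \<beta>"
  by (simp add: A_hopf_def)

lemma A_hopf_model: "hopf_model (A_hopf \<alpha> \<beta>) lookup lookup (*)"
  unfolding A_hopf_def by (rule H_CK_model)

lemma A_hopf_simps [simp]: "unit (A_hopf \<alpha> \<beta>) = 1" "mult (A_hopf \<alpha> \<beta>) = (*)"
  "scal (A_hopf \<alpha> \<beta>) c x = ck_scalar c * x" "tens (A_hopf \<alpha> \<beta>) = ck_tens"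
  "counit (A_hopf \<alpha> \<beta>) x = lookup x {#}" "comult (A_hopf \<alpha> \<beta>) = ck_comult"
  by (simp_all add: A_hopf_def H_CK_def scal_eq_scalar_mult)

lemma gen_subalg_A_hopf: "gen_subalg (A_hopf \<alpha> \<beta>) S = gen_subalg H_CK S"
  by (simp add: A_hopf_def)

lemma a_elt_in_A: "a_elt 1 \<beta> n \<in> A_carrier \<beta>"
proof (cases n)
  case 0
  then show ?thesis using subalgebra.zero_in[OF H_CK_subalgebra] by (simp add: a_elt_0)
next
  case (Suc m)
  then show ?thesis by (intro gen_subalg.gen) auto
qed

lemma DS_cofactor_in_A: "DS_cofactor \<beta> n j \<in> A_carrier \<beta>"
proof -
  interpret subalgebra ck_scalar "A_carrier \<beta>" by (rule H_CK_subalgebra)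
  have X: "fps_nth (DS_solution 1 \<beta>) n \<in> A_carrier \<beta>" for n
    using a_elt_in_A by (simp add: a_elt_def)
  show ?thesis unfolding DS_cofactor_def
    by (intro fps_mult_in fps_power_in fps_compose_in fps_diff_in fps_one_in fps_X_in fps_const_in scalar_in X)
qed

text \<open>
  Sending the ladder with \<open>n + 1\<close> vertices to the generator of degree \<open>n + 1\<close>, and every other tree to
  zero, fixes the generators and hence all of \<open>A_hopf 1 \<beta>\<close>. Consequently an element of the subalgebra is
  determined by its coefficients at forests of ladders, which is the algebraic independence of the
  generators.
\<close>

lemma A_retraction:
  assumes "x \<in> A_carrier \<beta>"
  shows "ck_eval ck_scalar (ladder_value (\<lambda>n. a_elt 1 \<beta> (Suc n))) x = x"
  using assms
proof induction
  case (gen x)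
  then obtain n where "x = a_elt 1 \<beta> n" "n \<ge> 1" by blast
  then show ?case by (cases n) (simp_all add: ck_scalar.ck_eval_a_elt)
next
  case unit
  show ?case using ck_scalar.ck_eval_scalar[of _ 1] by (simp add: H_CK_def)
next
  case (scal x c)
  then show ?case
    by (simp add: H_CK_def scal_eq_scalar_mult ck_scalar.ck_eval_mult ck_scalar.ck_eval_scalar)
qed (simp_all add: H_CK_def ck_scalar.ck_eval_add ck_scalar.ck_eval_mult)

lemma A_eq_0I:
  assumes x: "x \<in> A_carrier \<beta>" and zero: "\<And>M. lookup x (image_mset ladder M) = 0"
  shows "x = 0"
proof -
  have "ck_scalar (lookup x F) * (\<Prod>t\<in>#F. ladder_value (\<lambda>n. a_elt 1 \<beta> (Suc n)) t) = 0" for F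
  proof (cases F rule: forest_cases)
    case (ladders M)
    then show ?thesis by (simp add: zero)
  next
    case (other t)
    then have "(\<Prod>t\<in>#F. ladder_value (\<lambda>n. a_elt 1 \<beta> (Suc n)) t) = 0"
      by (intro prod_mset_eq_0) (auto simp: ladder_value_def)
    then show ?thesis by simp
  qed
  then have "ck_eval ck_scalar (ladder_value (\<lambda>n. a_elt 1 \<beta> (Suc n))) x = 0" by (simp add: ck_eval_def)
  then show ?thesis using A_retraction[OF x] by simp
qed

lemma (in scalars) ck_eval_ladders:
  "ck_eval \<iota> (ladder_value c) x = (\<Sum>M | image_mset ladder M \<in> keys x.
     \<iota> (lookup x (image_mset ladder M)) * (\<Prod>n\<in>#M. c n))"
proof -
  let ?f = "\<lambda>F. \<iota> (lookup x F) * (\<Prod>t\<in>#F. ladder_value c t)"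
  let ?S = "{M. image_mset ladder M \<in> keys x}"
  have inj: "inj_on (image_mset ladder) ?S"
    using multiset.inj_map[OF inj_ladder] by (rule inj_on_subset) simp
  have "ck_eval \<iota> (ladder_value c) x = sum ?f (image_mset ladder ` ?S)"
    unfolding ck_eval_def
  proof (rule sum.mono_neutral_right)
    show "\<forall>F\<in>keys x - image_mset ladder ` ?S. ?f F = 0"
    proof
      fix F assume F: "F \<in> keys x - image_mset ladder ` ?S"
      show "?f F = 0"
      proof (cases F rule: forest_cases)
        case (ladders M)
        then show ?thesis using F by blast
      next
        case (other t)
        then have "(\<Prod>t\<in>#F. ladder_value c t) = 0"
          by (intro prod_mset_eq_0) (auto simp: ladder_value_def)
        then show ?thesis by simp
      qed
    qed
  qed auto
  also have "\<dots> = (\<Sum>M\<in>?S. ?f (image_mset ladder M))" by (simp add: sum.reindex[OF inj])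
  finally show ?thesis by (simp add: multiset.map_comp comp_def)
qed

lemma finite_ladder_keys: "finite {M. image_mset ladder M \<in> keys x}"
  by (rule finite_subset[OF _ finite_imageI[of "keys x" "image_mset (inv ladder)"]])
    (auto simp: image_iff multiset.map_comp inj_ladder intro!: bexI[of _ "image_mset ladder _"])

text \<open>
  Dedekind's lemma on the linear independence of characters of a monoid: subtracting \<open>\<chi> j y\<close> times the
  relation at \<open>x\<close> from the relation at \<open>x * y\<close> removes the character \<open>\<chi> j\<close>.
\<close>

lemma dedekind_independence:
  fixes \<chi> :: "'i \<Rightarrow> 'm::monoid_mult \<Rightarrow> 'k::field"
  assumes "finite S" and one: "\<And>i. \<chi> i 1 = 1" and mult: "\<And>i x y. \<chi> i (x * y) = \<chi> i x * \<chi> i y"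
    and inj: "inj_on \<chi> S" and zero: "\<And>x. (\<Sum>i\<in>S. a i * \<chi> i x) = 0"
  shows "\<forall>i\<in>S. a i = 0"
  using \<open>finite S\<close> inj zero
proof (induction S arbitrary: a rule: finite_induct)
  case (insert j S)
  have "(\<Sum>i\<in>S. (a i * (\<chi> i y - \<chi> j y)) * \<chi> i x) = 0" for x y
  proof -
    have "(\<Sum>i\<in>insert j S. a i * \<chi> i (x * y)) - (\<Sum>i\<in>insert j S. a i * \<chi> i x) * \<chi> j y = 0"
      by (simp only: insert.prems(2)) simp
    then show ?thesis using insert.hyps
      by (simp add: mult sum_distrib_left sum_distrib_right sum_subtractf algebra_simps)
  qed
  moreover have "inj_on \<chi> S" using insert.prems(1) by (simp add: inj_on_insert)
  ultimately have "\<forall>i\<in>S. a i * (\<chi> i y - \<chi> j y) = 0" for y by (intro insert.IH) auto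
  moreover have "\<exists>y. \<chi> i y \<noteq> \<chi> j y" if "i \<in> S" for i
  proof -
    have "\<chi> i \<noteq> \<chi> j" using that insert.prems(1) insert.hyps by (auto simp: inj_on_def)
    then show ?thesis by (simp add: fun_eq_iff)
  qed
  ultimately have S: "\<forall>i\<in>S. a i = 0" by (metis eq_iff_diff_eq_0 mult_eq_0_iff)
  then have "a j = 0" using insert.prems(2)[of 1] insert.hyps by (simp add: one)
  then show ?case using S by simp
qed simp

text \<open>
  The monomials in the variables \<open>c n\<close> are distinct characters of the multiplicative monoid of
  all assignments \<open>c\<close>: setting one variable to \<open>2\<close> and the others to \<open>1\<close> reads off an exponent.
\<close>

lemma multiset_characters_inj: "inj (\<lambda>M (c :: 'a \<Rightarrow> 'k::field_char_0). \<Prod>n\<in>#M. c n)"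
proof (rule injI, rule multiset_eqI)
  fix M N :: "'a multiset" and n
  assume eq: "(\<lambda>c :: 'a \<Rightarrow> 'k. \<Prod>n\<in>#M. c n) = (\<lambda>c. \<Prod>n\<in>#N. c n)"
  have "(\<Prod>m\<in>#M. if m = n then 2 else 1 :: 'k) = of_nat (2 ^ count M n)" for M :: "'a multiset"
    by (induction M) auto
  with fun_cong[OF eq, of "\<lambda>m. if m = n then 2 else 1"]
  have "(of_nat (2 ^ count M n) :: 'k) = of_nat (2 ^ count N n)" by simp
  then show "count M n = count N n" by (simp only: of_nat_eq_iff) simp
qed

text \<open>
  A polynomial that vanishes at all points is zero, here by Dedekind's lemma for its monomials.
\<close>

lemma ladder_coefficients_zeroI:
  assumes "\<And>c :: nat \<Rightarrow> 'k::field_char_0. ck_eval (\<lambda>a. a) (ladder_value c) x = 0"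
  shows "lookup x (image_mset ladder M) = 0"
proof -
  interpret scalars "\<lambda>a :: 'k. a" by unfold_locales auto
  let ?S = "{M. image_mset ladder M \<in> keys x}"
  \<comment> \<open>The assignments \<open>c\<close> form a monoid under pointwise multiplication.\<close>
  have "\<forall>M\<in>?S. lookup x (image_mset ladder M) = 0"
  proof (rule dedekind_independence[where \<chi> = "\<lambda>M c. \<Prod>n\<in>#M. c n :: 'k"])
    show "inj_on (\<lambda>M c. \<Prod>n\<in>#M. c n :: 'k) ?S"
      using multiset_characters_inj by (rule inj_on_subset) simp
    show "(\<Sum>M\<in>?S. lookup x (image_mset ladder M) * (\<Prod>n\<in>#M. c n)) = 0" for c
      using assms[of c] by (simp add: ck_eval_ladders)
  qed (simp_all add: finite_ladder_keys prod_mset.distrib)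
  then show ?thesis by (auto simp: in_keys_iff)
qed


section \<open>The Faa di Bruno Hopf algebra\<close>

lemma fun_scalars: "scalars (\<lambda>c::'k::field_char_0. \<lambda>_::'p. c)"
  by unfold_locales (simp_all add: fun_eq_iff)

lemma scalars_id: "scalars (\<lambda>c::'k::field_char_0. c)"
  by unfold_locales simp_all

lemma eval_at_morphism: "ring_morphism (\<lambda>f :: 'p \<Rightarrow> 'k::comm_ring_1. f p)"
  by unfold_locales simp_all

lemma fps_map_id [simp]: "fps_map (\<lambda>c. c) X = X"
  by (rule fps_ext) simp

lemma fun_FdB_subalgebra:
  "subalgebra (\<lambda>c::'k::field_char_0. \<lambda>_. c) (gen_subalg fun_FdB S)"
  by (rule scalars.subalgebra_gen_subalg[OF fun_scalars]) (simp_all add: fun_FdB_def fun_eq_iff)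

lemma carr_H_FdB: "carr H_FdB = gen_subalg fun_FdB {coord i | i. i \<ge> 1}"
  by (simp add: H_FdB_def)

lemma H_FdB_simps [simp]: "unit H_FdB = 1" "mult H_FdB = (*)" "scal H_FdB c f = (\<lambda>P. c * f P)"
  "tens H_FdB f g (P, Q) = f P * g Q" "counit H_FdB f = f (Diffeo fps_X)"
  "comult H_FdB f (P, Q) = f (diffeo_comp Q P)"
  by (simp_all add: H_FdB_def fun_FdB_def)

lemma H_FdB_model: "hopf_model (H_FdB :: ('k::field_char_0, _, _) hopf) (\<lambda>f P. f P) (\<lambda>F p. F p) (*)"
proof -
  interpret C: subalgebra "\<lambda>c::'k. \<lambda>_. c" "carr H_FdB"
    unfolding carr_H_FdB by (rule fun_FdB_subalgebra)
  have scal: "(\<lambda>P. c * f P) \<in> carr H_FdB" if "f \<in> carr H_FdB" for c :: 'k and f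
    using C.mult_in[OF C.scalar_in[of c] that] by (simp add: times_fun_def)
  show ?thesis
    by unfold_locales
      (auto simp: C.one_in C.add_in C.mult_in scal fun_eq_iff distrib_left distrib_right)
qed

lemma sum_list_upt: "(\<Sum>j\<leftarrow>[0..<Suc n]. f j) = (\<Sum>j\<le>n. f j)"
  by (simp only: interv_sum_list_conv_sum_set_nat set_upt atLeast0LessThan lessThan_Suc_atMost)

text \<open>
  A character of \<open>A_hopf 1 \<beta>\<close> is given by the series \<open>f\<close> of its values on the generators. With
  \<open>R = P'\<close>, attach to it the diffeomorphism \<open>h * (R \<circ> f)\<close>. As \<open>R = 1 + (1 + \<beta>) h + \<dots>\<close>, the condition on
  \<open>\<beta>\<close> says exactly that \<open>f\<close> can be recovered from the diffeomorphism.
\<close>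

locale faa_di_bruno_parameter =
  fixes \<beta> :: "'k::field_char_0"
  assumes \<beta>: "\<beta> \<noteq> -1"
begin

definition R :: "'k fps" where
  "R = fps_deriv (P_series 1 \<beta>)"

definition R_inv :: "'k fps" where
  "R_inv = fps_inv (R - 1)"

lemma R_0: "fps_nth R 0 = 1"
  by (simp add: R_def P_series_1)

lemma R_1: "fps_nth R (Suc 0) = 1 + \<beta>"
  using P_series_rec[of 1 1 \<beta>] by (simp add: R_def P_series_1 numeral_2_eq_2)

lemma R_ode: "(1 - fps_const \<beta> * fps_X) * fps_deriv R = fps_const (1 + \<beta>) * R"
proof -
  have "fps_deriv ((1 - fps_const \<beta> * fps_X) * fps_deriv (P_series 1 \<beta>)) = fps_deriv (P_series 1 \<beta>)"
    using P_series_ode[of 1 \<beta>] by simp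
  then show ?thesis by (simp add: R_def algebra_simps flip: fps_const_add)
qed

lemma R_inv_left: "(R_inv oo (R - 1)) = fps_X"
  and R_inv_right: "((R - 1) oo R_inv) = fps_X"
  and R_inv_0: "fps_nth R_inv 0 = 0"
proof -
  have nz: "fps_nth (R - 1) 1 \<noteq> 0" using \<beta> by (simp add: R_1 add_eq_0_iff)
  have z: "fps_nth (R - 1) 0 = 0" by (simp add: R_0)
  show "(R_inv oo (R - 1)) = fps_X" unfolding R_inv_def by (rule fps_inv[OF z nz])
  show "((R - 1) oo R_inv) = fps_X" unfolding R_inv_def by (rule fps_inv_right[OF z nz])
  show "fps_nth R_inv 0 = 0" by (simp add: R_inv_def fps_inv_def)
qed

definition coord_series :: "('k diffeo \<Rightarrow> 'k) fps" where
  "coord_series = Abs_fps (\<lambda>n. if n = 0 then 0 else coord n)"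

text \<open>
  The inverse passage, as a series of coordinate functions on the group: its value \<open>chart_at P\<close> at a
  diffeomorphism \<open>P\<close> is the series \<open>f\<close> with \<open>h * (R \<circ> f) = P\<close>. Keeping \<open>chart\<close> as a series over the ring of
  functions shows that its coefficients are polynomials in the coordinates.
\<close>

definition chart :: "('k diffeo \<Rightarrow> 'k) fps" where
  "chart = ((fps_map (\<lambda>c _. c) R_inv) oo coord_series)"

definition chart_at :: "'k diffeo \<Rightarrow> 'k fps" where
  "chart_at P = fps_map (\<lambda>f. f P) chart"

lemma coord_series_at: "fps_X * (1 + fps_map (\<lambda>f. f P) coord_series) = series P"
proof (rule fps_ext)
  fix n
  show "fps_nth (fps_X * (1 + fps_map (\<lambda>f. f P) coord_series)) n = fps_nth (series P) n"
    using series[of P] by (cases n) (auto simp: coord_series_def coord_def)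
qed

lemma chart_at_eq: "chart_at P = (R_inv oo (fps_map (\<lambda>f. f P) coord_series))"
  by (simp add: chart_at_def chart_def fps_map_map ring_morphism.fps_map_compose[OF eval_at_morphism])

lemma chart_at_0: "fps_nth (chart_at P) 0 = 0"
  by (simp add: chart_at_eq R_inv_0)

lemma chart_at_iff:
  "fps_nth f 0 = 0 \<and> fps_X * (R oo f) = series P \<longleftrightarrow> f = chart_at P"
proof -
  let ?s = "fps_map (\<lambda>f. f P) coord_series"
  have s0: "fps_nth ?s 0 = 0" by (simp add: coord_series_def)
  have R: "(R oo f) = 1 + ((R - 1) oo f)" for f by (simp add: fps_compose_sub_distrib)
  have "fps_X * (R oo f) = series P \<longleftrightarrow> ((R - 1) oo f) = ?s" for f
    unfolding R coord_series_at[of P, symmetric] by simp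
  moreover have "((R - 1) oo (chart_at P)) = ?s"
    unfolding chart_at_eq fps_compose_assoc[OF s0 R_inv_0] R_inv_right
    by (rule fps_X_fps_compose_startby0[OF s0])
  moreover have "f = chart_at P" if "fps_nth f 0 = 0" "((R - 1) oo f) = ?s" for f
  proof -
    have "(R_inv oo ((R - 1) oo f)) = (fps_X oo f)"
      using fps_compose_assoc[OF that(1), of "R - 1" R_inv] by (simp add: R_0 R_inv_left)
    then show ?thesis by (simp add: that chart_at_eq)
  qed
  ultimately show ?thesis by (auto simp: chart_at_0)
qed

lemma chart_0: "fps_nth chart 0 = 0"
  by (simp add: chart_def R_inv_0 zero_fun_def)

lemma series_chart: "fps_X * (R oo (chart_at P)) = series P"
  using chart_at_iff[of "chart_at P" P] by simp

lemma chart_at_surj: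
  assumes "fps_nth f 0 = 0"
  shows "\<exists>P. chart_at P = f"
proof -
  have "fps_nth (fps_X * (R oo f)) 0 = 0 \<and> fps_nth (fps_X * (R oo f)) 1 = 1"
    by (simp add: R_0)
  then have "series (Diffeo (fps_X * (R oo f))) = fps_X * (R oo f)"
    by (intro Diffeo_inverse) simp
  then show ?thesis using chart_at_iff[of f] assms by metis
qed

lemma chart_at_identity: "chart_at (Diffeo fps_X) = 0"
proof -
  have "series (Diffeo fps_X) = (fps_X :: 'k fps)" by (intro Diffeo_inverse) simp
  then show ?thesis using chart_at_iff[of 0 "Diffeo fps_X"] by (simp add: R_0)
qed

text \<open>
  Since \<open>R\<close> satisfies the addition formula with \<open>c = 1 + \<beta>\<close>, composition of diffeomorphisms becomes, in
  the chart, the law of the coproduct of \<open>X\<close>: with \<open>f = chart_at P\<close> and \<open>g = chart_at Q\<close>,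
  \<open>h R (f + (1 - \<beta> f) (g \<circ> P)) = h R f * (R g \<circ> P) = P * (R g \<circ> P) = (h R g) \<circ> P = Q \<circ> P\<close>.
\<close>

lemma chart_at_comp:
  "chart_at (diffeo_comp Q P)
    = chart_at P + (1 - fps_const \<beta> * chart_at P) * ((chart_at Q) oo (series P))"
proof -
  interpret scalars "\<lambda>c::'k. c" by (rule scalars_id)
  let ?F = "chart_at P + (1 - fps_const \<beta> * chart_at P) * ((chart_at Q) oo (series P))"
  have P0: "fps_nth (series P) 0 = 0" using series[of P] by simp
  have c0: "fps_nth ((chart_at Q) oo (series P)) 0 = 0" by (simp add: chart_at_0)
  have "(R oo ?F) = (R oo (chart_at P)) * (R oo ((chart_at Q) oo (series P)))"
    using binomial_addition_formula[OF R_ode R_0 chart_at_0 c0] by simp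
  then have "fps_X * (R oo ?F)
      = (fps_X * (R oo (chart_at P))) * (R oo ((chart_at Q) oo (series P)))"
    by (simp only: mult.assoc)
  also have "\<dots> = series P * ((R oo (chart_at Q)) oo (series P))"
    by (simp only: series_chart fps_compose_assoc[OF P0 chart_at_0])
  also have "\<dots> = ((fps_X * (R oo (chart_at Q))) oo (series P))"
    by (simp add: fps_compose_mult_distrib[OF P0] P0)
  also have "\<dots> = series (diffeo_comp Q P)" by (simp add: series_chart series_diffeo_comp)
  finally have *: "fps_X * (R oo ?F) = series (diffeo_comp Q P)" .
  have "?F = chart_at (diffeo_comp Q P)"
    by (rule chart_at_iff[THEN iffD1, OF conjI[OF _ *]]) (simp add: chart_at_0)
  then show ?thesis ..
qed

definition to_FdB :: "'k ck \<Rightarrow> 'k diffeo \<Rightarrow> 'k" where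
  "to_FdB = ck_eval (\<lambda>c _. c) (ladder_value (\<lambda>n. fps_nth chart (Suc n)))"

lemma to_FdB_morphism: "ring_morphism to_FdB"
  unfolding to_FdB_def by (rule scalars.ck_eval_morphism[OF fun_scalars])

lemma to_FdB_scalar: "to_FdB (ck_scalar c) = (\<lambda>_. c)"
  unfolding to_FdB_def by (rule scalars.ck_eval_scalar[OF fun_scalars])

lemma to_FdB_a_elt: "to_FdB (a_elt 1 \<beta> n) = fps_nth chart n"
proof (cases n)
  case 0
  then show ?thesis
    using ring_morphism.h_zero[OF to_FdB_morphism] by (simp add: a_elt_0 chart_0)
next
  case (Suc m)
  then show ?thesis by (simp add: to_FdB_def scalars.ck_eval_a_elt[OF fun_scalars])
qed

lemma to_FdB_at: "to_FdB x P = ck_eval (\<lambda>c. c) (ladder_value (\<lambda>n. fps_nth (chart_at P) (Suc n))) x"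
proof -
  have "(\<lambda>t. ladder_value (\<lambda>n. fps_nth chart (Suc n)) t P) = ladder_value (\<lambda>n. fps_nth (chart_at P) (Suc n))"
    by (auto simp: fun_eq_iff ladder_value_def chart_at_def)
  then show ?thesis
    unfolding to_FdB_def scalars.ring_morphism_ck_eval[OF fun_scalars eval_at_morphism] by simp
qed

lemma to_FdB_at_morphism: "ring_morphism (\<lambda>x. to_FdB x P)"
  unfolding to_FdB_at by (rule scalars.ck_eval_morphism[OF scalars_id])

text \<open>
  Every series without constant term occurs as a chart value, so an element of the kernel vanishes
  under all assignments of values to the ladders.
\<close>

lemma to_FdB_inj: "inj_on to_FdB (A_carrier \<beta>)"
proof (rule inj_onI)
  fix x y assume xy: "x \<in> A_carrier \<beta>" "y \<in> A_carrier \<beta>" "to_FdB x = to_FdB y"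
  interpret subalgebra ck_scalar "A_carrier \<beta>" by (rule H_CK_subalgebra)
  have zero: "to_FdB (x - y) = 0" using ring_morphism.h_diff[OF to_FdB_morphism] xy(3) by simp
  have "ck_eval (\<lambda>a. a) (ladder_value c) (x - y) = 0" for c
  proof -
    obtain P where "chart_at P = Abs_fps (\<lambda>n. if n = 0 then 0 else c (n - 1))"
      using chart_at_surj[of "Abs_fps (\<lambda>n. if n = 0 then 0 else c (n - 1))"] by auto
    then have "(\<lambda>n. fps_nth (chart_at P) (Suc n)) = c" by simp
    then show ?thesis using to_FdB_at[of "x - y" P] zero by simp
  qed
  then have "x - y = 0"
    by (intro A_eq_0I[OF diff_in[OF xy(1,2)]] ladder_coefficients_zeroI)
  then show "x = y" by simp
qed

text \<open>
  Conversely, the coordinates are polynomials in the coefficients of the chart; hence both families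
  generate the same algebra of functions.
\<close>

lemma coord_series_eq: "coord_series = ((fps_map (\<lambda>c _. c) (R - 1)) oo chart)"
proof -
  interpret scalars "\<lambda>c::'k. \<lambda>_::'k diffeo. c" by (rule fun_scalars)
  have s0: "fps_nth coord_series 0 = 0" and r0: "fps_nth (fps_map (\<lambda>c _::'k diffeo. c) R_inv) 0 = 0"
    by (simp_all add: coord_series_def R_inv_0 fun_eq_iff)
  show ?thesis
    unfolding chart_def fps_compose_assoc_comm_ring[OF r0 s0] fps_map_compose[symmetric] R_inv_right fps_map_X
    by (simp add: s0)
qed

lemma to_FdB_image: "to_FdB ` A_carrier \<beta> = carr H_FdB"
proof -
  let ?S = "{a_elt 1 \<beta> n | n. n \<ge> 1}" and ?T = "{coord i | i. i \<ge> 1} :: ('k diffeo \<Rightarrow> 'k) set"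
  interpret T: subalgebra "\<lambda>c::'k. \<lambda>_. c" "gen_subalg fun_FdB ?T" by (rule fun_FdB_subalgebra)
  interpret S: subalgebra "\<lambda>c::'k. \<lambda>_. c" "gen_subalg fun_FdB (to_FdB ` ?S)" by (rule fun_FdB_subalgebra)
  have "to_FdB ` gen_subalg H_CK ?S = gen_subalg fun_FdB (to_FdB ` ?S)"
  proof (rule gen_subalg_image)
    show "to_FdB (unit H_CK) = unit fun_FdB"
      using ring_morphism.h_one[OF to_FdB_morphism] by (simp add: H_CK_def fun_FdB_def)
    show "to_FdB (x + y) = to_FdB x + to_FdB y" for x y by (rule ring_morphism.h_add[OF to_FdB_morphism])
    show "to_FdB (scal H_CK c x) = scal fun_FdB c (to_FdB x)" for c x
      by (simp add: H_CK_def fun_FdB_def scal_eq_scalar_mult ring_morphism.h_mult[OF to_FdB_morphism] to_FdB_scalar fun_eq_iff)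
    show "to_FdB (mult H_CK x y) = mult fun_FdB (to_FdB x) (to_FdB y)" for x y
      by (simp add: H_CK_def fun_FdB_def ring_morphism.h_mult[OF to_FdB_morphism])
  qed
  also have "\<dots> = gen_subalg fun_FdB ?T"
  proof (rule gen_subalg_eqI)
    fix f assume "f \<in> to_FdB ` ?S"
    then obtain n where f: "f = fps_nth chart n" by (auto simp: to_FdB_a_elt)
    have "fps_nth coord_series n \<in> gen_subalg fun_FdB ?T" for n
    proof (cases "n = 0")
      case True
      then show ?thesis using T.zero_in by (simp only: coord_series_def fps_nth_Abs_fps if_True simp_thms)
    next
      case False
      then have "coord n \<in> ?T" by auto
      with False show ?thesis by (simp only: coord_series_def fps_nth_Abs_fps if_False gen_subalg.gen)
    qed
    then show "f \<in> gen_subalg fun_FdB ?T" unfolding f chart_def by (rule T.fps_compose_in)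
  next
    fix f assume "f \<in> ?T"
    then obtain n where n: "n \<ge> 1" "f = coord n" by blast
    have "fps_nth chart m \<in> gen_subalg fun_FdB (to_FdB ` ?S)" for m
    proof (cases "m = 0")
      case True
      then show ?thesis using S.zero_in by (simp only: chart_0)
    next
      case False
      then have "to_FdB (a_elt 1 \<beta> m) \<in> to_FdB ` ?S" by (intro imageI) auto
      then show ?thesis by (simp only: to_FdB_a_elt gen_subalg.gen)
    qed
    then have "fps_nth coord_series n \<in> gen_subalg fun_FdB (to_FdB ` ?S)"
      unfolding coord_series_eq by (rule S.fps_compose_in)
    with n show "f \<in> gen_subalg fun_FdB (to_FdB ` ?S)" by (simp only: coord_series_def fps_nth_Abs_fps) simp
  qed
  finally show ?thesis by (simp only: carr_H_FdB)
qed

lemma to_FdB_cofactor: "to_FdB (DS_cofactor \<beta> n j) P = fps_nth ((1 - fps_const \<beta> * chart_at P) * series P ^ j) n"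
proof -
  interpret h: ring_morphism "\<lambda>x. to_FdB x P" by (rule to_FdB_at_morphism)
  have X: "fps_map (\<lambda>x. to_FdB x P) (DS_solution 1 \<beta>) = chart_at P"
    by (rule fps_ext) (simp add: chart_at_def flip: to_FdB_a_elt, simp add: a_elt_def)
  have "fps_map (\<lambda>x. to_FdB x P) ((1 - fps_const (ck_scalar \<beta>) * DS_solution 1 \<beta>) *
     (fps_X * ((fps_map ck_scalar R) oo (DS_solution 1 \<beta>))) ^ j)
     = (1 - fps_const \<beta> * chart_at P) * series P ^ j"
    by (simp add: h.fps_map_mult h.fps_map_diff h.fps_map_one h.fps_map_const h.fps_map_power h.fps_map_X
        h.fps_map_compose fps_map_map X to_FdB_scalar series_chart)
  then show ?thesis unfolding DS_cofactor_def R_def[symmetric] by (metis fps_map_nth)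
qed

text \<open>
  By the expansion of a coefficient of a product with a composite, the coproduct of the generator
  \<open>a_elt 1 \<beta> n\<close> and the function \<open>(P, Q) \<mapsto> chart_at (Q \<circ> P)\<close> in degree \<open>n\<close> are given by matching sums.
\<close>

theorem A_iso_FdB: "A_hopf 1 \<beta> \<cong>\<^sub>H H_FdB"
  unfolding hopf_iso_def
proof (intro exI[of _ to_FdB] conjI)
  let ?S = "{a_elt 1 \<beta> n | n. n \<ge> 1}"
  show "bij_betw to_FdB (carr (A_hopf 1 \<beta>)) (carr H_FdB)"
    using to_FdB_inj to_FdB_image by (simp add: bij_betw_def carr_A_hopf)
  show alg: "alg_hom (A_hopf 1 \<beta>) H_FdB to_FdB"
    unfolding alg_hom_def
    using to_FdB_image ring_morphism.h_one[OF to_FdB_morphism]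
    by (auto simp: carr_A_hopf ring_morphism.h_add[OF to_FdB_morphism] ring_morphism.h_mult[OF to_FdB_morphism] to_FdB_scalar)
  show "coalg_hom (A_hopf 1 \<beta>) H_FdB to_FdB"
  proof (rule coalg_hom_from_generators[OF A_hopf_model H_FdB_model alg, where S = ?S])
    show "carr (A_hopf 1 \<beta>) = gen_subalg (A_hopf 1 \<beta>) ?S"
      by (simp only: carr_A_hopf gen_subalg_A_hopf)
    fix x assume "x \<in> ?S"
    then obtain n where x: "x = a_elt 1 \<beta> n" by blast
    show "counit H_FdB (to_FdB x) = counit (A_hopf 1 \<beta>) x"
      using arg_cong[OF chart_at_identity, of "\<lambda>f. fps_nth f n"]
      by (simp add: x to_FdB_a_elt chart_at_def lookup_a_elt_not_tree)
    let ?ts = "(a_elt 1 \<beta> n, 1) # map (\<lambda>j. (DS_cofactor \<beta> n j, a_elt 1 \<beta> j)) [0..<Suc n]"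
    have "1 \<in> A_carrier \<beta>" using subalgebra.one_in[OF H_CK_subalgebra] .
    then have "set ?ts \<subseteq> carr (A_hopf 1 \<beta>) \<times> carr (A_hopf 1 \<beta>)"
      unfolding carr_A_hopf using a_elt_in_A DS_cofactor_in_A by auto
    moreover have "comult (A_hopf 1 \<beta>) x = (\<Sum>(a, b)\<leftarrow>?ts. tens (A_hopf 1 \<beta>) a b)"
      by (simp add: x comult_a_elt sum_list_upt comp_def del: upt_Suc)
    moreover have "comult H_FdB (to_FdB x) = (\<Sum>(a, b)\<leftarrow>?ts. tens H_FdB (to_FdB a) (to_FdB b))"
    proof (rule ext, clarify)
      fix P Q :: "'k diffeo"
      have P0: "fps_nth (series P) 0 = 0" using series[of P] by simp
      have at: "to_FdB (a_elt 1 \<beta> m) P = fps_nth (chart_at P) m" for m P by (simp add: to_FdB_a_elt chart_at_def)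
      have "to_FdB (a_elt 1 \<beta> n) (diffeo_comp Q P) = fps_nth (chart_at P) n +
          (\<Sum>j\<le>n. fps_nth (chart_at Q) j * to_FdB (DS_cofactor \<beta> n j) P)"
        unfolding at chart_at_comp fps_add_nth fps_mult_compose_nth_eq_sum[OF P0] to_FdB_cofactor ..
      also have "\<dots> = (\<Sum>(a, b)\<leftarrow>?ts. to_FdB a P * to_FdB b Q)"
        by (simp add: sum_list_upt comp_def at mult.commute ring_morphism.h_one[OF to_FdB_morphism] del: upt_Suc)
      also have "\<dots> = (\<Sum>(a, b)\<leftarrow>?ts. tens H_FdB (to_FdB a) (to_FdB b)) (P, Q)"
        using hopf_model.ev2_tensor_sum[OF H_FdB_model, of to_FdB to_FdB ?ts P Q] by simp
      finally show "comult H_FdB (to_FdB x) (P, Q) = (\<Sum>(a, b)\<leftarrow>?ts. tens H_FdB (to_FdB a) (to_FdB b)) (P, Q)"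
        by (simp only: x H_FdB_simps)
    qed
    ultimately show "\<exists>ts. set ts \<subseteq> carr (A_hopf 1 \<beta>) \<times> carr (A_hopf 1 \<beta>) \<and>
        comult (A_hopf 1 \<beta>) x = (\<Sum>(a, b)\<leftarrow>ts. tens (A_hopf 1 \<beta>) a b) \<and>
        comult H_FdB (to_FdB x) = (\<Sum>(a, b)\<leftarrow>ts. tens H_FdB (to_FdB a) (to_FdB b))" by blast
  qed
qed

end

text \<open>
  Cocommutativity would make the coefficient of \<open>h\<^sup>4\<close> in a composite independent of the order of the
  factors, but for \<open>h + h\<^sup>2\<close> and \<open>h + h\<^sup>3\<close> it is \<open>2\<close> in one order and \<open>3\<close> in the other.
\<close>

lemma H_FdB_not_cocommutative: "\<not> cocommutative (H_FdB :: ('k::field_char_0, _, _) hopf)"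
proof
  assume "cocommutative (H_FdB :: ('k, _, _) hopf)"
  moreover have "coord 3 \<in> carr (H_FdB :: ('k, _, _) hopf)"
    unfolding carr_H_FdB by (rule gen_subalg.gen) auto
  ultimately obtain ts where ts: "comult H_FdB (coord 3) = (\<Sum>(a, b)\<leftarrow>ts. tens H_FdB a b)"
    "comult H_FdB (coord 3) = (\<Sum>(a, b)\<leftarrow>ts. tens H_FdB b (a :: 'k diffeo \<Rightarrow> 'k))"
    unfolding cocommutative_def by blast
  have swap: "(\<Sum>(a, b)\<leftarrow>ts. tens H_FdB b (a :: 'k diffeo \<Rightarrow> 'k)) (P, Q) = (\<Sum>(a, b)\<leftarrow>ts. tens H_FdB a b) (Q, P)" for P Q ts
    by (induction ts) (auto simp: mult.commute)
  have comm: "coord 3 (diffeo_comp Q P) = coord 3 (diffeo_comp P (Q :: 'k diffeo))" for P Q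
    using ts swap[of ts P Q] by (metis H_FdB_simps(6))
  define p q :: "'k fps" where "p = fps_X + fps_X ^ 2" and "q = fps_X + fps_X ^ 3"
  have "fps_nth p 0 = 0 \<and> fps_nth p 1 = 1" "fps_nth q 0 = 0 \<and> fps_nth q 1 = 1"
    by (simp_all add: p_def q_def fps_X_power_iff)
  then have s: "series (Diffeo p) = p" "series (Diffeo q) = q" by (simp_all add: Diffeo_inverse)
  have p0: "fps_nth p 0 = 0" and q0: "fps_nth q 0 = 0" by (simp_all add: p_def q_def)
  have "(p oo q) = fps_X + fps_X ^ 2 + fps_X ^ 3 + 2 * fps_X ^ 4 + fps_X ^ 6"
    by (simp add: p_def fps_compose_add_distrib fps_compose_power[symmetric] q0)
      (simp add: q_def power2_eq_square power3_eq_cube power_numeral_reduce algebra_simps)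
  moreover have "(q oo p) = fps_X + fps_X ^ 2 + fps_X ^ 3 + 3 * fps_X ^ 4 + 3 * fps_X ^ 5 + fps_X ^ 6"
    by (simp add: q_def fps_compose_add_distrib fps_compose_power[symmetric] p0)
      (simp add: p_def power2_eq_square power3_eq_cube power_numeral_reduce algebra_simps)
  moreover have "fps_nth (p oo q) 4 = fps_nth (q oo p) 4"
    using comm[of "Diffeo p" "Diffeo q"] by (simp add: coord_def series_diffeo_comp s)
  ultimately have "(2 :: 'k) = 3"
    by (simp add: fps_X_power_iff numeral_fps_const)
  then show False by simp
qed


section \<open>The ring of power series in countably many variables\<close>

lemma finite_submultisets [simp]: "finite {p. p \<subseteq># m}"
proof (induction m)
  case (add x m)
  have "{p. p \<subseteq># add_mset x m} \<subseteq> {p. p \<subseteq># m} \<union> add_mset x ` {p. p \<subseteq># m}"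
  proof
    fix p assume "p \<in> {p. p \<subseteq># add_mset x m}"
    then have p: "p \<subseteq># add_mset x m" by simp
    show "p \<in> {p. p \<subseteq># m} \<union> add_mset x ` {p. p \<subseteq># m}"
    proof (cases "x \<in># p")
      case True
      then obtain q where "p = add_mset x q" by (blast dest: multi_member_split)
      then show ?thesis using p by auto
    next
      case False
      then have "count p y \<le> count m y" for y
        using mset_subset_eq_count[OF p, of y] by (cases "y = x") (auto simp: not_in_iff)
      then show ?thesis by (simp add: subseteq_mset_def)
    qed
  qed
  moreover have "finite ({p. p \<subseteq># m} \<union> add_mset x ` {p. p \<subseteq># m})" using add by simp
  ultimately show ?case by (rule finite_subset)
qed simp

lemma submultiset_diff:
  assumes "q \<subseteq># p" "p \<subseteq># m"
  shows "m - (m - p) = p" "p - q \<subseteq># m - q" "m - q - (p - q) = m - p"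
proof -
  have le: "count q x \<le> count p x" "count p x \<le> count m x" for x
    using assms by (simp_all add: mset_subset_eq_count)
  show "m - (m - p) = p" by (simp add: multiset_eq_iff le)
  show "p - q \<subseteq># m - q" by (simp add: subseteq_mset_def le diff_le_mono)
  show "m - q - (p - q) = m - p" by (simp add: multiset_eq_iff le)
qed

lemma series_mult_nonzeroE:
  assumes "series_mult f g m \<noteq> 0"
  obtains p where "p \<subseteq># m" "f p * g (m - p) \<noteq> 0"
proof -
  have "\<exists>p. p \<subseteq># m \<and> f p * g (m - p) \<noteq> 0"
  proof (rule ccontr)
    assume "\<not> ?thesis"
    then have "series_mult f g m = 0" unfolding series_mult_def by (intro sum.neutral) auto
    then show False using assms by simp
  qed
  then show thesis using that by blast
qed

lemma series_mult_commute: "series_mult f g = series_mult g (f :: nat multiset \<Rightarrow> 'k::comm_ring_1)"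
proof
  fix m
  show "series_mult f g m = series_mult g f m"
    unfolding series_mult_def
    by (rule sum.reindex_bij_witness[where i = "\<lambda>p. m - p" and j = "\<lambda>p. m - p"])
      (auto simp: submultiset_diff(1)[OF empty_le] mult.commute)
qed

lemma series_mult_assoc:
  "series_mult (series_mult f g) h = series_mult f (series_mult g (h :: nat multiset \<Rightarrow> 'k::comm_ring_1))"
proof
  fix m
  have "series_mult (series_mult f g) h m
      = (\<Sum>(p, q)\<in>(SIGMA p:{p. p \<subseteq># m}. {q. q \<subseteq># p}). f q * g (p - q) * h (m - p))"
    by (simp add: series_mult_def sum_distrib_right sum.Sigma)
  also have "\<dots> = (\<Sum>(q, r)\<in>(SIGMA q:{q. q \<subseteq># m}. {r. r \<subseteq># m - q}). f q * (g r * h (m - q - r)))"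
    by (rule sum.reindex_bij_witness[where i = "\<lambda>(q, r). (q + r, q)" and j = "\<lambda>(p, q). (q, p - q)"])
      (auto simp: submultiset_diff subset_mset.add_diff_inverse mult.assoc subset_mset.le_diff_conv2
        add.commute intro: subset_mset.order_trans)
  also have "\<dots> = series_mult f (series_mult g h) m"
    by (simp add: series_mult_def sum_distrib_left sum.Sigma)
  finally show "series_mult (series_mult f g) h m = series_mult f (series_mult g h) m" .
qed

lemma series_mult_one: "series_mult (\<lambda>m. if m = {#} then c else 0) f = (\<lambda>m. c * f m)"
  for f :: "nat multiset \<Rightarrow> 'k::comm_ring_1"
proof
  fix m
  have "series_mult (\<lambda>m. if m = {#} then c else 0) f m = (\<Sum>p | p \<subseteq># m. if p = {#} then c * f m else 0)"
    unfolding series_mult_def by (rule sum.cong) auto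
  then show "series_mult (\<lambda>m. if m = {#} then c else 0) f m = c * f m" by simp
qed

text \<open>
  A copy of the functions on monomials that carries the convolution product as its ring
  multiplication; on plain functions multiplication is pointwise.
\<close>

typedef 'k mseries = "UNIV :: (nat multiset \<Rightarrow> 'k) set"
  morphisms coeff_at Mseries by simp

lemma coeff_at_Mseries [simp]: "coeff_at (Mseries f) = f"
  by (rule Mseries_inverse) simp

lemma mseries_eq_iff: "f = g \<longleftrightarrow> coeff_at f = coeff_at g"
  by (rule coeff_at_inject[symmetric])

instantiation mseries :: (comm_ring_1) comm_ring_1
begin

definition zero_mseries :: "'a mseries" where "0 = Mseries (\<lambda>_. 0)"
definition one_mseries :: "'a mseries" where "1 = Mseries (\<lambda>m. if m = {#} then 1 else 0)"
definition plus_mseries :: "'a mseries \<Rightarrow> 'a mseries \<Rightarrow> 'a mseries" where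
  "f + g = Mseries (\<lambda>m. coeff_at f m + coeff_at g m)"
definition minus_mseries :: "'a mseries \<Rightarrow> 'a mseries \<Rightarrow> 'a mseries" where
  "f - g = Mseries (\<lambda>m. coeff_at f m - coeff_at g m)"
definition uminus_mseries :: "'a mseries \<Rightarrow> 'a mseries" where
  "- f = Mseries (\<lambda>m. - coeff_at f m)"
definition times_mseries :: "'a mseries \<Rightarrow> 'a mseries \<Rightarrow> 'a mseries" where
  "f * g = Mseries (series_mult (coeff_at f) (coeff_at g))"

instance
proof
  fix a b c :: "'a mseries"
  show "a * b * c = a * (b * c)" by (simp add: times_mseries_def series_mult_assoc)
  show "a * b = b * a" by (simp add: times_mseries_def series_mult_commute)
  show "1 * a = a" by (simp add: mseries_eq_iff times_mseries_def one_mseries_def series_mult_one)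
  show "(a + b) * c = a * c + b * c"
    by (simp add: mseries_eq_iff times_mseries_def plus_mseries_def series_mult_def fun_eq_iff distrib_right sum.distrib)
  show "0 \<noteq> (1 :: 'a mseries)"
    by (auto simp: mseries_eq_iff zero_mseries_def one_mseries_def fun_eq_iff)
qed (simp_all add: mseries_eq_iff zero_mseries_def plus_mseries_def minus_mseries_def uminus_mseries_def fun_eq_iff)

end

lemma coeff_at_zero: "coeff_at 0 = (\<lambda>m. 0)"
  and coeff_at_one: "coeff_at 1 = (\<lambda>m. if m = {#} then 1 else 0)"
  and coeff_at_add: "coeff_at (f + g) m = coeff_at f m + coeff_at g m"
  and coeff_at_mult: "coeff_at (f * g) = series_mult (coeff_at f) (coeff_at g)"
  by (simp_all add: zero_mseries_def one_mseries_def plus_mseries_def minus_mseries_def times_mseries_def)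

lemma coeff_at_sum: "coeff_at (sum f A) m = (\<Sum>i\<in>A. coeff_at (f i) m)"
  by (induction A rule: infinite_finite_induct) (simp_all add: coeff_at_zero coeff_at_add)

definition ms_scalar :: "'k::comm_ring_1 \<Rightarrow> 'k mseries" where
  "ms_scalar c = Mseries (\<lambda>m. if m = {#} then c else 0)"

lemma coeff_at_scalar_mult: "coeff_at (ms_scalar c * f) m = c * coeff_at f m"
  by (simp add: coeff_at_mult ms_scalar_def series_mult_one)

lemma ms_scalars: "scalars (ms_scalar :: 'k::field_char_0 \<Rightarrow> _)"
proof unfold_locales
  fix x y :: 'k
  show "ms_scalar (x * y) = ms_scalar x * ms_scalar y"
    unfolding mseries_eq_iff by (simp add: fun_eq_iff coeff_at_scalar_mult) (simp add: ms_scalar_def)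
qed (simp_all add: mseries_eq_iff ms_scalar_def one_mseries_def plus_mseries_def fun_eq_iff)


section \<open>The Hopf algebra of symmetric functions\<close>

text \<open>
  The monomial in one alphabet that the doubling of the alphabet attaches to a pair of monomials.
  It is a bijection that respects divisibility, which makes the doubling multiplicative.
\<close>

definition split_alphabet :: "nat multiset \<Rightarrow> nat multiset \<Rightarrow> nat multiset" where
  "split_alphabet p q = image_mset (\<lambda>i. 2 * i) p + image_mset (\<lambda>i. 2 * i + 1) q"

lemma alphabet_doubling_eq: "alphabet_doubling f (p, q) = f (split_alphabet p q)"
  by (simp add: alphabet_doubling_def split_alphabet_def)

lemma split_alphabet_left: "image_mset (\<lambda>i. i div 2) (filter_mset even (split_alphabet p q)) = p"
  and split_alphabet_right: "image_mset (\<lambda>i. i div 2) (filter_mset odd (split_alphabet p q)) = q"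
proof -
  have "filter_mset even (image_mset (\<lambda>i. 2 * i) p) = image_mset (\<lambda>i. 2 * i) p"
    "filter_mset odd (image_mset (\<lambda>i. 2 * i) p) = {#}"
    by (induction p) simp_all
  moreover have "filter_mset even (image_mset (\<lambda>i. 2 * i + 1) q) = {#}"
    "filter_mset odd (image_mset (\<lambda>i. 2 * i + 1) q) = image_mset (\<lambda>i. 2 * i + 1) q"
    by (induction q) simp_all
  ultimately show "image_mset (\<lambda>i. i div 2) (filter_mset even (split_alphabet p q)) = p"
    "image_mset (\<lambda>i. i div 2) (filter_mset odd (split_alphabet p q)) = q"
    by (simp_all add: split_alphabet_def multiset.map_comp comp_def)
qed

lemma split_alphabet_surj: "\<exists>p q. r = split_alphabet p q"
proof (induction r)
  case empty
  show ?case by (rule exI[of _ "{#}"], rule exI[of _ "{#}"]) (simp add: split_alphabet_def)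
next
  case (add x r)
  then obtain p q where r: "r = split_alphabet p q" by blast
  show ?case
  proof (cases "even x")
    case True
    then have "add_mset x r = split_alphabet (add_mset (x div 2) p) q" by (simp add: r split_alphabet_def)
    then show ?thesis by blast
  next
    case False
    then have "add_mset x r = split_alphabet p (add_mset (x div 2) q)" by (simp add: r split_alphabet_def)
    then show ?thesis by blast
  qed
qed

lemma split_alphabet_add: "split_alphabet p q + split_alphabet p' q' = split_alphabet (p + p') (q + q')"
  by (simp add: split_alphabet_def)

lemma split_alphabet_subset:
  "split_alphabet p' q' \<subseteq># split_alphabet p q \<longleftrightarrow> p' \<subseteq># p \<and> q' \<subseteq># q"
proof
  assume a: "split_alphabet p' q' \<subseteq># split_alphabet p q"
  show "p' \<subseteq># p \<and> q' \<subseteq># q"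
    using image_mset_subseteq_mono[OF multiset_filter_mono[OF a, of even], of "\<lambda>i. i div 2"]
      image_mset_subseteq_mono[OF multiset_filter_mono[OF a, of odd], of "\<lambda>i. i div 2"]
    by (simp only: split_alphabet_left split_alphabet_right)
next
  assume "p' \<subseteq># p \<and> q' \<subseteq># q"
  then show "split_alphabet p' q' \<subseteq># split_alphabet p q"
    by (simp add: split_alphabet_def image_mset_subseteq_mono subset_mset.add_mono)
qed

lemma split_alphabet_diff:
  assumes "p' \<subseteq># p" "q' \<subseteq># q"
  shows "split_alphabet p q - split_alphabet p' q' = split_alphabet (p - p') (q - q')"
proof -
  have "split_alphabet p q = split_alphabet p' q' + split_alphabet (p - p') (q - q')"
    using assms by (simp add: split_alphabet_add subset_mset.add_diff_inverse)
  then show ?thesis by simp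
qed

lemma sum_split_alphabet:
  "(\<Sum>r | r \<subseteq># split_alphabet p q. f r) = (\<Sum>p' | p' \<subseteq># p. \<Sum>q' | q' \<subseteq># q. f (split_alphabet p' q'))"
proof -
  have "(\<Sum>p' | p' \<subseteq># p. \<Sum>q' | q' \<subseteq># q. f (split_alphabet p' q'))
      = (\<Sum>x\<in>{p'. p' \<subseteq># p} \<times> {q'. q' \<subseteq># q}. f (split_alphabet (fst x) (snd x)))"
    by (simp add: sum.cartesian_product split_def)
  also have "\<dots> = (\<Sum>r | r \<subseteq># split_alphabet p q. f r)"
  proof (rule sum.reindex_bij_betw[where h = "\<lambda>x. split_alphabet (fst x) (snd x)"])
    show "bij_betw (\<lambda>x. split_alphabet (fst x) (snd x)) ({p'. p' \<subseteq># p} \<times> {q'. q' \<subseteq># q})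
        {r. r \<subseteq># split_alphabet p q}"
      unfolding bij_betw_def
    proof
      show "inj_on (\<lambda>x. split_alphabet (fst x) (snd x)) ({p'. p' \<subseteq># p} \<times> {q'. q' \<subseteq># q})"
        by (rule inj_onI) (metis prod.collapse split_alphabet_left split_alphabet_right)
      show "(\<lambda>x. split_alphabet (fst x) (snd x)) ` ({p'. p' \<subseteq># p} \<times> {q'. q' \<subseteq># q})
          = {r. r \<subseteq># split_alphabet p q}"
      proof (intro equalityI subsetI)
        fix r assume r: "r \<in> {r. r \<subseteq># split_alphabet p q}"
        obtain p' q' where "r = split_alphabet p' q'" using split_alphabet_surj by blast
        with r show "r \<in> (\<lambda>x. split_alphabet (fst x) (snd x)) ` ({p'. p' \<subseteq># p} \<times> {q'. q' \<subseteq># q})"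
          by (intro image_eqI[of _ _ "(p', q')"]) (simp_all add: split_alphabet_subset)
      qed (auto simp: split_alphabet_subset)
    qed
  qed
  finally show ?thesis ..
qed

definition two_alphabet_mult ::
    "(nat multiset \<times> nat multiset \<Rightarrow> 'k::comm_ring_1) \<Rightarrow> (nat multiset \<times> nat multiset \<Rightarrow> 'k) \<Rightarrow>
      nat multiset \<times> nat multiset \<Rightarrow> 'k" where
  "two_alphabet_mult F G = (\<lambda>(p, q). \<Sum>p' | p' \<subseteq># p. \<Sum>q' | q' \<subseteq># q. F (p', q') * G (p - p', q - q'))"

lemma alphabet_doubling_mult:
  "alphabet_doubling (series_mult f g) = two_alphabet_mult (alphabet_doubling f) (alphabet_doubling g)"
  by (auto simp: fun_eq_iff two_alphabet_mult_def alphabet_doubling_eq series_mult_def sum_split_alphabet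
      split_alphabet_diff)

lemma symmetric_function_add:
  fixes f g :: "nat multiset \<Rightarrow> 'k::comm_ring_1"
  assumes "symmetric_function f" "symmetric_function g"
  shows "symmetric_function (\<lambda>m. f m + g m)"
proof -
  obtain d e where "\<forall>m. f m \<noteq> 0 \<longrightarrow> size m \<le> d" "\<forall>m. g m \<noteq> 0 \<longrightarrow> size m \<le> e"
    using assms by (auto simp: symmetric_function_def)
  then have "\<forall>m. f m + g m \<noteq> 0 \<longrightarrow> size m \<le> max d e" by (metis add.right_neutral max.coboundedI1 max.coboundedI2)
  then have "\<exists>d. \<forall>m. f m + g m \<noteq> 0 \<longrightarrow> size m \<le> d" by blast
  with assms show ?thesis by (simp add: symmetric_function_def)
qed

lemma symmetric_function_scale:
  "symmetric_function f \<Longrightarrow> symmetric_function (\<lambda>m. c * f m)"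
  for f :: "nat multiset \<Rightarrow> 'k::comm_ring_1"
  unfolding symmetric_function_def by (metis mult_zero_right)

lemma symmetric_function_mult:
  fixes f g :: "nat multiset \<Rightarrow> 'k::comm_ring_1"
  assumes f: "symmetric_function f" and g: "symmetric_function g"
  shows "symmetric_function (series_mult f g)"
  unfolding symmetric_function_def
proof (intro conjI)
  obtain d e where d: "\<And>m. f m \<noteq> 0 \<Longrightarrow> size m \<le> d" and e: "\<And>m. g m \<noteq> 0 \<Longrightarrow> size m \<le> e"
    using f g by (auto simp: symmetric_function_def)
  have "size m \<le> d + e" if "series_mult f g m \<noteq> 0" for m
  proof -
    from that obtain p where p: "p \<subseteq># m" "f p * g (m - p) \<noteq> 0"
      by (rule series_mult_nonzeroE)
    then have "f p \<noteq> 0" "g (m - p) \<noteq> 0" by auto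
    then have "size p \<le> d" "size (m - p) \<le> e" using d e by auto
    moreover have "size m = size p + size (m - p)"
      using p(1) by (metis size_union subset_mset.add_diff_inverse)
    ultimately show ?thesis by simp
  qed
  then show "\<exists>d. \<forall>m. series_mult f g m \<noteq> 0 \<longrightarrow> size m \<le> d" by blast
  show "\<forall>\<sigma> m. bij \<sigma> \<longrightarrow> series_mult f g (image_mset \<sigma> m) = series_mult f g m"
  proof (intro allI impI)
    fix \<sigma> :: "nat \<Rightarrow> nat" and m assume \<sigma>: "bij \<sigma>"
    then have inj: "inj \<sigma>" and inv: "inv \<sigma> \<circ> \<sigma> = id" "\<sigma> \<circ> inv \<sigma> = id"
      by (auto simp: bij_is_inj bij_imp_bij_inv fun_eq_iff bij_is_surj surj_f_inv_f)
    have cancel: "image_mset (inv \<sigma>) (image_mset \<sigma> p) = p" "image_mset \<sigma> (image_mset (inv \<sigma>) p) = p" for p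
      by (simp_all add: multiset.map_comp inv)
    have sym: "f (image_mset \<sigma> p) = f p" "g (image_mset \<sigma> p) = g p" for p
      using f g \<sigma> by (auto simp: symmetric_function_def)
    show "series_mult f g (image_mset \<sigma> m) = series_mult f g m"
      unfolding series_mult_def
    proof (rule sum.reindex_bij_witness[where i = "image_mset \<sigma>" and j = "image_mset (inv \<sigma>)"])
      fix p assume p: "p \<in> {p. p \<subseteq># image_mset \<sigma> m}"
      have "g (image_mset \<sigma> m - p) = g (m - image_mset (inv \<sigma>) p)"
        using sym(2)[of "m - image_mset (inv \<sigma>) p"] by (simp add: image_mset_diff_if_inj[OF inj] cancel)
      then show "f (image_mset (inv \<sigma>) p) * g (m - image_mset (inv \<sigma>) p) = f p * g (image_mset \<sigma> m - p)"
        using sym(1)[of "image_mset (inv \<sigma>) p"] by (simp add: cancel)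
      show "image_mset (inv \<sigma>) p \<in> {p. p \<subseteq># m}"
        using p image_mset_subseteq_mono[of p "image_mset \<sigma> m" "inv \<sigma>"] by (simp add: cancel)
    qed (auto simp: cancel image_mset_subseteq_mono)
  qed
qed

lemma symmetric_function_one: "symmetric_function (\<lambda>m. if m = {#} then 1 else 0)"
  by (auto simp: symmetric_function_def)

lemma Sym_simps [simp]: "carr Sym = {f. symmetric_function f}" "unit Sym = (\<lambda>m. if m = {#} then 1 else 0)"
  "mult Sym = series_mult" "scal Sym c f = (\<lambda>m. c * f m)" "tens Sym f g (p, q) = f p * g q"
  "counit Sym f = f {#}" "comult Sym = alphabet_doubling"
  by (simp_all add: Sym_def)

lemma Sym_model: "hopf_model (Sym :: ('k::field_char_0, _, _) hopf) (\<lambda>f m. f m) (\<lambda>F p. F p) two_alphabet_mult"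
proof unfold_locales
  show "two_alphabet_mult (tens Sym x y) (tens Sym x' y') = tens Sym (mult Sym x x') (mult Sym y y')"
    for x y x' y' :: "nat multiset \<Rightarrow> 'k"
    by (auto simp: fun_eq_iff two_alphabet_mult_def series_mult_def sum_product mult.assoc mult.left_commute intro!: sum.cong)
  show "comult Sym (unit Sym) = tens Sym (unit Sym) (unit Sym :: nat multiset \<Rightarrow> 'k)"
    by (auto simp: fun_eq_iff alphabet_doubling_eq split_alphabet_def)
  show "x + y \<in> carr Sym" if "x \<in> carr Sym" "y \<in> carr Sym" for x y :: "nat multiset \<Rightarrow> 'k"
    using symmetric_function_add[of x y] that by (simp add: plus_fun_def)
qed (auto simp: symmetric_function_scale symmetric_function_mult symmetric_function_one fun_eq_iff
    two_alphabet_mult_def distrib_right distrib_left sum.distrib alphabet_doubling_eq alphabet_doubling_mult series_mult_def)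


definition elementary :: "nat \<Rightarrow> nat multiset \<Rightarrow> 'k::comm_ring_1" where
  "elementary n m = (if size m = n \<and> (\<forall>i. count m i \<le> 1) then 1 else 0)"

lemma count_image_mset_inj: "inj f \<Longrightarrow> count (image_mset f m) (f x) = count m x"
  by (induction m) (auto dest: injD)

lemma symmetric_elementary: "symmetric_function (elementary n)"
  unfolding symmetric_function_def
proof (intro conjI allI impI)
  show "\<exists>d. \<forall>m. elementary n m \<noteq> 0 \<longrightarrow> size m \<le> d" by (auto simp: elementary_def)
  fix \<sigma> :: "nat \<Rightarrow> nat" and m assume "bij \<sigma>"
  then have "(\<forall>i. count (image_mset \<sigma> m) i \<le> 1) \<longleftrightarrow> (\<forall>i. count (image_mset \<sigma> m) (\<sigma> i) \<le> 1)"
    by (metis bij_pointE)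
  also have "\<dots> \<longleftrightarrow> (\<forall>i. count m i \<le> 1)"
    using \<open>bij \<sigma>\<close> by (simp add: count_image_mset_inj bij_is_inj)
  finally show "elementary n (image_mset \<sigma> m) = elementary n m" by (simp add: elementary_def)
qed

lemma elementary_0: "elementary 0 = (\<lambda>m. if m = {#} then 1 else 0)"
  by (auto simp: elementary_def fun_eq_iff)

text \<open>
  A squarefree monomial of degree \<open>n\<close> in the doubled alphabet is a pair of squarefree monomials whose
  degrees add up to \<open>n\<close>, and the degree of the second one singles out the only nonzero summand.
\<close>

lemma alphabet_doubling_elementary:
  "alphabet_doubling (elementary n) (p, q) = (\<Sum>j\<le>n. elementary (n - j) p * elementary j q)"
proof -
  have odd: "count (image_mset (\<lambda>i. 2 * i + 1) q) (2 * j) = 0" "count (image_mset (\<lambda>i. 2 * i) p) (2 * j + 1) = 0"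
    for p q :: "nat multiset" and j
    by (auto simp: count_eq_zero_iff) presburger+
  have "count (split_alphabet p q) (2 * j) = count p j" "count (split_alphabet p q) (2 * j + 1) = count q j" for j
    using count_image_mset_inj[of "\<lambda>i. 2 * i" p j] count_image_mset_inj[of "\<lambda>i. 2 * i + 1" q j] odd
    by (simp_all add: split_alphabet_def inj_on_def)
  then have "(\<forall>i. count (split_alphabet p q) i \<le> 1) \<longleftrightarrow> (\<forall>i. count p i \<le> 1) \<and> (\<forall>i. count q i \<le> 1)"
    by (metis oddE evenE)
  then have "alphabet_doubling (elementary n) (p, q) = (if size p + size q = n \<and>
      (\<forall>i. count p i \<le> 1) \<and> (\<forall>i. count q i \<le> 1) then 1 else 0 :: 'a)"
    by (simp add: alphabet_doubling_eq elementary_def) (simp add: split_alphabet_def)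
  also have "\<dots> = (\<Sum>j\<le>n. if j = size q then elementary (n - j) p * elementary j q else 0)"
    by (auto simp: elementary_def)
  also have "\<dots> = (\<Sum>j\<le>n. elementary (n - j) p * elementary j q)"
    by (rule sum.cong) (auto simp: elementary_def)
  finally show ?thesis .
qed


section \<open>Lowest terms of symmetric functions\<close>

text \<open>
  The multiset order compares the exponents of two monomials from the largest variable downwards.
  It is a monomial order and a well-order, also in infinitely many variables, which is why lowest
  rather than highest terms are used.
\<close>

definition low_term :: "(nat multiset \<Rightarrow> 'k::zero) \<Rightarrow> nat multiset \<Rightarrow> 'k \<Rightarrow> bool" where
  "low_term f m c \<longleftrightarrow> f m = c \<and> (\<forall>p<m. f p = 0)"

lemma low_term_mult:
  fixes f g :: "nat multiset \<Rightarrow> 'k::comm_ring_1"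
  assumes f: "low_term f m c" and g: "low_term g n d"
  shows "low_term (series_mult f g) (m + n) (c * d)"
proof -
  have zero: "f p * g (k - p) = 0" if "p \<subseteq># k" "k \<le> m + n" "p \<noteq> m \<or> k \<noteq> m + n" for p k
  proof (rule ccontr)
    assume "f p * g (k - p) \<noteq> 0"
    then have "f p \<noteq> 0" "g (k - p) \<noteq> 0" by auto
    then have le: "m \<le> p" "n \<le> k - p" using f g by (auto simp: low_term_def not_le[symmetric])
    have k: "k = p + (k - p)" using that(1) by (simp add: subset_mset.add_diff_inverse)
    have "m + n \<le> k" using add_mono[OF le] k by simp
    then have eq: "k = m + n" using that(2) by simp
    then have "m < p" using that(3) le(1) by auto
    then have "m + n < p + (k - p)" using le(2) by (rule add_less_le_mono)
    then show False using k eq by simp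
  qed
  have "series_mult f g (m + n) = (\<Sum>p\<in>{m}. f p * g (m + n - p))"
    unfolding series_mult_def by (rule sum.mono_neutral_right) (auto simp: zero)
  moreover have "series_mult f g k = 0" if "k < m + n" for k
    unfolding series_mult_def by (rule sum.neutral, clarify, rule zero) (use that in auto)
  ultimately show ?thesis using f g by (simp add: low_term_def)
qed

text \<open>
  Another squarefree monomial of degree \<open>n\<close> must contain a variable of index at least \<open>n\<close>, which
  makes it larger.
\<close>

lemma low_term_elementary: "low_term (elementary n) (mset_set {..<n}) 1"
  unfolding low_term_def
proof (intro conjI allI impI)
  show "elementary n (mset_set {..<n}) = (1 :: 'a)" by (simp add: elementary_def count_mset_set')
  fix p assume less: "p < mset_set {..<n}"
  show "elementary n p = (0 :: 'a)"
  proof (rule ccontr)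
    assume "elementary n p \<noteq> (0 :: 'a)"
    then have size: "size p = n" and count: "count p i \<le> 1" for i by (auto simp: elementary_def split: if_splits)
    define A where "A = set_mset p"
    have p: "p = mset_set A"
    proof (rule multiset_eqI)
      fix i show "count p i = count (mset_set A) i"
      proof (cases "i \<in># p")
        case True
        then have "0 < count p i" by simp
        with count[of i] have "count p i = 1" by linarith
        then show ?thesis using True by (simp add: A_def count_mset_set')
      qed (simp add: A_def count_mset_set' count_eq_zero_iff)
    qed
    have A: "finite A" "card A = n" using size by (simp_all add: A_def[symmetric] p) (simp add: A_def)
    have neq: "A \<noteq> {..<n}" using less p by auto
    then have "\<not> A \<subseteq> {..<n}" using A card_subset_eq[of "{..<n}" A] by auto
    then obtain x where x: "x \<in> A" "n \<le> x" by (auto simp: subset_iff not_less)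
    have "mset_set {..<n} < p"
      unfolding less_multiset\<^sub>H\<^sub>O
    proof (intro conjI allI impI)
      show "mset_set {..<n} \<noteq> p" using less by auto
      fix y assume "count p y < count (mset_set {..<n}) y"
      then have "y < n" by (simp add: count_mset_set' split: if_splits)
      then show "\<exists>x>y. count (mset_set {..<n}) x < count p x"
        using x A by (intro exI[of _ x]) (simp add: p)
    qed
    then show False using less by simp
  qed
qed

definition elementary_series :: "nat \<Rightarrow> 'k::comm_ring_1 mseries" where
  "elementary_series n = Mseries (elementary n)"

text \<open>
  The lowest monomial of a product of elementary symmetric functions. The entry \<open>n\<close> of \<open>M\<close> stands for
  the elementary symmetric function of degree \<open>n + 1\<close>, whose lowest monomial is \<open>x\<^sub>0 \<dots> x\<^sub>n\<close>; the shift
  matches the numbering of ladders.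
\<close>

definition lead :: "nat multiset \<Rightarrow> nat multiset" where
  "lead M = (\<Sum>n\<in>#M. mset_set {..n})"

lemma low_term_elementary_prod: "low_term (coeff_at (\<Prod>n\<in>#M. elementary_series (Suc n))) (lead M) (1 :: 'k::comm_ring_1)"
proof (induction M)
  case empty
  show ?case by (simp add: lead_def low_term_def coeff_at_one)
next
  case (add n M)
  then show ?case
    using low_term_mult[OF low_term_elementary[of "Suc n"] add]
    by (simp add: coeff_at_mult elementary_series_def lead_def lessThan_Suc_atMost)
qed

lemma count_lead: "count (lead M) i = size (filter_mset (\<lambda>n. i \<le> n) M)"
  by (induction M) (auto simp: lead_def count_mset_set')

text \<open>
  The multiplicity of \<open>i\<close> in \<open>M\<close> is the difference of the exponents of \<open>i\<close> and \<open>i + 1\<close> in \<open>lead M\<close>.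
\<close>

lemma inj_lead: "inj lead"
proof (rule injI, rule multiset_eqI)
  fix M N i assume eq: "lead M = lead N"
  have "count (lead M) i = count (lead M) (Suc i) + count M i" for M
    unfolding count_lead by (induction M) auto
  from this[of M] this[of N] show "count M i = count N i" by (simp add: eq)
qed

definition decreasing :: "nat multiset \<Rightarrow> bool" where
  "decreasing m \<longleftrightarrow> (\<forall>i. count m (Suc i) \<le> count m i)"

lemma decreasing_mono: "decreasing m \<Longrightarrow> i \<le> j \<Longrightarrow> count m j \<le> count m i"
  using lift_Suc_antimono_le[of "count m" i j] by (simp add: decreasing_def)

text \<open>
  If \<open>n\<close> is the largest variable of a monomial with decreasing exponents, then \<open>x\<^sub>0 \<dots> x\<^sub>n\<close> divides it, and the
  quotient again has decreasing exponents.
\<close>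

lemma decreasing_imp_lead: "decreasing m \<Longrightarrow> \<exists>M. lead M = m"
proof (induction "size m" arbitrary: m rule: less_induct)
  case less
  show ?case
  proof (cases "m = {#}")
    case True
    then show ?thesis by (intro exI[of _ "{#}"]) (simp add: lead_def)
  next
    case False
    define n where "n = Max (set_mset m)"
    have n: "n \<in># m" "\<And>i. i \<in># m \<Longrightarrow> i \<le> n" using False by (auto simp: n_def)
    have pos: "i \<in># m" if "i \<le> n" for i
      using decreasing_mono[OF less.prems that] n(1) by (metis count_greater_zero_iff le_trans less_le_trans)
    then have sub: "mset_set {..n} \<subseteq># m"
      by (auto simp: subseteq_mset_def count_mset_set' Suc_le_eq)
    define m' where "m' = m - mset_set {..n}"
    have m: "m = mset_set {..n} + m'" using sub by (simp add: m'_def subset_mset.add_diff_inverse)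
    have "decreasing m'" unfolding decreasing_def
    proof
      fix i
      have "count m (Suc i) \<le> count m i" using less.prems by (simp add: decreasing_def)
      moreover have "count m (Suc i) = 0" if "n \<le> i" using n(2)[of "Suc i"] that by (auto simp: count_eq_zero_iff)
      ultimately show "count m' (Suc i) \<le> count m' i"
        by (auto simp: m'_def count_mset_set')
    qed
    moreover have "size m' < size m" by (subst m) simp
    ultimately obtain M where "lead M = m'" using less.hyps by blast
    then have "lead (add_mset n M) = m" by (subst m) (simp add: lead_def)
    then show ?thesis by blast
  qed
qed

text \<open>
  If the exponent of \<open>i + 1\<close> exceeded that of \<open>i\<close>, exchanging the two variables would give a smaller
  monomial with the same coefficient.
\<close>

lemma symmetric_least_decreasing:
  assumes f: "symmetric_function f" and m: "f m \<noteq> 0" and least: "\<And>p. p < m \<Longrightarrow> f p = 0"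
  shows "decreasing m"
proof (rule ccontr)
  assume "\<not> decreasing m"
  then obtain i where i: "count m i < count m (Suc i)" by (auto simp: decreasing_def not_le)
  \<comment> \<open>The transposition of \<open>i\<close> and \<open>i + 1\<close>.\<close>
  define \<sigma> where "\<sigma> = id(i := Suc i, Suc i := i)"
  have \<sigma>\<sigma>: "\<sigma> \<circ> \<sigma> = id" by (auto simp: \<sigma>_def fun_eq_iff)
  then have "bij \<sigma>" by (metis o_bij)
  have count: "count (image_mset \<sigma> m) x = count m (\<sigma> x)" for x
    using count_image_mset_inj[OF bij_is_inj[OF \<open>bij \<sigma>\<close>], of m "\<sigma> x"] \<sigma>\<sigma> by (metis comp_apply id_apply)
  have "image_mset \<sigma> m < m"
    unfolding less_multiset\<^sub>H\<^sub>O
  proof (intro conjI allI impI)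
    show "image_mset \<sigma> m \<noteq> m"
    proof
      assume "image_mset \<sigma> m = m"
      then show False using count[of i] i by (simp add: \<sigma>_def)
    qed
    fix y assume y: "count m y < count (image_mset \<sigma> m) y"
    have "y = i"
    proof (rule ccontr)
      assume "y \<noteq> i"
      then show False using y i unfolding count by (auto simp: \<sigma>_def split: if_splits)
    qed
    then show "\<exists>x>y. count (image_mset \<sigma> m) x < count m x"
      unfolding count using i by (intro exI[of _ "Suc i"]) (simp add: \<sigma>_def)
  qed
  then have "f (image_mset \<sigma> m) = 0" by (rule least)
  then show False using f m \<open>bij \<sigma>\<close> by (simp add: symmetric_function_def)
qed

lemma elementary_prod_homogeneous:
  "coeff_at (\<Prod>n\<in>#M. elementary_series (Suc n)) m \<noteq> (0 :: 'k::comm_ring_1) \<Longrightarrow> size m = size (lead M)"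
proof (induction M arbitrary: m)
  case empty
  then show ?case by (simp add: coeff_at_one lead_def split: if_splits)
next
  case (add n M)
  have "series_mult (elementary (Suc n)) (coeff_at (\<Prod>n\<in>#M. elementary_series (Suc n))) m \<noteq> (0 :: 'k)"
    using add.prems by (simp add: coeff_at_mult elementary_series_def)
  then obtain p where p: "p \<subseteq># m"
      "elementary (Suc n) p * coeff_at (\<Prod>n\<in>#M. elementary_series (Suc n)) (m - p) \<noteq> (0 :: 'k)"
    by (rule series_mult_nonzeroE)
  then have "elementary (Suc n) p \<noteq> (0 :: 'k)" "coeff_at (\<Prod>n\<in>#M. elementary_series (Suc n)) (m - p) \<noteq> (0 :: 'k)" by auto
  then have "size p = Suc n" "size (m - p) = size (lead M)"
    using add.IH by (auto simp: elementary_def split: if_splits)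
  moreover have "size m = size p + size (m - p)"
    using p(1) by (metis size_union subset_mset.add_diff_inverse)
  ultimately show ?case by (simp add: lead_def)
qed

lemma elementary_prod_in_gen:
  "coeff_at (\<Prod>n\<in>#M. elementary_series (Suc n)) \<in> gen_subalg Sym {elementary n | n. n \<ge> 1}"
proof (induction M)
  case empty
  show ?case using gen_subalg.unit[of Sym] by (simp add: coeff_at_one)
next
  case (add n M)
  have "elementary (Suc n) \<in> gen_subalg Sym {elementary n | n. n \<ge> 1}" by (rule gen_subalg.gen) auto
  from gen_subalg.mult[OF this add] show ?case by (simp add: coeff_at_mult elementary_series_def)
qed

lemma gen_elementary_symmetric:
  assumes "f \<in> gen_subalg (Sym :: ('k::field_char_0, _, _) hopf) {elementary n | n. n \<ge> 1}"
  shows "symmetric_function f"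
  using assms
proof induction
  case (gen f)
  then show ?case by (auto simp: symmetric_elementary)
next
  case (add f g)
  then show ?case using symmetric_function_add[of f g] by (simp add: plus_fun_def)
qed (simp_all add: symmetric_function_one symmetric_function_scale symmetric_function_mult)

text \<open>
  The classical reduction: the lowest monomial of a symmetric function \<open>f\<close> has decreasing exponents,
  hence is the lowest monomial of some product of elementary symmetric functions, and subtracting a
  multiple of that product raises the lowest monomial without raising the degree bound. Only
  finitely many monomials with decreasing exponents respect the bound, so the process ends.
\<close>

theorem elementary_generate_Sym:
  "gen_subalg Sym {elementary n | n. n \<ge> 1} = carr (Sym :: ('k::field_char_0, _, _) hopf)"
proof (intro equalityI subsetI)
  let ?G = "gen_subalg (Sym :: ('k, _, _) hopf) {elementary n | n. n \<ge> 1}"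
  fix f assume "f \<in> ?G"
  then show "f \<in> carr Sym" by (simp add: gen_elementary_symmetric)
next
  let ?G = "gen_subalg (Sym :: ('k, _, _) hopf) {elementary n | n. n \<ge> 1}"
  fix f :: "nat multiset \<Rightarrow> 'k" assume "f \<in> carr Sym"
  then have "symmetric_function f" by simp
  then obtain d where "\<And>m. f m \<noteq> 0 \<Longrightarrow> size m \<le> d" by (auto simp: symmetric_function_def)
  \<comment> \<open>The monomials with decreasing exponents that are still to be treated.\<close>
  define T where "T f = {m. decreasing m \<and> size m \<le> d \<and> (\<exists>p\<le>m. f p \<noteq> 0)}" for f :: "nat multiset \<Rightarrow> 'k"
  have finite: "finite (T f)" for f
  proof (rule finite_subset)
    show "T f \<subseteq> (\<Union>n\<in>{..d}. multisets_of_size {..<d} n)"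
    proof
      fix m assume m: "m \<in> T f"
      have "i < d" if "i \<in># m" for i
      proof -
        have "mset_set {..i} \<subseteq># m"
        proof (unfold subseteq_mset_def, intro allI)
          fix j
          have "1 \<le> count m i" using that by (simp add: Suc_le_eq)
          moreover have "decreasing m" using m by (simp add: T_def)
          ultimately have "1 \<le> count m j" if "j \<le> i"
            using decreasing_mono[of m j i] that by linarith
          then show "count (mset_set {..i}) j \<le> count m j" by (simp add: count_mset_set')
        qed
        then have "Suc i \<le> size m" using size_mset_mono by fastforce
        then show ?thesis using m by (simp add: T_def)
      qed
      then show "m \<in> (\<Union>n\<in>{..d}. multisets_of_size {..<d} n)"
        using m by (auto simp: T_def multisets_of_size_def)
    qed
  qed auto
  show "f \<in> ?G"
    using \<open>symmetric_function f\<close> \<open>\<And>m. f m \<noteq> 0 \<Longrightarrow> size m \<le> d\<close>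
  proof (induction "card (T f)" arbitrary: f rule: less_induct)
    case less
    show ?case
    proof (cases "\<exists>m. f m \<noteq> 0")
      case False
      then have "f = scal Sym 0 (unit Sym)" by (simp add: fun_eq_iff)
      then show ?thesis by (simp only: gen_subalg.scal gen_subalg.unit)
    next
      case True
      define m where "m = (LEAST m. f m \<noteq> 0)"
      have m: "f m \<noteq> 0" unfolding m_def using True by (rule LeastI_ex)
      have least: "f p = 0" if "p < m" for p using that not_less_Least unfolding m_def by blast
      have dec: "decreasing m" using symmetric_least_decreasing[OF less.prems(1) m] least by blast
      then obtain M where M: "lead M = m" using decreasing_imp_lead by blast
      define e where "e = coeff_at (\<Prod>n\<in>#M. elementary_series (Suc n) :: 'k mseries)"
      have e: "e m = 1" "\<And>p. p < m \<Longrightarrow> e p = 0"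
        using low_term_elementary_prod[of M, where ?'k = 'k] by (simp_all add: low_term_def M e_def)
      have e_gen: "e \<in> ?G" unfolding e_def by (rule elementary_prod_in_gen)
      \<comment> \<open>Cancelling the lowest term of \<open>f\<close>.\<close>
      define g where "g = (\<lambda>p. f p + (- f m) * e p)"
      have g_low: "g p = 0" if "p \<le> m" for p
        using that e least[of p] by (cases "p = m") (auto simp: g_def)
      have "g \<in> ?G"
      proof (rule less.hyps)
        show "symmetric_function g"
          unfolding g_def
          by (rule symmetric_function_add[OF less.prems(1) symmetric_function_scale])
            (rule gen_elementary_symmetric[OF e_gen])
        show "size p \<le> d" if "g p \<noteq> 0" for p
        proof (cases "f p = 0")
          case True
          then have "e p \<noteq> 0" using that by (auto simp: g_def)
          then have "size p = size m" using elementary_prod_homogeneous[of M p] by (simp add: M e_def)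
          then show ?thesis using less.prems(2)[OF m] by simp
        qed (rule less.prems(2))
        have sub: "T g \<subseteq> T f"
        proof
          fix q assume q: "q \<in> T g"
          then obtain p where "p \<le> q" "g p \<noteq> 0" by (auto simp: T_def)
          then have "m \<le> q" using g_low[of p] by (meson le_cases order_trans)
          then show "q \<in> T f" using q m by (auto simp: T_def)
        qed
        have "m \<in> T f" "m \<notin> T g" using m dec less.prems(2) g_low by (auto simp: T_def)
        then show "card (T g) < card (T f)" using sub finite by (intro psubset_card_mono) auto
      qed
      from gen_subalg.add[OF this gen_subalg.scal[OF e_gen, of "f m"]]
      show ?thesis by (simp add: g_def plus_fun_def)
    qed
  qed
qed


section \<open>The isomorphism with the symmetric functions\<close>

definition to_Sym :: "'k::field_char_0 ck \<Rightarrow> 'k mseries" where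
  "to_Sym = ck_eval ms_scalar (ladder_value (\<lambda>n. elementary_series (Suc n)))"

lemma to_Sym_morphism: "ring_morphism to_Sym"
  unfolding to_Sym_def by (rule scalars.ck_eval_morphism[OF ms_scalars])

lemma to_Sym_scalar: "to_Sym (ck_scalar c) = ms_scalar c"
  unfolding to_Sym_def by (rule scalars.ck_eval_scalar[OF ms_scalars])

lemma to_Sym_a_elt: "n \<ge> 1 \<Longrightarrow> coeff_at (to_Sym (a_elt 1 \<beta> n)) = elementary n"
  by (cases n) (simp_all add: to_Sym_def scalars.ck_eval_a_elt[OF ms_scalars] elementary_series_def)

text \<open>
  Distinct products of elementary symmetric functions have distinct lowest monomials, so the product
  with the smallest one cannot cancel.
\<close>

lemma to_Sym_inj: "inj_on to_Sym (A_carrier \<beta>)"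
proof (rule inj_onI)
  fix x y assume xy: "x \<in> A_carrier \<beta>" "y \<in> A_carrier \<beta>" "to_Sym x = to_Sym y"
  interpret subalgebra ck_scalar "A_carrier \<beta>" by (rule H_CK_subalgebra)
  let ?z = "x - y"
  let ?S = "{M. image_mset ladder M \<in> keys ?z}"
  have zero: "to_Sym ?z = 0" using ring_morphism.h_diff[OF to_Sym_morphism, of x y] xy(3) by simp
  have "?S = {}"
  proof (rule ccontr)
    assume "?S \<noteq> {}"
    then obtain M where M: "M \<in> ?S" and least: "\<And>N. N \<in> ?S \<Longrightarrow> lead M \<le> lead N"
      using finite_ladder_keys[of ?z] by (metis (no_types, lifting) arg_min_if_finite(1) arg_min_least)
    have "coeff_at (\<Prod>n\<in>#N. elementary_series (Suc n)) (lead M) = (if N = M then 1 else 0 :: 'a)" if "N \<in> ?S" for N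
    proof (cases "N = M")
      case True
      then show ?thesis using low_term_elementary_prod[of M, where ?'k = 'a] by (simp add: low_term_def)
    next
      case False
      then have "lead M < lead N" using least[OF that] inj_lead by (auto simp: inj_eq order_less_le)
      then show ?thesis using False low_term_elementary_prod[of N, where ?'k = 'a] by (simp add: low_term_def)
    qed
    then have "coeff_at (to_Sym ?z) (lead M) =
        (\<Sum>N\<in>?S. if N = M then lookup ?z (image_mset ladder M) else 0)"
      unfolding to_Sym_def scalars.ck_eval_ladders[OF ms_scalars] coeff_at_sum coeff_at_scalar_mult
      by (intro sum.cong) auto
    also have "\<dots> = lookup ?z (image_mset ladder M)"
      using M finite_ladder_keys[of ?z] by simp
    finally show False using M zero by (simp add: coeff_at_zero in_keys_iff)
  qed
  then have "?z = 0" by (intro A_eq_0I[OF diff_in[OF xy(1,2)]]) (auto simp: in_keys_iff)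
  then show "x = y" by simp
qed

lemma fps_deriv_P_series_minus_1: "fps_deriv (P_series 1 (-1 :: 'k::field_char_0)) = 1"
proof (rule fps_ext)
  fix n
  have "fps_nth (P_series 1 (-1 :: 'k)) (Suc (Suc n)) = 0" for n
  proof (induction n)
    case 0
    show ?case using P_series_rec[of 1 1 "-1 :: 'k"] by (simp add: P_series_1)
  next
    case (Suc n)
    have "of_nat (Suc (Suc (Suc n))) * fps_nth (P_series 1 (-1 :: 'k)) (Suc (Suc (Suc n))) = 0"
      unfolding P_series_rec Suc by simp
    then show ?case by (metis mult_eq_0_iff of_nat_neq_0)
  qed
  then show "fps_nth (fps_deriv (P_series 1 (-1 :: 'k))) n = fps_nth 1 n"
    by (cases n) (simp_all add: P_series_1)
qed

text \<open>
  The homogeneous components of \<open>1 + X\<close>, which is group-like when \<open>\<beta> = -1\<close>: then \<open>P = 1 + h\<close> and \<open>P' = 1\<close>,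
  and the coproduct formula reads \<open>\<Delta> X = X \<otimes> 1 + (1 + X) \<otimes> X\<close>.
\<close>

definition grouplike_part :: "nat \<Rightarrow> 'k::field_char_0 ck" where
  "grouplike_part n = (if n = 0 then 1 else a_elt 1 (-1) n)"

lemma comult_a_elt_minus_1:
  assumes "n \<ge> 1"
  shows "ck_comult (a_elt 1 (-1 :: 'k::field_char_0) n)
    = (\<Sum>j\<le>n. ck_tens (grouplike_part (n - j)) (grouplike_part j))"
proof -
  have "1 - fps_const (ck_scalar (-1)) * DS_solution 1 (-1 :: 'k) = Abs_fps grouplike_part"
  proof (rule fps_ext)
    fix n
    show "fps_nth (1 - fps_const (ck_scalar (-1)) * DS_solution 1 (-1 :: 'k)) n = fps_nth (Abs_fps grouplike_part) n"
      by (cases n) (simp_all add: grouplike_part_def a_elt_def DS_solution_0 ck_scalar.h_minus)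
  qed
  then have "DS_cofactor (-1 :: 'k) n j = (if n < j then 0 else grouplike_part (n - j))" for j
    unfolding DS_cofactor_def fps_deriv_P_series_minus_1 ck_scalar.fps_map_one
    by (simp add: fps_X_power_mult_right_nth)
  then have "ck_comult (a_elt 1 (-1 :: 'k) n) = ck_tens (a_elt 1 (-1) n) 1 +
      (\<Sum>j\<le>n. ck_tens (grouplike_part (n - j)) (a_elt 1 (-1) j))"
    by (simp add: comult_a_elt)
  \<comment> \<open>The term \<open>a\<^sub>n \<otimes> 1\<close> fills the place \<open>j = 0\<close>, where \<open>a_elt\<close> is zero.\<close>
  also have "\<dots> = (\<Sum>j\<le>n. ck_tens (grouplike_part (n - j)) (grouplike_part j))"
    using assms by (simp add: sum.atMost_shift grouplike_part_def a_elt_0 ck_tens_zero)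
  finally show ?thesis .
qed

lemma grouplike_part_in_A: "grouplike_part n \<in> A_carrier (-1)"
  using subalgebra.one_in[OF H_CK_subalgebra] a_elt_in_A[of "-1" n] 
  by (cases "n = 0") (simp_all only: grouplike_part_def if_True if_False simp_thms)

lemma comult_a_elt_list:
  assumes "n \<ge> 1"
  defines "ts \<equiv> map (\<lambda>j. (grouplike_part (n - j), grouplike_part j)) [0..<Suc n]"
  shows "set ts \<subseteq> A_carrier (-1 :: 'k::field_char_0) \<times> A_carrier (-1)"
    and "ck_comult (a_elt 1 (-1 :: 'k) n) = (\<Sum>(a, b)\<leftarrow>ts. ck_tens a b)"
    and "ck_comult (a_elt 1 (-1 :: 'k) n) = (\<Sum>(a, b)\<leftarrow>ts. ck_tens b a)"
proof -
  show "set ts \<subseteq> A_carrier (-1 :: 'k) \<times> A_carrier (-1)"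
    using grouplike_part_in_A by (auto simp: ts_def)
  have sum: "(\<Sum>(a, b)\<leftarrow>ts. F a b) = (\<Sum>j\<le>n. F (grouplike_part (n - j)) (grouplike_part j))"
    for F :: "'k ck \<Rightarrow> 'k ck \<Rightarrow> 'k ck2"
    unfolding ts_def by (simp add: sum_list_upt comp_def del: upt_Suc)
  show 1: "ck_comult (a_elt 1 (-1 :: 'k) n) = (\<Sum>(a, b)\<leftarrow>ts. ck_tens a b)"
    using assms(1) by (simp add: sum comult_a_elt_minus_1)
  have "(\<Sum>(a, b)\<leftarrow>ts. ck_tens b a) = (\<Sum>j\<le>n. ck_tens (grouplike_part j) (grouplike_part (n - j)) :: 'k ck2)"
    by (rule sum)
  also have "\<dots> = (\<Sum>j\<le>n. ck_tens (grouplike_part (n - j)) (grouplike_part j))"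
    by (rule sum.reindex_bij_witness[where i = "\<lambda>j. n - j" and j = "\<lambda>j. n - j"]) auto
  finally show "ck_comult (a_elt 1 (-1 :: 'k) n) = (\<Sum>(a, b)\<leftarrow>ts. ck_tens b a)"
    unfolding 1 sum by simp
qed

theorem A_minus_1_cocommutative: "cocommutative (A_hopf 1 (-1 :: 'k::field_char_0))"
proof (rule cocommutative_from_generators[OF A_hopf_model])
  let ?S = "{a_elt 1 (-1 :: 'k) n | n. n \<ge> 1}"
  show "carr (A_hopf 1 (-1)) = gen_subalg (A_hopf 1 (-1)) ?S" by (simp only: carr_A_hopf gen_subalg_A_hopf)
  fix x assume "x \<in> ?S"
  then obtain n where "x = a_elt 1 (-1) n" "n \<ge> 1" by blast
  then show "\<exists>ts. set ts \<subseteq> carr (A_hopf 1 (-1)) \<times> carr (A_hopf 1 (-1)) \<and>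
      comult (A_hopf 1 (-1)) x = (\<Sum>(a, b)\<leftarrow>ts. tens (A_hopf 1 (-1)) a b) \<and>
      comult (A_hopf 1 (-1)) x = (\<Sum>(a, b)\<leftarrow>ts. tens (A_hopf 1 (-1)) b a)"
    unfolding carr_A_hopf A_hopf_simps using comult_a_elt_list[of n] by blast
qed

text \<open>
  The elementary symmetric functions, completed by \<open>1\<close> in degree zero, are the components of a
  group-like series as well.
\<close>

theorem A_minus_1_iso_Sym: "A_hopf 1 (-1 :: 'k::field_char_0) \<cong>\<^sub>H Sym"
  unfolding hopf_iso_def
proof (intro exI[of _ "\<lambda>x. coeff_at (to_Sym x)"] conjI)
  let ?\<phi> = "\<lambda>x :: 'k ck. coeff_at (to_Sym x)" and ?S = "{a_elt 1 (-1 :: 'k) n | n. n \<ge> 1}"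
  interpret h: ring_morphism to_Sym by (rule to_Sym_morphism)
  have hom: "?\<phi> 1 = unit Sym" "?\<phi> (x + y) = ?\<phi> x + ?\<phi> y" "?\<phi> (ck_scalar c * x) = scal Sym c (?\<phi> x)"
    "?\<phi> (x * y) = mult Sym (?\<phi> x) (?\<phi> y)" for x y c
    by (simp_all add: h.h_one h.h_add h.h_mult to_Sym_scalar coeff_at_one coeff_at_add coeff_at_mult
        coeff_at_scalar_mult fun_eq_iff flip: coeff_at_mult)
  have "?\<phi> ` ?S = {elementary n | n. n \<ge> 1}"
    by (auto simp: to_Sym_a_elt image_iff) (metis to_Sym_a_elt One_nat_def)
  moreover have "?\<phi> ` gen_subalg H_CK ?S = gen_subalg Sym (?\<phi> ` ?S)"
  proof (rule gen_subalg_image)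
    show "?\<phi> (scal H_CK c x) = scal Sym c (?\<phi> x)" for c x
      using hom(3)[of c x] by (simp only: H_CK_def hopf.simps scal_eq_scalar_mult)
  qed (simp_all only: H_CK_def hopf.simps hom(1,2,4))
  ultimately have image: "?\<phi> ` carr (A_hopf 1 (-1)) = carr Sym"
    by (simp only: carr_A_hopf elementary_generate_Sym)
  then show "bij_betw ?\<phi> (carr (A_hopf 1 (-1))) (carr Sym)"
    using to_Sym_inj[of "-1"] unfolding bij_betw_def carr_A_hopf
    by (auto simp: inj_on_def mseries_eq_iff)
  show alg: "alg_hom (A_hopf 1 (-1)) Sym ?\<phi>"
    unfolding alg_hom_def A_hopf_simps using image hom by blast
  show "coalg_hom (A_hopf 1 (-1)) Sym ?\<phi>"
  proof (rule coalg_hom_from_generators[OF A_hopf_model Sym_model alg, where S = ?S])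
    show "carr (A_hopf 1 (-1)) = gen_subalg (A_hopf 1 (-1)) ?S"
      by (simp only: carr_A_hopf gen_subalg_A_hopf)
    fix x assume "x \<in> ?S"
    then obtain n where x: "x = a_elt 1 (-1) n" "n \<ge> 1" by blast
    show "counit Sym (?\<phi> x) = counit (A_hopf 1 (-1)) x"
      using x(2) by (simp add: x(1) to_Sym_a_elt lookup_a_elt_not_tree) (simp add: elementary_def)
    let ?ts = "map (\<lambda>j. (grouplike_part (n - j), grouplike_part j :: 'k ck)) [0..<Suc n]"
    have g: "?\<phi> (grouplike_part j) = elementary j" for j
      by (simp add: grouplike_part_def to_Sym_a_elt h.h_one coeff_at_one elementary_0)
    have "comult Sym (?\<phi> x) = (\<Sum>(a, b)\<leftarrow>?ts. tens Sym (?\<phi> a) (?\<phi> b))"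
    proof (rule ext, clarify)
      fix p q
      have "alphabet_doubling (elementary n) (p, q) = (\<Sum>(a, b)\<leftarrow>?ts. ?\<phi> a p * ?\<phi> b q)"
        by (simp add: alphabet_doubling_elementary g sum_list_upt comp_def del: upt_Suc)
      also have "\<dots> = (\<Sum>(a, b)\<leftarrow>?ts. tens Sym (?\<phi> a) (?\<phi> b)) (p, q)"
        using hopf_model.ev2_tensor_sum[OF Sym_model, of ?\<phi> ?\<phi> ?ts p q] by simp
      finally show "comult Sym (?\<phi> x) (p, q) = (\<Sum>(a, b)\<leftarrow>?ts. tens Sym (?\<phi> a) (?\<phi> b)) (p, q)"
        using x by (simp only: Sym_simps to_Sym_a_elt)
    qed
    then show "\<exists>ts. set ts \<subseteq> carr (A_hopf 1 (-1)) \<times> carr (A_hopf 1 (-1)) \<and>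
        comult (A_hopf 1 (-1)) x = (\<Sum>(a, b)\<leftarrow>ts. tens (A_hopf 1 (-1)) a b) \<and>
        comult Sym (?\<phi> x) = (\<Sum>(a, b)\<leftarrow>ts. tens Sym (?\<phi> a) (?\<phi> b))"
      using comult_a_elt_list(1,2)[OF x(2)] unfolding x(1) carr_A_hopf A_hopf_simps by blast
  qed
qed


section \<open>The classification\<close>

lemma a_elt_scale: "a_elt \<alpha> \<beta> (Suc n) = ck_scalar (\<alpha> ^ n) * a_elt 1 \<beta> (Suc n)"
  for \<alpha> :: "'k::field_char_0"
  unfolding a_elt_def by (rule DS_solution_scale)

lemma A_hopf_scale:
  fixes \<alpha> \<beta> :: "'k::field_char_0"
  assumes "\<alpha> \<noteq> 0"
  shows "A_hopf \<alpha> \<beta> = A_hopf 1 \<beta>"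
proof -
  let ?S = "\<lambda>\<alpha> :: 'k. {a_elt \<alpha> \<beta> n | n. n \<ge> 1}"
  interpret C: subalgebra ck_scalar "gen_subalg H_CK (?S \<gamma>)" for \<gamma> by (rule H_CK_subalgebra)
  have inv_scale: "a_elt 1 \<beta> (Suc n) = ck_scalar (inverse \<alpha> ^ n) * a_elt \<alpha> \<beta> (Suc n)" for n
    using assms by (simp add: a_elt_scale[of \<alpha>] mult_single power_inverse mult.assoc[symmetric])
  have "gen_subalg H_CK (?S \<alpha>) = gen_subalg H_CK (?S 1)"
  proof (rule gen_subalg_eqI)
    fix x assume "x \<in> ?S \<alpha>"
    then obtain n where x: "x = a_elt \<alpha> \<beta> (Suc n)" by (auto simp: Suc_le_eq dest: gr0_implies_Suc)
    have "a_elt 1 \<beta> (Suc n) \<in> gen_subalg H_CK (?S 1)" by (rule gen_subalg.gen) auto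
    then show "x \<in> gen_subalg H_CK (?S 1)" unfolding x a_elt_scale[of \<alpha>] by (intro C.mult_in C.scalar_in)
  next
    fix x assume "x \<in> ?S 1"
    then obtain n where x: "x = a_elt 1 \<beta> (Suc n)" by (auto simp: Suc_le_eq dest: gr0_implies_Suc)
    have "a_elt \<alpha> \<beta> (Suc n) \<in> gen_subalg H_CK (?S \<alpha>)" by (rule gen_subalg.gen) auto
    then show "x \<in> gen_subalg H_CK (?S \<alpha>)" unfolding x inv_scale by (intro C.mult_in C.scalar_in)
  qed
  then show ?thesis by (simp add: A_hopf_def)
qed

lemma a_elt_1: "a_elt 1 \<beta> (Suc 0) = tree_elt (Node {#})" for \<beta> :: "'k::field_char_0"
  by (simp add: a_elt_Suc P_series_0 Bplus_single tree_elt_def del: single_one)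

lemma A_hopf_0: "A_hopf 0 \<beta> = K_bullet" for \<beta> :: "'k::field_char_0"
proof -
  let ?S = "{a_elt 0 \<beta> n | n. n \<ge> 1}" and ?b = "tree_elt (Node {#}) :: 'k ck"
  interpret C: subalgebra ck_scalar "gen_subalg H_CK {?b}" by (rule H_CK_subalgebra)
  have a: "a_elt 0 \<beta> (Suc n) = (if n = 0 then ?b else 0)" for n
    unfolding a_elt_scale[of 0] by (cases n) (simp_all add: a_elt_1)
  have "gen_subalg H_CK ?S = gen_subalg H_CK {?b}"
  proof (rule gen_subalg_eqI)
    fix x assume "x \<in> ?S"
    then obtain n where "x = a_elt 0 \<beta> (Suc n)" by (auto simp: Suc_le_eq dest: gr0_implies_Suc)
    then show "x \<in> gen_subalg H_CK {?b}"
      using C.zero_in gen_subalg.gen[of ?b "{?b}" H_CK] by (simp add: a)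
  next
    fix x assume "x \<in> {?b}"
    then have "x = a_elt 0 \<beta> 1" by (simp add: a)
    then have "x \<in> ?S" by blast
    then show "x \<in> gen_subalg H_CK ?S" by (rule gen_subalg.gen)
  qed
  then show ?thesis by (simp add: A_hopf_def K_bullet_def)
qed

lemma K_bullet_model: "hopf_model (K_bullet :: ('k::field_char_0, _, _) hopf) lookup lookup (*)"
  unfolding K_bullet_def by (rule H_CK_model)

lemma K_bullet_iso_refl: "K_bullet \<cong>\<^sub>H (K_bullet :: ('k::field_char_0, _, _) hopf)"
  unfolding hopf_iso_def
proof (intro exI[of _ "\<lambda>x. x"] conjI)
  let ?b = "tree_elt (Node {#}) :: 'k ck"
  show "bij_betw (\<lambda>x. x) (carr K_bullet) (carr (K_bullet :: ('k, _, _) hopf))" by (simp add: bij_betw_def)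
  show alg: "alg_hom K_bullet (K_bullet :: ('k, _, _) hopf) (\<lambda>x. x)" by (simp add: alg_hom_def)
  show "coalg_hom K_bullet (K_bullet :: ('k, _, _) hopf) (\<lambda>x. x)"
  proof (rule coalg_hom_from_generators[OF K_bullet_model K_bullet_model alg, where S = "{?b}"])
    show "carr K_bullet = gen_subalg K_bullet {?b}" by (simp add: K_bullet_def)
    fix x assume x: "x \<in> {?b}"
    show "counit K_bullet x = counit K_bullet x" ..
    have "?b = Bplus 1" by (metis Bplus_single single_one tree_elt_def)
    then have "ck_comult ?b = ck_tens ?b 1 + id_Bplus (ck_tens 1 1)"
      by (metis ck_comult_1 ck_comult_Bplus ck_tens_one)
    also have "id_Bplus (ck_tens 1 1) = ck_tens 1 ?b" unfolding id_Bplus_tens \<open>?b = Bplus 1\<close> ..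
    finally have "comult K_bullet x = (\<Sum>(a, b)\<leftarrow>[(?b, 1), (1, ?b)]. tens K_bullet a b)"
      using x by (simp add: K_bullet_def H_CK_def)
    moreover have "?b \<in> carr K_bullet" "1 \<in> carr (K_bullet :: ('k, _, _) hopf)"
      using gen_subalg.gen[of ?b "{?b}" H_CK] subalgebra.one_in[OF H_CK_subalgebra] by (simp_all add: K_bullet_def)
    ultimately show "\<exists>ts. set ts \<subseteq> carr K_bullet \<times> carr K_bullet \<and>
        comult K_bullet x = (\<Sum>(a, b)\<leftarrow>ts. tens K_bullet a b) \<and>
        comult K_bullet x = (\<Sum>(a, b)\<leftarrow>ts. tens K_bullet a b)"
      by (intro exI[of _ "[(?b, 1), (1, ?b)]"]) simp
  qed
qed

text \<open>
  A derivation of \<open>K_bullet\<close> relative to the counit is determined by its value at the single vertex,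
  so any two of them are proportional. On \<open>A_hopf 1 \<beta>\<close> the coefficients of the ladders with one and with
  two vertices are such derivations, and the first two generators separate them.
\<close>

lemma K_bullet_not_iso: "\<not> K_bullet \<cong>\<^sub>H A_hopf 1 (\<beta> :: 'k::field_char_0)"
proof
  assume "K_bullet \<cong>\<^sub>H A_hopf 1 \<beta>"
  then obtain \<phi> where bij: "bij_betw \<phi> (carr K_bullet) (carr (A_hopf 1 \<beta>))"
    and alg: "alg_hom K_bullet (A_hopf 1 \<beta>) \<phi>" and coalg: "coalg_hom K_bullet (A_hopf 1 \<beta>) \<phi>"
    by (auto simp: hopf_iso_def)
  let ?b = "tree_elt (Node {#}) :: 'k ck"
  have K: "carr K_bullet = gen_subalg H_CK {?b}" by (simp add: K_bullet_def)
  have \<phi>: "\<phi> 1 = 1" "\<And>x y. x \<in> carr K_bullet \<Longrightarrow> y \<in> carr K_bullet \<Longrightarrow> \<phi> (x + y) = \<phi> x + \<phi> y"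
    "\<And>c x. x \<in> carr K_bullet \<Longrightarrow> \<phi> (ck_scalar c * x) = ck_scalar c * \<phi> x"
    "\<And>x y. x \<in> carr K_bullet \<Longrightarrow> y \<in> carr K_bullet \<Longrightarrow> \<phi> (x * y) = \<phi> x * \<phi> y"
    "\<And>x. x \<in> carr K_bullet \<Longrightarrow> lookup (\<phi> x) {#} = lookup x {#}"
    using alg coalg by (auto simp: alg_hom_def coalg_hom_def K_bullet_def H_CK_def scal_eq_scalar_mult)
  have D: "lookup (\<phi> x) {#t#} = lookup x {#Node {#}#} * lookup (\<phi> ?b) {#t#}"
    if "x \<in> gen_subalg H_CK {?b}" for x t
    using that
  proof induction
    case (gen x)
    then show ?case by (simp add: tree_elt_def)
  next
    case unit
    show ?case by (simp add: H_CK_def \<phi>(1) lookup_one)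
  next
    case (add x y)
    then show ?case by (simp add: \<phi>(2) K lookup_add distrib_right)
  next
    case (scal x c)
    then show ?case by (simp add: H_CK_def scal_eq_scalar_mult \<phi>(3) K lookup_mult_tree lookup_single)
  next
    case (mult x y)
    then show ?case by (simp add: H_CK_def \<phi>(4,5) K lookup_mult_tree algebra_simps)
  qed
  have image: "\<phi> ` gen_subalg H_CK {?b} = A_carrier \<beta>"
    using bij by (simp only: bij_betw_def K carr_A_hopf)
  have surj: "a_elt 1 \<beta> n \<in> \<phi> ` gen_subalg H_CK {?b}" for n
    unfolding image by (rule a_elt_in_A)
  obtain x where x: "x \<in> gen_subalg H_CK {?b}" "\<phi> x = a_elt 1 \<beta> (Suc 0)" using surj[of "Suc 0"] by auto
  obtain y where y: "y \<in> gen_subalg H_CK {?b}" "\<phi> y = a_elt 1 \<beta> (Suc 1)" using surj[of "Suc 1"] by auto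
  have "lookup x {#Node {#}#} * lookup (\<phi> ?b) {#ladder 0#} = 1"
    "lookup x {#Node {#}#} * lookup (\<phi> ?b) {#ladder 1#} = 0"
    using D[OF x(1), of "ladder 0"] D[OF x(1), of "ladder 1"] unfolding x(2) lookup_a_elt_ladder by simp_all
  moreover have "lookup y {#Node {#}#} * lookup (\<phi> ?b) {#ladder 1#} = 1"
    using D[OF y(1), of "ladder 1"] unfolding y(2) lookup_a_elt_ladder by simp
  ultimately show False by auto
qed

lemma A_hopf_1_iso_FdB: "\<beta> \<noteq> -1 \<Longrightarrow> A_hopf 1 \<beta> \<cong>\<^sub>H H_FdB"
  by (rule faa_di_bruno_parameter.A_iso_FdB) (simp add: faa_di_bruno_parameter_def)

lemma A_minus_1_not_iso: "\<beta> \<noteq> -1 \<Longrightarrow> \<not> A_hopf 1 (-1) \<cong>\<^sub>H A_hopf 1 (\<beta> :: 'k::field_char_0)"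
  using hopf_iso_trans[OF A_hopf_model H_FdB_model _ A_hopf_1_iso_FdB]
    cocommutative_hopf_iso[OF A_hopf_model H_FdB_model _ A_minus_1_cocommutative] H_FdB_not_cocommutative
  by blast

lemma A_hopf_sym: "A_hopf \<alpha> \<beta> \<cong>\<^sub>H H \<Longrightarrow> H \<cong>\<^sub>H A_hopf \<alpha> \<beta>" for \<alpha> :: "'k::field_char_0"
  by (rule hopf_iso_sym[OF A_hopf_model])

lemma A_hopf_iso_same_class:
  assumes "\<beta> \<noteq> -1" "\<gamma> \<noteq> -1"
  shows "A_hopf 1 \<beta> \<cong>\<^sub>H A_hopf 1 (\<gamma> :: 'k::field_char_0)"
  using hopf_iso_trans[OF H_FdB_model A_hopf_model A_hopf_1_iso_FdB[OF assms(1)] A_hopf_sym[OF A_hopf_1_iso_FdB[OF assms(2)]]] .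

text \<open>
  Reflexivity includes that the coproduct of the subalgebra lies in its own tensor square. For
  \<open>\<alpha> \<noteq> 0\<close> this follows by composing an isomorphism to \<open>H_FdB\<close> or \<open>Sym\<close> with its inverse.
\<close>

lemma A_hopf_iso_refl: "A_hopf \<alpha> \<beta> \<cong>\<^sub>H A_hopf \<alpha> (\<beta> :: 'k::field_char_0)"
proof (cases "\<alpha> = 0")
  case True
  then show ?thesis by (simp add: A_hopf_0 K_bullet_iso_refl)
next
  case False
  show ?thesis
  proof (cases "\<beta> = -1")
    case True
    then show ?thesis
      using hopf_iso_trans[OF Sym_model A_hopf_model A_minus_1_iso_Sym A_hopf_sym[OF A_minus_1_iso_Sym]]
      by (simp add: A_hopf_scale[OF False])
  next
    case False
    then show ?thesis using A_hopf_iso_same_class[OF False False] by (simp add: A_hopf_scale[OF \<open>\<alpha> \<noteq> 0\<close>])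
  qed
qed

lemma A_family_cases:
  assumes "H \<in> A_family"
  obtains (FdB) \<beta> where "\<beta> \<noteq> -1" "H = A_hopf 1 \<beta>" | (Sym) "H = A_hopf 1 (-1)" | (bullet) "H = A_hopf 0 1"
proof -
  obtain \<alpha> \<beta> where "H = A_hopf \<alpha> \<beta>" using assms by (auto simp: A_family_def)
  then show thesis using that A_hopf_scale[of \<alpha> \<beta>] A_hopf_0[of \<beta>] A_hopf_0[of 1] by metis
qed

lemma A_family_equiv: "equiv A_family (iso_rel (A_family :: ('k::field_char_0, 'k ck, 'k ck2) hopf set))"
proof (rule equivI)
  show "iso_rel A_family \<subseteq> A_family \<times> (A_family :: ('k, 'k ck, 'k ck2) hopf set)" by (auto simp: iso_rel_def)
  show "refl_on A_family (iso_rel (A_family :: ('k, 'k ck, 'k ck2) hopf set))"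
    by (auto simp: refl_on_def iso_rel_def A_family_def A_hopf_iso_refl)
  show "sym (iso_rel (A_family :: ('k, 'k ck, 'k ck2) hopf set))"
    by (rule symI) (auto simp: iso_rel_def A_family_def intro: A_hopf_sym)
  show "trans (iso_rel (A_family :: ('k, 'k ck, 'k ck2) hopf set))"
    by (rule transI) (auto simp: iso_rel_def A_family_def intro: hopf_iso_trans[OF A_hopf_model A_hopf_model])
qed

lemma iso_classes:
  shows "\<beta> \<noteq> -1 \<Longrightarrow> iso_rel A_family `` {A_hopf 1 \<beta>} = {A_hopf 1 \<gamma> | \<gamma> :: 'k::field_char_0. \<gamma> \<noteq> -1}"
    and "iso_rel A_family `` {A_hopf 1 (-1 :: 'k)} = {A_hopf 1 (-1)}"
    and "iso_rel A_family `` {A_hopf 0 (1 :: 'k)} = {A_hopf 0 1}"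
proof -
  have mem: "A_hopf \<alpha> \<beta> \<in> A_family" for \<alpha> \<beta> :: 'k by (auto simp: A_family_def)
  have class_eq: "iso_rel A_family `` {H} = {H'. H' \<in> A_family \<and> H \<cong>\<^sub>H H'}" if "H \<in> A_family"
    for H :: "('k, 'k ck, 'k ck2) hopf" using that by (auto simp: iso_rel_def)
  have bullet: "\<not> A_hopf 0 1 \<cong>\<^sub>H A_hopf 1 \<gamma>" for \<gamma> :: 'k using K_bullet_not_iso by (simp add: A_hopf_0)
  have bullet': "\<not> A_hopf 1 \<gamma> \<cong>\<^sub>H A_hopf 0 1" for \<gamma> :: 'k using bullet A_hopf_sym by blast
  have Sym: "\<not> A_hopf 1 \<gamma> \<cong>\<^sub>H A_hopf 1 (-1)" if "\<gamma> \<noteq> -1" for \<gamma> :: 'k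
    using A_minus_1_not_iso[OF that] A_hopf_sym by blast
  show "iso_rel A_family `` {A_hopf 1 \<beta>} = {A_hopf 1 \<gamma> | \<gamma> :: 'k. \<gamma> \<noteq> -1}" if "\<beta> \<noteq> -1"
    unfolding class_eq[OF mem] using that
    by (auto simp: mem A_hopf_iso_same_class bullet' Sym elim!: A_family_cases)
  show "iso_rel A_family `` {A_hopf 1 (-1 :: 'k)} = {A_hopf 1 (-1)}"
    unfolding class_eq[OF mem]
    by (auto simp: mem A_hopf_iso_refl bullet' A_minus_1_not_iso elim!: A_family_cases)
  show "iso_rel A_family `` {A_hopf 0 (1 :: 'k)} = {A_hopf 0 1}"
    unfolding class_eq[OF mem]
    by (auto simp: mem A_hopf_iso_refl bullet elim!: A_family_cases)
qed

theorem corollary19: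
  shows "equiv A_family (iso_rel (A_family :: ('k::field_char_0, 'k ck, 'k ck2) hopf set))
    \<and> A_family // iso_rel A_family =
        {{A_hopf 1 \<beta> | \<beta> :: 'k. \<beta> \<noteq> -1}, {A_hopf 1 (-1)}, {A_hopf 0 1}}
    \<and> card (A_family // iso_rel (A_family :: ('k, 'k ck, 'k ck2) hopf set)) = 3
    \<and> (\<forall>\<beta>::'k. \<beta> \<noteq> -1 \<longrightarrow> A_hopf 1 \<beta> \<cong>\<^sub>H (H_FdB :: ('k, _, _) hopf))
    \<and> A_hopf 1 (-1 :: 'k) \<cong>\<^sub>H (Sym :: ('k, _, _) hopf)
    \<and> commutative (A_hopf 1 (-1 :: 'k))
    \<and> cocommutative (A_hopf 1 (-1 :: 'k))
    \<and> A_hopf 0 1 = (K_bullet :: ('k, 'k ck, 'k ck2) hopf)"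
proof (intro conjI allI impI)
  let ?F = "A_family :: ('k, 'k ck, 'k ck2) hopf set"
  let ?C = "{A_hopf 1 \<beta> | \<beta> :: 'k. \<beta> \<noteq> -1}"
  have mem: "A_hopf \<alpha> \<beta> \<in> ?F" for \<alpha> \<beta> by (auto simp: A_family_def)
  have zero: "(0 :: 'k) \<noteq> -1" by (metis neg_equal_0_iff_equal zero_neq_one)
  show quot: "?F // iso_rel ?F = {?C, {A_hopf 1 (-1)}, {A_hopf 0 1}}"
  proof (intro equalityI subsetI)
    fix X assume "X \<in> ?F // iso_rel ?F"
    then obtain H where "H \<in> ?F" "X = iso_rel ?F `` {H}" by (rule quotientE)
    then show "X \<in> {?C, {A_hopf 1 (-1)}, {A_hopf 0 1}}"
      by (cases H rule: A_family_cases) (simp_all add: iso_classes)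
  next
    fix X assume "X \<in> {?C, {A_hopf 1 (-1)}, {A_hopf 0 1}}"
    then have "X = iso_rel ?F `` {A_hopf 1 0} \<or> X = iso_rel ?F `` {A_hopf 1 (-1)} \<or> X = iso_rel ?F `` {A_hopf 0 1}"
      using iso_classes(1)[OF zero] iso_classes(2,3)[where ?'k = 'k] by simp
    then show "X \<in> ?F // iso_rel ?F" using mem quotientI by metis
  qed
  have neq: "A_hopf 1 0 \<noteq> A_hopf 1 (-1 :: 'k)" "A_hopf 0 1 \<noteq> A_hopf 1 \<gamma>" for \<gamma> :: 'k
    using A_minus_1_not_iso[OF zero] K_bullet_not_iso[of \<gamma>] A_hopf_iso_refl[of 1 "-1 :: 'k"] A_hopf_iso_refl[of 0 "1 :: 'k"]
    by (metis, metis A_hopf_0)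
  have C: "A_hopf 1 0 \<in> ?C" using zero by blast
  have "?C \<noteq> {H}" if "A_hopf 1 0 \<noteq> H" for H
  proof
    assume "?C = {H}"
    then have "A_hopf 1 0 \<in> {H}" using C by (simp only:)
    then show False using that by simp
  qed
  from this[OF neq(1)] this[OF neq(2)[of 0, symmetric]]
  have "?C \<noteq> {A_hopf 1 (-1)}" "?C \<noteq> {A_hopf 0 1}" "{A_hopf 1 (-1 :: 'k)} \<noteq> {A_hopf 0 1}"
    using neq(2)[of "-1"] by simp_all
  then show "card (?F // iso_rel ?F) = 3" unfolding quot by simp
  show "commutative (A_hopf 1 (-1 :: 'k))" by (simp add: commutative_def mult.commute)
qed (simp_all add: A_family_equiv A_hopf_1_iso_FdB A_minus_1_iso_Sym A_minus_1_cocommutative A_hopf_0)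

end
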